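(* For each $n\ge 1$ let $(\xi_{n,i})_{1\le i\le n}$ be a (possibly non-homogeneous) Markov chain and let $X_{n,i}=f_{n,i}(\xi_{n,i})$, $1\le i\le n$, where the $f_{n,i}$ are real-valued measurable functions, with $\mathbf{E}X_{n,i}=0$ and $\mathbf{E}X_{n,i}^2<\infty$. Let $\lambda_n$, $\sigma_n$, $b_n$ be as in the context, and assume $\lambda_n b_n>0$ for all $n\ge 1$. Suppose that for every $\varepsilon>0$ $$\frac{1}{\lambda_n\sigma_n^2}\sum_{i=1}^n\mathbf{E}\left[X_{n,i}^2\, I(|X_{n,i}|>\varepsilon h(\lambda_n)\sigma_n)\right]\to 0\quad\text{as } n\to\infty,$$ where $h(\lambda_n)=\lambda_n(1+|\ln(\lambda_n)|)^{-1}$. Then $$\frac{\sum_{i=1}^n X_{n,i}}{\sigma_n}\to N(0,1)\quad\text{in distribution as } n\to\infty.$$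
   Context: All Markov chains are defined on a probability space $(\Omega,\mathcal{K},\mathbf{P})$ and take values in a measurable space $(\mathcal{X},\mathcal{B}(\mathcal{X}))$. For sub-$\sigma$-algebras $\mathcal{A},\mathcal{B}$ of $\mathcal{K}$, the maximal coefficient of correlation is $$\rho(\mathcal{A},\mathcal{B})=\sup_{f\in \mathbf{L}_2(\mathcal{A}),\,g\in \mathbf{L}_2(\mathcal{B})}|\mathrm{corr}(f,g)|,$$ where $\mathbf{L}_2(\mathcal{A})$ is the space of square integrable $\mathcal{A}$-measurable random variables (the correlation is taken to be $0$ if one of the variables is a.s. constant). Define $\rho_{n,1}=\max_{1\le s\le n-1}\rho(\sigma(\xi_{n,s}),\sigma(\xi_{n,s+1}))$ (with $\rho_{1,1}=0$) and $\lambda_n=1-\rho_{n,1}$. Put $S_n=\sum_{i=1}^n X_{n,i}$, $\sigma_n^2=\mathrm{var}\,S_n$, $b_n^2=\sum_{i=1}^n \mathrm{var}\,X_{n,i}$, with $\sigma_n,b_n\ge 0$. The condition $\lambda_n b_n>0$ is equivalent to $\lambda_n\sigma_n>0$. $I(\cdot)$ denotes the indicator of an event and $N(0,1)$ is the standard normal law. *)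

theory Defs
  imports "HOL-Probability.Probability"
begin

text \<open>
  The sigma-algebra generated by the \<open>\<xi> i\<close>, \<open>i \<in> I\<close>. It carries the null measure, which is irrelevant:
  all uses depend only on its space and its measurable sets.
\<close>
definition gen_alg :: "'a measure \<Rightarrow> 'b measure \<Rightarrow> (nat \<Rightarrow> 'a \<Rightarrow> 'b) \<Rightarrow> nat set \<Rightarrow> 'a measure" where
  "gen_alg M S \<xi> I = sigma (space M) (\<Union>i\<in>I. {\<xi> i -` A \<inter> space M | A. A \<in> sets S})"

text \<open>
  Markov property with respect to the chain's own history, on an arbitrary measurable state space
  and with no homogeneity: for each \<open>i < n\<close> and each measurable \<open>A\<close>,
  \<open>P(\<xi> (i+1) \<in> A | \<xi> 1, \<dots>, \<xi> i) = P(\<xi> (i+1) \<in> A | \<xi> i)\<close> almost surely. No regular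
  version of the transition probabilities is required.
\<close>
definition markov_chain :: "'a measure \<Rightarrow> 'b measure \<Rightarrow> nat \<Rightarrow> (nat \<Rightarrow> 'a \<Rightarrow> 'b) \<Rightarrow> bool" where
  "markov_chain M S n \<xi> \<longleftrightarrow>
     (\<forall>i\<in>{1..n}. \<xi> i \<in> measurable M S) \<and>
     (\<forall>i\<in>{1..<n}. \<forall>A\<in>sets S. AE \<omega> in M.
        real_cond_exp M (gen_alg M S \<xi> {1..i}) (indicator (\<xi> (Suc i) -` A \<inter> space M)) \<omega> =
        real_cond_exp M (gen_alg M S \<xi> {i}) (indicator (\<xi> (Suc i) -` A \<inter> space M)) \<omega>)"

definition L2 :: "'a measure \<Rightarrow> 'a measure \<Rightarrow> ('a \<Rightarrow> real) set" where
  "L2 M F = {f \<in> borel_measurable F. integrable M (\<lambda>\<omega>. (f \<omega>)\<^sup>2)}"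

definition cov :: "'a measure \<Rightarrow> ('a \<Rightarrow> real) \<Rightarrow> ('a \<Rightarrow> real) \<Rightarrow> real" where
  "cov M f g = (\<integral>\<omega>. (f \<omega> - (\<integral>x. f x \<partial>M)) * (g \<omega> - (\<integral>x. g x \<partial>M)) \<partial>M)"

text \<open>
  Since \<open>x / 0 = 0\<close>, the correlation is \<open>0\<close> as soon as one of the variables has variance \<open>0\<close>,
  that is, is almost surely constant.
\<close>
definition corr :: "'a measure \<Rightarrow> ('a \<Rightarrow> real) \<Rightarrow> ('a \<Rightarrow> real) \<Rightarrow> real" where
  "corr M f g = cov M f g / (sqrt (prob_space.variance M f) * sqrt (prob_space.variance M g))"

text \<open>
  On a probability space, for sub-sigma-algebras \<open>A\<close> and \<open>B\<close>, the set below contains \<open>0\<close>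
  (constants) and is bounded by \<open>1\<close> (Cauchy-Schwarz), so the real supremum is the true one.
\<close>
definition max_corr :: "'a measure \<Rightarrow> 'a measure \<Rightarrow> 'a measure \<Rightarrow> real" where
  "max_corr M A B = Sup {\<bar>corr M f g\<bar> | f g. f \<in> L2 M A \<and> g \<in> L2 M B}"

definition rho1 :: "'a measure \<Rightarrow> 'b measure \<Rightarrow> nat \<Rightarrow> (nat \<Rightarrow> 'a \<Rightarrow> 'b) \<Rightarrow> real" where
  "rho1 M S n \<xi> =
     (if n \<le> 1 then 0
      else Max ((\<lambda>s. max_corr M (gen_alg M S \<xi> {s}) (gen_alg M S \<xi> {s + 1})) ` {1..n - 1}))"

definition lam :: "'a measure \<Rightarrow> 'b measure \<Rightarrow> nat \<Rightarrow> (nat \<Rightarrow> 'a \<Rightarrow> 'b) \<Rightarrow> real" where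
  "lam M S n \<xi> = 1 - rho1 M S n \<xi>"

definition sd_sum :: "'a measure \<Rightarrow> nat \<Rightarrow> (nat \<Rightarrow> 'a \<Rightarrow> real) \<Rightarrow> real" where
  "sd_sum M n X = sqrt (prob_space.variance M (\<lambda>\<omega>. \<Sum>i=1..n. X i \<omega>))"

definition b_coeff :: "'a measure \<Rightarrow> nat \<Rightarrow> (nat \<Rightarrow> 'a \<Rightarrow> real) \<Rightarrow> real" where
  "b_coeff M n X = sqrt (\<Sum>i=1..n. prob_space.variance M (X i))"

definition hfun :: "real \<Rightarrow> real" where
  "hfun l = l * inverse (1 + \<bar>ln l\<bar>)"

end

theory Submission
  imports Defs
begin

text \<open>
  Write \<open>r = 1 - \<lambda>\<^sub>n\<close>. Conditional expectations along the chain contract the \<open>L2\<close> norm of centred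
  functions by \<open>r\<close>, which gives \<open>\<lambda> b\<^sup>2 / 4 \<le> \<sigma>\<^sup>2 \<le> 2 b\<^sup>2 / \<lambda>\<close>. By the upper bound and the Lindeberg
  condition, the \<open>X\<^sub>i\<close> may be truncated at \<open>c = \<epsilon> h(\<lambda>) \<sigma>\<close>.
  The sum is then compared with the martingale with differences
  \<open>D\<^sub>k = \<theta>\<^sub>k\<^sub>+\<^sub>1 - E(\<theta>\<^sub>k\<^sub>+\<^sub>1 | \<xi>\<^sub>k)\<close>, \<open>\<theta>\<^sub>k = \<Sum>\<^sub>i\<^sub>\<le>\<^sub>m E(X\<^sub>k\<^sub>+\<^sub>i | \<xi>\<^sub>k)\<close>, where \<open>m\<close> is of order
  \<open>(1 + |ln \<lambda>|) / \<lambda>\<close>, so that \<open>r\<^sup>m\<close> is small compared with \<open>\<lambda>\<close> while \<open>B = (m + 1) c\<close>, which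
  bounds \<open>\<theta>\<close>, is still small compared with \<open>\<sigma>\<close>. For \<open>A = \<Sum> E D\<^sub>k\<^sup>2\<close> the quadratic variation satisfies
  \<open>Var (\<Sum> D\<^sub>k\<^sup>2) \<le> 40 B\<^sup>2 A\<close>: the covariances of terms at distance more than \<open>m\<close> are summable
  by mixing, and for those at distance at most \<open>m\<close> orthogonality replaces a block
  \<open>\<Sum> D\<^sub>j\<^sup>2\<close> by \<open>(\<Sum> D\<^sub>j)\<^sup>2\<close>, which telescopes and is at most \<open>16 B\<^sup>2\<close>. The martingale
  central limit theorem then applies.
\<close>

section \<open>Square integrable random variables\<close>

text \<open>The maximal correlation contracts conditional expectations in \<open>L2\<close> only: in
  sup norm each term of the potential keeps the bound of its summand and need not decay. Summed over
  all later times, the potential would be bounded only by a multiple of n c, hence the cut at m. The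
  cut leaves a remainder of second moment at most 8 r^(2m) sigma^2 / lambda^2, by the upper variance
  bound for the remainder and the lower one for the sum, so r^m must be small against lambda. Since
  r^m <= exp(-lambda m), this is where the logarithm enters, and h(lambda) is up to constants 1/m.
  The factor 1/lambda in the Lindeberg condition pays for the upper variance bound applied to the
  part removed by truncation. Mixing alone would bound the covariances of the D_k^2 with a loss of
  1/lambda; this is what makes the separate treatment of short distances necessary. All estimates
  are for a fixed row: the characteristic function of the normalised sum is within a multiple of a
  parameter delta of the Gaussian one, and n tends to infinity only at the very end.\<close>

definition norm2 :: "'a measure \<Rightarrow> ('a \<Rightarrow> real) \<Rightarrow> real" where
  "norm2 M f = sqrt (\<integral>\<omega>. (f \<omega>)\<^sup>2 \<partial>M)"

lemma norm2_nonneg [simp]: "0 \<le> norm2 M f"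
  by (simp add: norm2_def)

lemma norm2_power2: "(norm2 M f)\<^sup>2 = (\<integral>\<omega>. (f \<omega>)\<^sup>2 \<partial>M)"
  by (simp add: norm2_def)

lemma norm2_uminus [simp]: "norm2 M (\<lambda>\<omega>. - f \<omega>) = norm2 M f"
  by (simp add: norm2_def)

lemma norm2_cmult: "norm2 M (\<lambda>\<omega>. c * f \<omega>) = \<bar>c\<bar> * norm2 M f"
  by (simp add: norm2_def power_mult_distrib real_sqrt_mult)

lemma L2_measurable: "f \<in> L2 M F \<Longrightarrow> f \<in> borel_measurable F"
  and L2_square_integrable: "f \<in> L2 M F \<Longrightarrow> integrable M (\<lambda>\<omega>. (f \<omega>)\<^sup>2)"
  by (auto simp: L2_def)

lemma L2_subalgebra:
  assumes "subalgebra G F" "f \<in> L2 M F"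
  shows "f \<in> L2 M G"
  using assms measurable_from_subalg by (auto simp: L2_def)

lemma L2_product_integrable:
  assumes "f \<in> L2 M M" "g \<in> L2 M M"
  shows "integrable M (\<lambda>\<omega>. f \<omega> * g \<omega>)"
proof (rule Bochner_Integration.integrable_bound)
  show "integrable M (\<lambda>\<omega>. (f \<omega>)\<^sup>2 + (g \<omega>)\<^sup>2)"
    using assms by (auto simp: L2_def)
  show "(\<lambda>\<omega>. f \<omega> * g \<omega>) \<in> borel_measurable M"
    using assms by (auto simp: L2_def)
  have "\<bar>x * y\<bar> \<le> x\<^sup>2 + y\<^sup>2" for x y :: real
  proof -
    have "2 * (\<bar>x\<bar> * \<bar>y\<bar>) \<le> x\<^sup>2 + y\<^sup>2"
      using sum_squares_bound[of "\<bar>x\<bar>" "\<bar>y\<bar>"] by (simp add: mult.assoc)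
    moreover have "0 \<le> \<bar>x\<bar> * \<bar>y\<bar>"
      by simp
    ultimately show ?thesis
      unfolding abs_mult by linarith
  qed
  then show "AE \<omega> in M. norm (f \<omega> * g \<omega>) \<le> norm ((f \<omega>)\<^sup>2 + (g \<omega>)\<^sup>2)"
    by auto
qed

lemma L2_cmult: "f \<in> L2 M F \<Longrightarrow> (\<lambda>\<omega>. c * f \<omega>) \<in> L2 M F"
  by (auto simp: L2_def power_mult_distrib)

lemma L2_uminus: "f \<in> L2 M F \<Longrightarrow> (\<lambda>\<omega>. - f \<omega>) \<in> L2 M F"
  by (auto simp: L2_def)

lemma L2_zero: "(\<lambda>\<omega>. 0) \<in> L2 M F"
  by (auto simp: L2_def)

lemma L2_add:
  assumes "subalgebra M F" "f \<in> L2 M F" "g \<in> L2 M F"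
  shows "(\<lambda>\<omega>. f \<omega> + g \<omega>) \<in> L2 M F"
proof -
  have "f \<in> L2 M M" "g \<in> L2 M M"
    using assms L2_subalgebra by blast+
  then have "integrable M (\<lambda>\<omega>. (f \<omega>)\<^sup>2 + (g \<omega>)\<^sup>2 + 2 * (f \<omega> * g \<omega>))"
    using L2_product_integrable[of f M g] by (auto simp: L2_def)
  then have "integrable M (\<lambda>\<omega>. (f \<omega> + g \<omega>)\<^sup>2)"
    by (simp add: power2_sum algebra_simps)
  then show ?thesis
    using assms by (auto simp: L2_def)
qed

lemma L2_diff:
  assumes "subalgebra M F" "f \<in> L2 M F" "g \<in> L2 M F"
  shows "(\<lambda>\<omega>. f \<omega> - g \<omega>) \<in> L2 M F"
  using L2_add[OF assms(1,2) L2_uminus[OF assms(3)]] by simp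

lemma L2_sum:
  assumes "subalgebra M F" "\<And>i. i \<in> I \<Longrightarrow> f i \<in> L2 M F"
  shows "(\<lambda>\<omega>. \<Sum>i\<in>I. f i \<omega>) \<in> L2 M F"
  using assms(2) by (induction I rule: infinite_finite_induct) (auto simp: L2_zero intro!: L2_add assms(1))

lemma Cauchy_Schwarz_norm2:
  assumes "f \<in> L2 M M" "g \<in> L2 M M"
  shows "\<bar>\<integral>\<omega>. f \<omega> * g \<omega> \<partial>M\<bar> \<le> norm2 M f * norm2 M g"
proof -
  have f2: "integrable M (\<lambda>\<omega>. (f \<omega>)\<^sup>2)" and g2: "integrable M (\<lambda>\<omega>. (g \<omega>)\<^sup>2)"
    and [measurable]: "f \<in> borel_measurable M" "g \<in> borel_measurable M"
    using assms by (auto simp: L2_def)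
  note fg = L2_product_integrable[OF assms]
  define a where "a = norm2 M f"
  define b where "b = norm2 M g"
  have a2: "a\<^sup>2 = (\<integral>\<omega>. (f \<omega>)\<^sup>2 \<partial>M)" and b2: "b\<^sup>2 = (\<integral>\<omega>. (g \<omega>)\<^sup>2 \<partial>M)"
    by (simp_all add: a_def b_def norm2_power2)
  have quad: "0 \<le> s\<^sup>2 * a\<^sup>2 + 2 * s * t * (\<integral>\<omega>. f \<omega> * g \<omega> \<partial>M) + t\<^sup>2 * b\<^sup>2" for s t
  proof -
    have "0 \<le> (\<integral>\<omega>. (s * f \<omega> + t * g \<omega>)\<^sup>2 \<partial>M)"
      by simp
    also have "\<dots> = (\<integral>\<omega>. s\<^sup>2 * (f \<omega>)\<^sup>2 + (2 * s * t) * (f \<omega> * g \<omega>) + t\<^sup>2 * (g \<omega>)\<^sup>2 \<partial>M)"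
      by (simp add: power2_sum power_mult_distrib algebra_simps)
    also have "\<dots> = s\<^sup>2 * a\<^sup>2 + 2 * s * t * (\<integral>\<omega>. f \<omega> * g \<omega> \<partial>M) + t\<^sup>2 * b\<^sup>2"
      using f2 g2 fg by (simp add: a2 b2)
    finally show ?thesis .
  qed
  have nn: "a \<ge> 0" "b \<ge> 0"
    by (simp_all add: a_def b_def)
  show ?thesis
  proof (cases "a = 0 \<or> b = 0")
    case True
    then have "AE \<omega> in M. f \<omega> = 0 \<or> g \<omega> = 0"
      using integral_nonneg_eq_0_iff_AE[OF f2] integral_nonneg_eq_0_iff_AE[OF g2] a2 b2 by auto
    then have "(\<integral>\<omega>. f \<omega> * g \<omega> \<partial>M) = (\<integral>\<omega>. 0 \<partial>M)"
      by (intro integral_cong_AE) auto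
    then show ?thesis
      by (simp add: nn)
  next
    case False
    then have pos: "a * b > 0"
      using nn by simp
    \<comment> \<open>The combination \<open>s * f + t * g\<close> is tested with the crossed norms
      \<open>s = b\<close> and \<open>t = a\<close>, then \<open>t = - a\<close>; the quadratic
      expression then has the factor \<open>2 * (a * b)\<close>.\<close>
    have "0 \<le> 2 * (a * b) * (a * b + (\<integral>\<omega>. f \<omega> * g \<omega> \<partial>M))"
      using quad[of b a] by (simp add: algebra_simps power2_eq_square)
    moreover have "0 \<le> 2 * (a * b) * (a * b - (\<integral>\<omega>. f \<omega> * g \<omega> \<partial>M))"
      using quad[of b "- a"] by (simp add: algebra_simps power2_eq_square)
    ultimately show ?thesis
      using pos unfolding a_def[symmetric] b_def[symmetric]
      by (auto simp: zero_le_mult_iff abs_le_iff)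
  qed
qed

lemma norm2_triangle:
  assumes "f \<in> L2 M M" "g \<in> L2 M M"
  shows "norm2 M (\<lambda>\<omega>. f \<omega> + g \<omega>) \<le> norm2 M f + norm2 M g"
proof (rule power2_le_imp_le)
  have "(norm2 M (\<lambda>\<omega>. f \<omega> + g \<omega>))\<^sup>2 = (\<integral>\<omega>. (f \<omega>)\<^sup>2 + 2 * (f \<omega> * g \<omega>) + (g \<omega>)\<^sup>2 \<partial>M)"
    by (simp add: norm2_power2 power2_sum algebra_simps)
  also have "\<dots> = (norm2 M f)\<^sup>2 + 2 * (\<integral>\<omega>. f \<omega> * g \<omega> \<partial>M) + (norm2 M g)\<^sup>2"
    using assms L2_product_integrable[OF assms] by (simp add: norm2_power2 L2_def)
  also have "\<dots> \<le> (norm2 M f + norm2 M g)\<^sup>2"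
    using Cauchy_Schwarz_norm2[OF assms] by (simp add: power2_sum abs_le_iff)
  finally show "(norm2 M (\<lambda>\<omega>. f \<omega> + g \<omega>))\<^sup>2 \<le> (norm2 M f + norm2 M g)\<^sup>2" .
qed simp

lemma norm2_triangle_diff:
  assumes "f \<in> L2 M M" "g \<in> L2 M M"
  shows "norm2 M (\<lambda>\<omega>. f \<omega> - g \<omega>) \<le> norm2 M f + norm2 M g"
  using norm2_triangle[OF assms(1) L2_uminus[OF assms(2)]] by simp

context prob_space
begin

lemma subalgebra_self: "subalgebra M M"
  by (simp add: subalgebra_def)

lemma L2_integrable: "f \<in> L2 M M \<Longrightarrow> integrable M f"
  by (auto simp: L2_def intro: square_integrable_imp_integrable)

lemma L2_const: "(\<lambda>\<omega>. c) \<in> L2 M F"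
  by (auto simp: L2_def)

lemma L2_AE_bounded:
  assumes "subalgebra M F" "f \<in> borel_measurable F" "AE \<omega> in M. \<bar>f \<omega>\<bar> \<le> (c::real)"
  shows "f \<in> L2 M F"
proof -
  have "f \<in> borel_measurable M"
    using assms measurable_from_subalg by blast
  moreover have "AE \<omega> in M. norm ((f \<omega>)\<^sup>2) \<le> c\<^sup>2"
    using assms(3) by eventually_elim (simp add: abs_le_square_iff[symmetric])
  ultimately have "integrable M (\<lambda>\<omega>. (f \<omega>)\<^sup>2)"
    by (intro integrable_const_bound[where B = "c\<^sup>2"]) auto
  then show ?thesis
    using assms by (simp add: L2_def)
qed

lemma L2_mult_AE_bounded:
  assumes "subalgebra M F" "f \<in> borel_measurable F" "AE \<omega> in M. \<bar>f \<omega>\<bar> \<le> (c::real)" "g \<in> L2 M F"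
  shows "(\<lambda>\<omega>. f \<omega> * g \<omega>) \<in> L2 M F"
proof -
  have [measurable]: "f \<in> borel_measurable M" "g \<in> borel_measurable M"
    using assms measurable_from_subalg by (auto simp: L2_def)
  have "integrable M (\<lambda>\<omega>. (f \<omega> * g \<omega>)\<^sup>2)"
  proof (rule Bochner_Integration.integrable_bound)
    show "integrable M (\<lambda>\<omega>. c\<^sup>2 * (g \<omega>)\<^sup>2)"
      using assms by (simp add: L2_def)
    show "AE \<omega> in M. norm ((f \<omega> * g \<omega>)\<^sup>2) \<le> norm (c\<^sup>2 * (g \<omega>)\<^sup>2)"
      using assms(3)
      by eventually_elim (simp add: power_mult_distrib mult_right_mono abs_le_square_iff[symmetric])
  qed simp
  then show ?thesis
    using assms by (auto simp: L2_def)
qed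

lemma expectation_abs_le_norm2:
  assumes "f \<in> L2 M M"
  shows "(\<integral>\<omega>. \<bar>f \<omega>\<bar> \<partial>M) \<le> norm2 M f"
proof -
  have "(\<lambda>\<omega>. \<bar>f \<omega>\<bar>) \<in> L2 M M"
    using assms by (auto simp: L2_def)
  from Cauchy_Schwarz_norm2[OF this L2_const[of 1]] show ?thesis
    by (simp add: norm2_def prob_space)
qed

lemma sigma_finite_subalgebra_of: "subalgebra M F \<Longrightarrow> sigma_finite_subalgebra M F"
  by (intro finite_measure_subalgebra_is_sigma_finite finite_measure_subalgebra.intro
      finite_measure_subalgebra_axioms.intro finite_measure_axioms)

text \<open>Conditional Jensen inequality for the square.\<close>

lemma real_cond_exp_L2:
  assumes "subalgebra M F" "Y \<in> L2 M M"
  shows "real_cond_exp M F Y \<in> L2 M F"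
proof -
  interpret F: sigma_finite_subalgebra M F
    by (rule sigma_finite_subalgebra_of[OF assms(1)])
  have "integrable M (\<lambda>\<omega>. (real_cond_exp M F Y \<omega>)\<^sup>2)"
    using assms(2) L2_integrable[OF assms(2)]
    by (intro F.integrable_convex_cond_exp[where I = UNIV and q = "\<lambda>x. x\<^sup>2"]) (auto simp: L2_def convex_power2)
  then show ?thesis
    by (simp add: L2_def)
qed

end

section \<open>A quantitative martingale central limit theorem\<close>

text \<open>After squaring this is 1 + x^2 <= exp(x^2). Modulus at most 1 is what allows products of
  such factors to be compared factor by factor.\<close>

lemma cmod_one_plus_i_exp_le:
  "cmod ((1 + \<i> * of_real x) * of_real (exp (- x\<^sup>2 / 2))) \<le> 1"
proof -
  have "(cmod ((1 + \<i> * of_real x) * of_real (exp (- x\<^sup>2 / 2))))\<^sup>2 = (1 + x\<^sup>2) * (exp (- x\<^sup>2 / 2))\<^sup>2"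
    unfolding norm_mult power_mult_distrib norm_of_real by (simp add: cmod_power2)
  also have "(exp (- x\<^sup>2 / 2))\<^sup>2 = exp (- x\<^sup>2)"
    unfolding exp_double[symmetric] by simp
  also have "(1 + x\<^sup>2) * exp (- x\<^sup>2) \<le> exp (x\<^sup>2) * exp (- x\<^sup>2)"
    by (intro mult_right_mono exp_ge_add_one_self) auto
  also have "\<dots> = 1\<^sup>2"
    by (simp add: exp_minus)
  finally show ?thesis
    by (rule power2_le_imp_le) simp
qed

text \<open>McLeish's expansion of exp(ix) in additive form. For |x| <= 1, the product (1 + ix)(1 -
  x^2/2) is the Taylor polynomial of degree 2 minus i x^3/2, and the error \<open>e\<close> in
  exp(-x^2/2) is of fourth order. For |x| > 1 both terms have modulus at most 1.\<close>

lemma iexp_one_plus_i_exp_bound: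
  "cmod (iexp x - (1 + \<i> * of_real x) * of_real (exp (- x\<^sup>2 / 2))) \<le> 2 * \<bar>x\<bar> ^ 3"
proof (cases "\<bar>x\<bar> \<le> 1")
  case True
  define R where "R = iexp x - (\<Sum>k\<le>2. (\<i> * x) ^ k / fact k)"
  have R: "cmod R \<le> \<bar>x\<bar> ^ 3 / 6"
    using iexp_approx1[of x 2] by (simp add: R_def fact_numeral eval_nat_numeral)
  define e where "e = exp (- x\<^sup>2 / 2) - (1 - x\<^sup>2 / 2)"
  have "e \<ge> 0"
    using exp_ge_add_one_self[of "- x\<^sup>2 / 2"] by (simp add: e_def)
  have x2: "x\<^sup>2 \<le> 1"
    using True by (simp add: abs_square_le_1)
  have e_le: "e \<le> (x\<^sup>2 / 2)\<^sup>2"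
  proof -
    \<comment> \<open>With y = x^2/2 the chain is exp(-y) <= 1/(1 + y) <= 1 - y + y^2, the latter
      because (1 - y + y^2)(1 + y) = 1 + y^3.\<close>
    have "exp (- (x\<^sup>2 / 2)) \<le> inverse (1 + x\<^sup>2 / 2)"
      using exp_ge_add_one_self[of "x\<^sup>2 / 2"] unfolding exp_minus
      by (intro le_imp_inverse_le) (auto intro: add_pos_nonneg)
    also have "\<dots> \<le> 1 - x\<^sup>2 / 2 + (x\<^sup>2 / 2)\<^sup>2"
    proof -
      define y where "y = x\<^sup>2 / 2"
      have y: "y \<ge> 0" by (simp add: y_def)
      have "1 \<le> (1 - y + y\<^sup>2) * (1 + y)"
        using y by (simp add: algebra_simps power2_eq_square)
      then show ?thesis
        using y unfolding y_def[symmetric] by (simp add: inverse_eq_divide divide_le_eq)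
    qed
    finally show ?thesis
      by (simp add: e_def)
  qed
  have eq: "iexp x - (1 + \<i> * of_real x) * of_real (exp (- x\<^sup>2 / 2)) =
      R + \<i> * of_real (x ^ 3 / 2) - (1 + \<i> * of_real x) * of_real e"
  proof -
    have "(\<Sum>k\<le>2. (\<i> * of_real x) ^ k / fact k) = 1 + \<i> * of_real x - of_real (x\<^sup>2 / 2)"
      by (simp add: numeral_2_eq_2 power_mult_distrib)
    then show ?thesis
      unfolding R_def e_def
      by (simp add: algebra_simps power2_eq_square power3_eq_cube add_divide_distrib diff_divide_distrib)
  qed
  have x4: "(x\<^sup>2 / 2)\<^sup>2 \<le> \<bar>x\<bar> ^ 3 / 4"
  proof -
    have "(x\<^sup>2 / 2)\<^sup>2 = \<bar>x\<bar> ^ 3 * \<bar>x\<bar> / 4"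
      by (simp add: power2_eq_square eval_nat_numeral abs_mult[symmetric])
    also have "\<dots> \<le> \<bar>x\<bar> ^ 3 * 1 / 4"
      using True by (intro divide_right_mono mult_left_mono) auto
    finally show ?thesis by simp
  qed
  have "cmod (1 + \<i> * of_real x) \<le> 1 + \<bar>x\<bar>"
    using norm_triangle_ineq[of 1 "\<i> * of_real x"] by (simp add: norm_mult)
  then have c2: "cmod (1 + \<i> * of_real x) \<le> 2"
    using True by simp
  have "cmod ((1 + \<i> * of_real x) * of_real e) \<le> 2 * (\<bar>x\<bar> ^ 3 / 4)"
    unfolding norm_mult using c2 e_le x4 \<open>e \<ge> 0\<close> by (intro mult_mono) auto
  moreover have "cmod (\<i> * of_real (x ^ 3 / 2)) = \<bar>x\<bar> ^ 3 / 2"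
    by (simp add: norm_mult power_abs norm_divide norm_power)
  ultimately have "cmod (R + \<i> * of_real (x ^ 3 / 2) - (1 + \<i> * of_real x) * of_real e)
      \<le> \<bar>x\<bar> ^ 3 / 6 + \<bar>x\<bar> ^ 3 / 2 + 2 * (\<bar>x\<bar> ^ 3 / 4)"
    using R norm_triangle_ineq4[of "R + \<i> * of_real (x ^ 3 / 2)" "(1 + \<i> * of_real x) * of_real e"]
      norm_triangle_ineq[of R "\<i> * of_real (x ^ 3 / 2)"] by linarith
  also have "\<dots> \<le> 2 * \<bar>x\<bar> ^ 3"
    by simp
  finally show ?thesis
    unfolding eq .
next
  case False
  have "cmod (iexp x - (1 + \<i> * of_real x) * of_real (exp (- x\<^sup>2 / 2))) \<le> 1 + 1"
    by (intro order_trans[OF norm_triangle_ineq4] add_mono cmod_one_plus_i_exp_le) simp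
  moreover have "1 \<le> \<bar>x\<bar> ^ 3"
    using False by (intro one_le_power) simp
  ultimately show ?thesis
    by simp
qed

text \<open>Whether \<open>d k\<close> survives depends only on the entries before \<open>k\<close>,
  so the 0-1 factor is predictable and keeps martingale differences orthogonal to the past.
  Exceeding the level 2 already means that the sum of squares is off its target 1 by more than
  1.\<close>

definition stopped :: "(nat \<Rightarrow> real) \<Rightarrow> nat \<Rightarrow> real" where
  "stopped d k = (if (\<Sum>j<k. (d j)\<^sup>2) \<le> 2 then d k else 0)"

lemma stopped_square_le: "(stopped d k)\<^sup>2 \<le> (d k)\<^sup>2"
  by (simp add: stopped_def)

lemma stopped_abs_le: "\<bar>stopped d k\<bar> \<le> \<bar>d k\<bar>"
  by (simp add: stopped_def)

lemma stopped_eq: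
  assumes "(\<Sum>j<n. (d j)\<^sup>2) \<le> 2" "k < n"
  shows "stopped d k = d k"
proof -
  have "(\<Sum>j<k. (d j)\<^sup>2) \<le> (\<Sum>j<n. (d j)\<^sup>2)"
    using assms(2) by (intro sum_mono2) auto
  then show ?thesis
    using assms(1) by (simp add: stopped_def)
qed

text \<open>The bound is the level 2 plus one square of size at most 1 by which it may be overshot;
  after that every term is 0.\<close>

lemma stopped_square_sum_le:
  assumes "\<And>k. k < n \<Longrightarrow> \<bar>d k\<bar> \<le> 1"
  shows "(\<Sum>j<n. (stopped d j)\<^sup>2) \<le> 3"
  using assms
proof (induction n)
  case (Suc n)
  show ?case
  proof (cases "(\<Sum>j<n. (d j)\<^sup>2) \<le> 2")
    case True
    have "(\<Sum>j<n. (stopped d j)\<^sup>2) \<le> (\<Sum>j<n. (d j)\<^sup>2)"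
      by (intro sum_mono stopped_square_le)
    moreover have "(stopped d n)\<^sup>2 \<le> 1"
      using Suc.prems[of n] stopped_square_le[of d n] abs_square_le_1[of "d n"] by simp
    ultimately show ?thesis
      using True by simp
  next
    case False
    then have "stopped d n = 0"
      by (simp add: stopped_def)
    then show ?thesis
      using Suc by simp
  qed
qed simp

text \<open>Either nothing was stopped, or the original sum q exceeds 2 and the stopped one lies in
  [0, q].\<close>

lemma stopped_square_sum_diff:
  "\<bar>(\<Sum>j<n. (stopped d j)\<^sup>2) - 1\<bar> \<le> 3 * \<bar>(\<Sum>j<n. (d j)\<^sup>2) - 1\<bar>"
proof (cases "(\<Sum>j<n. (d j)\<^sup>2) \<le> 2")
  case True
  then have "(\<Sum>j<n. (stopped d j)\<^sup>2) = (\<Sum>j<n. (d j)\<^sup>2)"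
    using stopped_eq[OF True] by (intro sum.cong) auto
  then show ?thesis
    by simp
next
  case False
  have "(\<Sum>j<n. (stopped d j)\<^sup>2) \<le> (\<Sum>j<n. (d j)\<^sup>2)"
    by (intro sum_mono stopped_square_le)
  moreover have "0 \<le> (\<Sum>j<n. (stopped d j)\<^sup>2)"
    by (intro sum_nonneg) simp
  ultimately show ?thesis
    using False by (auto simp: abs_if)
qed

text \<open>All factors have modulus at most 1, so the difference of the products is at most the sum
  of the differences of the factors. In each cube one factor is absorbed by \<open>\<beta>\<close>,
  which leaves the squares.\<close>

lemma iexp_sum_prod_bound:
  fixes z :: "nat \<Rightarrow> real"
  assumes "\<And>k. k < n \<Longrightarrow> \<bar>z k\<bar> \<le> \<beta>"
  shows "cmod (iexp (t * (\<Sum>k<n. z k)) -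
           (\<Prod>k<n. 1 + \<i> * of_real (t * z k)) * of_real (exp (- t\<^sup>2 * (\<Sum>k<n. (z k)\<^sup>2) / 2)))
         \<le> 2 * \<bar>t\<bar> ^ 3 * \<beta> * (\<Sum>k<n. (z k)\<^sup>2)"
proof -
  have "iexp (t * (\<Sum>k<n. z k)) = (\<Prod>k<n. iexp (t * z k))"
    by (simp add: exp_sum[symmetric] sum_distrib_left)
  moreover have "exp (- t\<^sup>2 * (\<Sum>k<n. (z k)\<^sup>2) / 2) = (\<Prod>k<n. exp (- (t * z k)\<^sup>2 / 2))"
    by (simp add: exp_sum[symmetric] sum_distrib_left sum_negf sum_divide_distrib power_mult_distrib)
  ultimately have "cmod (iexp (t * (\<Sum>k<n. z k)) -
      (\<Prod>k<n. 1 + \<i> * of_real (t * z k)) * of_real (exp (- t\<^sup>2 * (\<Sum>k<n. (z k)\<^sup>2) / 2))) =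
    cmod ((\<Prod>k<n. iexp (t * z k)) -
      (\<Prod>k<n. (1 + \<i> * of_real (t * z k)) * of_real (exp (- (t * z k)\<^sup>2 / 2))))"
    by (simp only: prod.distrib of_real_prod)
  also have "\<dots> \<le> (\<Sum>k<n. cmod (iexp (t * z k) -
      (1 + \<i> * of_real (t * z k)) * of_real (exp (- (t * z k)\<^sup>2 / 2))))"
  proof (rule norm_prod_diff)
    show "cmod (iexp (t * z i)) \<le> 1" for i
      unfolding norm_exp_i_times by simp
    show "cmod ((1 + \<i> * of_real (t * z i)) * of_real (exp (- (t * z i)\<^sup>2 / 2))) \<le> 1" for i
      by (rule cmod_one_plus_i_exp_le)
  qed
  also have "\<dots> \<le> (\<Sum>k<n. 2 * \<bar>t\<bar> ^ 3 * \<beta> * (z k)\<^sup>2)"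
  proof (rule sum_mono)
    fix k assume "k \<in> {..<n}"
    then have "\<bar>z k\<bar> * (z k)\<^sup>2 \<le> \<beta> * (z k)\<^sup>2"
      using assms by (intro mult_right_mono) auto
    then have "\<bar>z k\<bar> ^ 3 \<le> \<beta> * (z k)\<^sup>2"
      by (simp add: power3_eq_cube power2_eq_square abs_mult[symmetric] mult.assoc)
    then have "2 * \<bar>t * z k\<bar> ^ 3 \<le> 2 * \<bar>t\<bar> ^ 3 * (\<beta> * (z k)\<^sup>2)"
      unfolding abs_mult power_mult_distrib by (simp add: mult_left_mono)
    then show "cmod (iexp (t * z k) - (1 + \<i> * of_real (t * z k)) * of_real (exp (- (t * z k)\<^sup>2 / 2)))
        \<le> 2 * \<bar>t\<bar> ^ 3 * \<beta> * (z k)\<^sup>2"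
      using iexp_one_plus_i_exp_bound[of "t * z k"] by (simp only: mult.assoc)
  qed
  also have "\<dots> = 2 * \<bar>t\<bar> ^ 3 * \<beta> * (\<Sum>k<n. (z k)\<^sup>2)"
    by (simp add: sum_distrib_left)
  finally show ?thesis .
qed

lemma cmod_prod_one_plus_i_le:
  fixes z :: "nat \<Rightarrow> real"
  shows "cmod (\<Prod>k<n. 1 + \<i> * of_real (t * z k)) \<le> exp (t\<^sup>2 * (\<Sum>k<n. (z k)\<^sup>2) / 2)"
proof -
  have "cmod (1 + \<i> * of_real x) \<le> exp (x\<^sup>2 / 2)" for x :: real
  proof -
    have "cmod (1 + \<i> * of_real x) * exp (- x\<^sup>2 / 2) \<le> 1"
      using cmod_one_plus_i_exp_le[of x] unfolding norm_mult norm_of_real by simp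
    then show ?thesis
      by (simp add: exp_minus field_simps)
  qed
  then have "(\<Prod>k<n. cmod (1 + \<i> * of_real (t * z k))) \<le> (\<Prod>k<n. exp ((t * z k)\<^sup>2 / 2))"
    by (intro prod_mono) (auto simp del: of_real_mult)
  also have "\<dots> = exp (t\<^sup>2 * (\<Sum>k<n. (z k)\<^sup>2) / 2)"
    by (simp add: exp_sum[symmetric] sum_distrib_left sum_divide_distrib power_mult_distrib)
  finally show ?thesis
    by (simp only: prod_norm)
qed

lemma exp_minus_diff_le:
  fixes x y :: real
  assumes "0 \<le> x" "0 \<le> y"
  shows "\<bar>exp (- x) - exp (- y)\<bar> \<le> \<bar>x - y\<bar>"
proof -
  have *: "exp (- a) - exp (- b) \<le> b - a" if "0 \<le> a" "a \<le> b" for a b :: real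
  proof -
    have "1 - exp (- (b - a)) \<le> b - a"
      using exp_ge_add_one_self[of "- (b - a)"] by linarith
    then have "exp (- a) * (1 - exp (- (b - a))) \<le> 1 * (b - a)"
      using that by (intro mult_mono) auto
    then show ?thesis
      by (simp add: right_diff_distrib exp_add[symmetric])
  qed
  have mono: "exp (- b) \<le> exp (- a)" if "a \<le> b" for a b :: real
    using that by simp
  show ?thesis
    using *[of x y] *[of y x] mono[of x y] mono[of y x] assms by (cases "x \<le> y") auto
qed

text \<open>Three replacements. Stopping changes the sum only if \<open>q > 2\<close>, and then the
  trivial bound 2 is below 2 |q - 1|. The product expansion costs 2 |t|^3 \<open>\<beta>\<close>
  \<open>Q\<close> with \<open>Q \<le> 3\<close>. Replacing the random \<open>Q\<close> by 1 in the
  exponential costs t^2/2 times |Q - 1|, multiplied by the bound exp(3 t^2 / 2) for the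
  product.\<close>

lemma iexp_stopped_bound:
  fixes d :: "nat \<Rightarrow> real"
  assumes "\<And>k. k < n \<Longrightarrow> \<bar>d k\<bar> \<le> \<beta>" "0 \<le> \<beta>" "\<beta> \<le> 1"
  shows "cmod (iexp (t * (\<Sum>k<n. d k)) -
           (\<Prod>k<n. 1 + \<i> * of_real (t * stopped d k)) * of_real (exp (- t\<^sup>2 / 2)))
         \<le> 6 * \<bar>t\<bar> ^ 3 * \<beta> + (2 + 3 / 2 * t\<^sup>2 * exp (3 / 2 * t\<^sup>2)) * \<bar>(\<Sum>k<n. (d k)\<^sup>2) - 1\<bar>"
proof -
  define q where "q = (\<Sum>k<n. (d k)\<^sup>2)"
  define Q where "Q = (\<Sum>k<n. (stopped d k)\<^sup>2)"
  define T where "T = (\<Prod>k<n. 1 + \<i> * of_real (t * stopped d k))"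
  have Q3: "Q \<le> 3"
    unfolding Q_def using assms by (intro stopped_square_sum_le) force
  have Q0: "0 \<le> Q"
    by (auto simp: Q_def intro: sum_nonneg)
  have Qq: "\<bar>Q - 1\<bar> \<le> 3 * \<bar>q - 1\<bar>"
    unfolding Q_def q_def by (rule stopped_square_sum_diff)
  have 1: "cmod (iexp (t * (\<Sum>k<n. d k)) - iexp (t * (\<Sum>k<n. stopped d k))) \<le> 2 * \<bar>q - 1\<bar>"
  proof (cases "q \<le> 2")
    case True
    then have "(\<Sum>k<n. stopped d k) = (\<Sum>k<n. d k)"
      using stopped_eq unfolding q_def by (intro sum.cong) auto
    then show ?thesis
      by simp
  next
    case False
    have "cmod (iexp (t * (\<Sum>k<n. d k)) - iexp (t * (\<Sum>k<n. stopped d k))) \<le> 1 + 1"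
      by (intro order_trans[OF norm_triangle_ineq4] add_mono) (simp_all only: norm_exp_i_times order_refl)
    then show ?thesis
      using False by simp
  qed
  have "cmod (iexp (t * (\<Sum>k<n. stopped d k)) - T * of_real (exp (- t\<^sup>2 * Q / 2)))
      \<le> 2 * \<bar>t\<bar> ^ 3 * \<beta> * Q"
    unfolding T_def Q_def using assms(1) stopped_abs_le
    by (intro iexp_sum_prod_bound) (meson order_trans)
  also have "\<dots> \<le> 2 * \<bar>t\<bar> ^ 3 * \<beta> * 3"
    using Q3 assms(2) by (intro mult_left_mono) auto
  finally have 2: "cmod (iexp (t * (\<Sum>k<n. stopped d k)) - T * of_real (exp (- t\<^sup>2 * Q / 2)))
      \<le> 6 * \<bar>t\<bar> ^ 3 * \<beta>"
    by simp
  have "cmod T \<le> exp (t\<^sup>2 * Q / 2)"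
    unfolding T_def Q_def by (rule cmod_prod_one_plus_i_le)
  also have "\<dots> \<le> exp (3 / 2 * t\<^sup>2)"
    using Q3 mult_left_mono[of Q 3 "t\<^sup>2"] by simp
  finally have T: "cmod T \<le> exp (3 / 2 * t\<^sup>2)" .
  have "\<bar>exp (- (t\<^sup>2 * Q / 2)) - exp (- (t\<^sup>2 / 2))\<bar> \<le> \<bar>t\<^sup>2 * Q / 2 - t\<^sup>2 / 2\<bar>"
    using Q0 by (intro exp_minus_diff_le) auto
  also have "\<dots> = t\<^sup>2 / 2 * \<bar>Q - 1\<bar>"
  proof -
    have "t\<^sup>2 * Q / 2 - t\<^sup>2 / 2 = t\<^sup>2 / 2 * (Q - 1)"
      by (simp add: algebra_simps)
    then show ?thesis
      by (simp only: abs_mult abs_divide abs_power2)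
  qed
  also have "\<dots> \<le> t\<^sup>2 / 2 * (3 * \<bar>q - 1\<bar>)"
    using Qq by (intro mult_left_mono) auto
  finally have e: "\<bar>exp (- t\<^sup>2 * Q / 2) - exp (- t\<^sup>2 / 2)\<bar> \<le> 3 / 2 * t\<^sup>2 * \<bar>q - 1\<bar>"
    by simp
  have "cmod (T * of_real (exp (- t\<^sup>2 * Q / 2)) - T * of_real (exp (- t\<^sup>2 / 2)))
      = cmod T * \<bar>exp (- t\<^sup>2 * Q / 2) - exp (- t\<^sup>2 / 2)\<bar>"
    by (simp only: right_diff_distrib[symmetric] of_real_diff[symmetric] norm_mult norm_of_real)
  also have "\<dots> \<le> exp (3 / 2 * t\<^sup>2) * (3 / 2 * t\<^sup>2 * \<bar>q - 1\<bar>)"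
    using T e by (intro mult_mono) auto
  finally have 3: "cmod (T * of_real (exp (- t\<^sup>2 * Q / 2)) - T * of_real (exp (- t\<^sup>2 / 2)))
      \<le> 3 / 2 * t\<^sup>2 * exp (3 / 2 * t\<^sup>2) * \<bar>q - 1\<bar>"
    by (simp add: mult.commute mult.left_commute)
  have "cmod (a - d) \<le> cmod (a - b) + cmod (b - c) + cmod (c - d)" for a b c d :: complex
    using norm_triangle_ineq[of "a - b" "b - c"] norm_triangle_ineq[of "a - c" "c - d"] by simp
  note this[of "iexp (t * (\<Sum>k<n. d k))" "T * of_real (exp (- t\<^sup>2 / 2))"
      "iexp (t * (\<Sum>k<n. stopped d k))" "T * of_real (exp (- t\<^sup>2 * Q / 2))"]
  then show ?thesis
    using 1 2 3 unfolding T_def[symmetric] q_def[symmetric] by (simp only: distrib_right)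
qed

lemma subalgebra_chain:
  assumes "\<And>k::nat. subalgebra (F (Suc k)) (F k)" "i \<le> j"
  shows "subalgebra (F j) (F i)"
  using assms(2)
proof (induction j rule: dec_induct)
  case base
  show ?case by (simp add: subalgebra_def)
next
  case (step m)
  then show ?case
    using assms(1)[of m] by (auto simp: subalgebra_def)
qed

context prob_space
begin

text \<open>McLeish's argument: freezing the martingale once its quadratic variation exceeds \<open>2\<close> keeps
  the products \<open>\<Prod>(1 + i t d\<^sub>k)\<close> bounded, and these have expectation \<open>1\<close>.\<close>
lemma martingale_char_bound:
  fixes F :: "nat \<Rightarrow> 'a measure" and d :: "nat \<Rightarrow> 'a \<Rightarrow> real"
  assumes sub: "\<And>k. subalgebra M (F k)"
    and mono: "\<And>k. subalgebra (F (Suc k)) (F k)"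
    and meas: "\<And>k. k < n \<Longrightarrow> d k \<in> borel_measurable (F (Suc k))"
    and orth: "\<And>k W. k < n \<Longrightarrow> W \<in> L2 M (F k) \<Longrightarrow> (\<integral>\<omega>. W \<omega> * d k \<omega> \<partial>M) = 0"
    and bnd: "\<And>k. k < n \<Longrightarrow> AE \<omega> in M. \<bar>d k \<omega>\<bar> \<le> \<beta>"
    and \<beta>: "0 \<le> \<beta>" "\<beta> \<le> 1"
  shows "cmod ((\<integral>\<omega>. iexp (t * (\<Sum>k<n. d k \<omega>)) \<partial>M) - of_real (exp (- t\<^sup>2 / 2)))
    \<le> 6 * \<bar>t\<bar> ^ 3 * \<beta> +
      (2 + 3 / 2 * t\<^sup>2 * exp (3 / 2 * t\<^sup>2)) * (\<integral>\<omega>. \<bar>(\<Sum>k<n. (d k \<omega>)\<^sup>2) - 1\<bar> \<partial>M)"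
proof -
  have chain: "subalgebra (F j) (F i)" if "i \<le> j" for i j
    using mono that by (rule subalgebra_chain)
  have measF: "d j \<in> borel_measurable (F k)" if "j < k" "j < n" for j k
    using measurable_from_subalg[OF chain[of "Suc j" k] meas[of j]] that by auto
  have measM: "d j \<in> borel_measurable M" if "j < n" for j
    using measurable_from_subalg[OF sub meas[OF that]] .
  define ind where "ind k \<omega> = (if (\<Sum>j<k. (d j \<omega>)\<^sup>2) \<le> 2 then 1 else 0 :: real)" for k \<omega>
  define Z where "Z k \<omega> = stopped (\<lambda>j. d j \<omega>) k" for k \<omega>
  define T where "T k \<omega> = (\<Prod>j<k. 1 + \<i> * of_real (t * Z j \<omega>))" for k \<omega>
  have Z_eq: "Z k \<omega> = ind k \<omega> * d k \<omega>" for k \<omega>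
    by (simp add: Z_def ind_def stopped_def)
  have ind_F: "ind k \<in> borel_measurable (F k)" if "k \<le> n" for k
  proof -
    have [measurable]: "d j \<in> borel_measurable (F k)" if "j \<in> {..<k}" for j
      using measF that \<open>k \<le> n\<close> by auto
    show ?thesis
      unfolding ind_def[abs_def] by measurable
  qed
  have Z_F: "Z j \<in> borel_measurable (F k)" if "j < k" "k \<le> n" for j k
  proof -
    have [measurable]: "d j \<in> borel_measurable (F k)"
      using measF that by auto
    have [measurable]: "ind j \<in> borel_measurable (F k)"
      using ind_F[of j] chain[of j k] that by (auto intro: measurable_from_subalg)
    show ?thesis
      unfolding Z_eq[abs_def] by measurable
  qed
  have T_F: "T k \<in> borel_measurable (F k)" if "k \<le> n" for k
  proof -
    have [measurable]: "Z j \<in> borel_measurable (F k)" if "j \<in> {..<k}" for j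
      using Z_F that \<open>k \<le> n\<close> by auto
    show ?thesis
      unfolding T_def[abs_def] by measurable
  qed
  have ae: "AE \<omega> in M. \<forall>k<n. \<bar>d k \<omega>\<bar> \<le> \<beta>"
    using bnd by (auto simp: AE_all_countable)
  have T_bound: "AE \<omega> in M. cmod (T k \<omega>) \<le> exp (3 / 2 * t\<^sup>2)" if "k \<le> n" for k
    using ae
  proof eventually_elim
    case (elim \<omega>)
    have "(\<Sum>j<k. (Z j \<omega>)\<^sup>2) \<le> 3"
      unfolding Z_def
    proof (rule stopped_square_sum_le)
      fix j assume "j < k"
      then have "\<bar>d j \<omega>\<bar> \<le> \<beta>"
        using elim that by auto
      then show "\<bar>d j \<omega>\<bar> \<le> 1"
        using \<beta> by linarith
    qed
    then have "t\<^sup>2 * (\<Sum>j<k. (Z j \<omega>)\<^sup>2) \<le> t\<^sup>2 * 3"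
      by (intro mult_left_mono) auto
    then have "exp (t\<^sup>2 * (\<Sum>j<k. (Z j \<omega>)\<^sup>2) / 2) \<le> exp (3 / 2 * t\<^sup>2)"
      by simp
    then show ?case
      unfolding T_def by (rule order_trans[OF cmod_prod_one_plus_i_le])
  qed
  have T_int: "integrable M (T k)" if "k \<le> n" for k
    using T_bound[OF that] measurable_from_subalg[OF sub T_F[OF that]]
    by (intro integrable_const_bound[where B = "exp (3 / 2 * t\<^sup>2)"]) auto
  have ET: "(\<integral>\<omega>. T k \<omega> \<partial>M) = 1" if "k \<le> n" for k
    using that
  proof (induction k)
    case 0
    show ?case
      by (simp add: T_def prob_space)
  next
    case (Suc k)
    then have k: "k < n" by simp
    have [measurable]: "T k \<in> borel_measurable (F k)" "ind k \<in> borel_measurable (F k)"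
      using T_F ind_F k by auto
    have [measurable]: "T k \<in> borel_measurable M" "ind k \<in> borel_measurable M" "d k \<in> borel_measurable M"
      using measurable_from_subalg[OF sub T_F] measurable_from_subalg[OF sub ind_F] measM k by auto
    \<comment> \<open>\<open>W\<close> is the coefficient of \<open>d k\<close> in the increment of
      \<open>T\<close>. It is bounded and \<open>F k\<close>-measurable, thanks to predictable
      stopping, so its real and imaginary parts are admissible in \<open>orth\<close>.\<close>
    define W where "W \<omega> = T k \<omega> * of_real (ind k \<omega>)" for \<omega>
    have W_bound: "AE \<omega> in M. cmod (W \<omega>) \<le> exp (3 / 2 * t\<^sup>2)"
      using T_bound[of k] k by (auto simp: W_def ind_def norm_mult)
    have Re: "(\<lambda>\<omega>. Re (W \<omega>)) \<in> L2 M (F k)"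
    proof (rule L2_AE_bounded[OF sub])
      show "AE \<omega> in M. \<bar>Re (W \<omega>)\<bar> \<le> exp (3 / 2 * t\<^sup>2)"
        using W_bound by eventually_elim (meson abs_Re_le_cmod order_trans)
    qed (simp add: W_def[abs_def])
    have Im: "(\<lambda>\<omega>. Im (W \<omega>)) \<in> L2 M (F k)"
    proof (rule L2_AE_bounded[OF sub])
      show "AE \<omega> in M. \<bar>Im (W \<omega>)\<bar> \<le> exp (3 / 2 * t\<^sup>2)"
        using W_bound by eventually_elim (meson abs_Im_le_cmod order_trans)
    qed (simp add: W_def[abs_def])
    have Wd_int: "integrable M (\<lambda>\<omega>. W \<omega> * of_real (d k \<omega>))"
    proof (rule integrable_const_bound[where B = "exp (3 / 2 * t\<^sup>2)"])
      show "AE \<omega> in M. cmod (W \<omega> * of_real (d k \<omega>)) \<le> exp (3 / 2 * t\<^sup>2)"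
        using W_bound ae
      proof eventually_elim
        case (elim \<omega>)
        have "\<bar>d k \<omega>\<bar> \<le> 1"
          using elim(2)[rule_format, OF k] \<beta>(2) by linarith
        then have "cmod (W \<omega>) * \<bar>d k \<omega>\<bar> \<le> exp (3 / 2 * t\<^sup>2) * 1"
          by (intro mult_mono elim(1)) simp_all
        then show ?case
          by (simp add: norm_mult)
      qed
    qed (simp add: W_def[abs_def])
    have "(\<integral>\<omega>. W \<omega> * of_real (d k \<omega>) \<partial>M) = 0"
    proof (rule complex_eqI)
      have "(\<integral>\<omega>. Re (W \<omega> * of_real (d k \<omega>)) \<partial>M) = 0"
        using orth[OF k Re] by simp
      then show "Re (\<integral>\<omega>. W \<omega> * of_real (d k \<omega>) \<partial>M) = Re 0"
        using Wd_int by (simp only: integral_Re zero_complex.sel)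
      have "(\<integral>\<omega>. Im (W \<omega> * of_real (d k \<omega>)) \<partial>M) = 0"
        using orth[OF k Im] by simp
      then show "Im (\<integral>\<omega>. W \<omega> * of_real (d k \<omega>) \<partial>M) = Im 0"
        using Wd_int by (simp only: integral_Im zero_complex.sel)
    qed
    moreover have "T (Suc k) \<omega> = T k \<omega> + (\<i> * of_real t) * (W \<omega> * of_real (d k \<omega>))" for \<omega>
      by (simp add: T_def W_def Z_eq algebra_simps)
    ultimately show ?case
      using Suc T_int[of k] Wd_int by (simp only: Bochner_Integration.integral_add integrable_mult_right integral_mult_right) simp
  qed
  define U where "U \<omega> = iexp (t * (\<Sum>k<n. d k \<omega>))" for \<omega>
  have [measurable]: "d k \<in> borel_measurable M" if "k \<in> {..<n}" for k
    using measM that by simp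
  have U_int: "integrable M U"
    by (rule integrable_const_bound[where B = 1]) (simp_all add: U_def[abs_def])
  have q_int: "integrable M (\<lambda>\<omega>. \<bar>(\<Sum>k<n. (d k \<omega>)\<^sup>2) - 1\<bar>)"
  proof -
    have "integrable M (\<lambda>\<omega>. (d k \<omega>)\<^sup>2)" if "k < n" for k
      using L2_AE_bounded[OF subalgebra_self measM[OF that] bnd[OF that]] by (simp add: L2_def)
    then show ?thesis
      by (intro integrable_abs Bochner_Integration.integrable_diff Bochner_Integration.integrable_sum) auto
  qed
  have "(\<integral>\<omega>. U \<omega> \<partial>M) - of_real (exp (- t\<^sup>2 / 2)) = (\<integral>\<omega>. U \<omega> - T n \<omega> * of_real (exp (- t\<^sup>2 / 2)) \<partial>M)"
    using ET[of n] T_int[of n] U_int by (subst Bochner_Integration.integral_diff) auto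
  also have "cmod \<dots> \<le> (\<integral>\<omega>. cmod (U \<omega> - T n \<omega> * of_real (exp (- t\<^sup>2 / 2))) \<partial>M)"
    by (rule integral_norm_bound)
  also have "\<dots> \<le> (\<integral>\<omega>. 6 * \<bar>t\<bar> ^ 3 * \<beta> +
      (2 + 3 / 2 * t\<^sup>2 * exp (3 / 2 * t\<^sup>2)) * \<bar>(\<Sum>k<n. (d k \<omega>)\<^sup>2) - 1\<bar> \<partial>M)"
  proof (rule integral_mono_AE)
    show "integrable M (\<lambda>\<omega>. cmod (U \<omega> - T n \<omega> * of_real (exp (- t\<^sup>2 / 2))))"
      using U_int T_int[of n] by auto
    show "AE \<omega> in M. cmod (U \<omega> - T n \<omega> * of_real (exp (- t\<^sup>2 / 2))) \<le> 6 * \<bar>t\<bar> ^ 3 * \<beta> +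
      (2 + 3 / 2 * t\<^sup>2 * exp (3 / 2 * t\<^sup>2)) * \<bar>(\<Sum>k<n. (d k \<omega>)\<^sup>2) - 1\<bar>"
      using ae unfolding U_def T_def Z_def
    proof eventually_elim
      case (elim \<omega>)
      then show ?case
        using \<beta> by (intro iexp_stopped_bound) auto
    qed
  qed (use q_int in auto)
  also have "\<dots> = 6 * \<bar>t\<bar> ^ 3 * \<beta> +
      (2 + 3 / 2 * t\<^sup>2 * exp (3 / 2 * t\<^sup>2)) * (\<integral>\<omega>. \<bar>(\<Sum>k<n. (d k \<omega>)\<^sup>2) - 1\<bar> \<partial>M)"
    using q_int by (simp add: prob_space)
  finally show ?thesis
    unfolding U_def .
qed

end

section \<open>Arrays along a filtration with contracting conditional expectations\<close>

lemma sum_power_le_geometric: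
  fixes r :: real
  assumes "0 \<le> r" "r < 1" "finite K" "\<And>k. k \<in> K \<Longrightarrow> m \<le> k"
  shows "(\<Sum>k\<in>K. r ^ k) \<le> r ^ m / (1 - r)"
proof -
  have "(\<Sum>k\<in>K. r ^ k) \<le> (\<Sum>k\<in>{m..Max (insert m K)}. r ^ k)"
    using assms by (intro sum_mono2) auto
  also have "\<dots> \<le> r ^ m / (1 - r)"
    using assms by (simp add: sum_gp divide_right_mono)
  finally show ?thesis .
qed

lemma sum_abs_diff_power_le:
  fixes r :: real
  assumes "0 \<le> r" "r < 1"
  shows "(\<Sum>j\<le>n. r ^ (if i \<le> j then j - i else i - j)) \<le> 2 / (1 - r)"
proof -
  have "(\<Sum>j\<le>n. r ^ (if i \<le> j then j - i else i - j)) =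
      (\<Sum>j\<in>{..n} \<inter> {j. i \<le> j}. r ^ (j - i)) + (\<Sum>j\<in>{..n} \<inter> {j. \<not> i \<le> j}. r ^ (i - j))"
    by (simp add: if_distrib sum.If_cases Int_def conj_commute)
  also have "(\<Sum>j\<in>{..n} \<inter> {j. i \<le> j}. r ^ (j - i)) = (\<Sum>k\<in>(\<lambda>j. j - i) ` ({..n} \<inter> {j. i \<le> j}). r ^ k)"
    by (subst sum.reindex) (auto simp: inj_on_def)
  also have "\<dots> \<le> r ^ 0 / (1 - r)"
    using assms by (intro sum_power_le_geometric) auto
  also have "(\<Sum>j\<in>{..n} \<inter> {j. \<not> i \<le> j}. r ^ (i - j)) = (\<Sum>k\<in>(\<lambda>j. i - j) ` ({..n} \<inter> {j. \<not> i \<le> j}). r ^ k)"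
    by (subst sum.reindex) (auto simp: inj_on_def)
  also have "\<dots> \<le> r ^ 0 / (1 - r)"
    using assms by (intro sum_power_le_geometric) auto
  finally show ?thesis
    by simp
qed

lemma sum_symmetric_split:
  fixes c :: "nat \<Rightarrow> nat \<Rightarrow> real"
  assumes "\<And>i j. c i j = c j i"
  shows "(\<Sum>i<n. \<Sum>j<n. c i j) = (\<Sum>i<n. c i i) + 2 * (\<Sum>i<n. \<Sum>j=Suc i..<n. c i j)"
proof -
  have "(\<Sum>i<n. \<Sum>j<n. c i j) =
      (\<Sum>i<n. \<Sum>j<n. (if i = j then c i j else 0) + (if i < j then c i j else 0) + (if j < i then c i j else 0))"
    by (intro sum.cong) auto
  also have "\<dots> = (\<Sum>i<n. c i i) + (\<Sum>i<n. \<Sum>j<n. if i < j then c i j else 0) +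
      (\<Sum>i<n. \<Sum>j<n. if j < i then c i j else 0)"
    by (simp add: sum.distrib)
  also have "(\<Sum>i<n. \<Sum>j<n. if j < i then c i j else 0) = (\<Sum>i<n. \<Sum>j<n. if i < j then c i j else 0)"
    by (subst sum.swap) (intro sum.cong refl, simp add: assms)
  also have "(\<Sum>i<n. \<Sum>j<n. if i < j then c i j else 0) = (\<Sum>i<n. \<Sum>j=Suc i..<n. c i j)"
  proof (rule sum.cong[OF refl])
    fix i
    have "(\<Sum>j<n. if i < j then c i j else 0) = sum (c i) {j \<in> {..<n}. i < j}"
      by (rule sum.inter_filter[symmetric]) simp
    also have "{j \<in> {..<n}. i < j} = {Suc i..<n}"
      by auto
    finally show "(\<Sum>j<n. if i < j then c i j else 0) = (\<Sum>j=Suc i..<n. c i j)" .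
  qed
  finally show ?thesis
    by simp
qed

text \<open>\<open>F k\<close> stands for the history up to time \<open>k\<close>,
  \<open>G k\<close> for the state at time \<open>k\<close>, and \<open>r\<close> for the largest
  one-step correlation. Markov property and contraction are expressed by integrals of products,
  which avoids almost sure identities. Time 0 is an artificial start with trivial
  \<open>F 0\<close>, which is what \<open>initial\<close> says; it gives the first martingale
  difference the same form as the others.\<close>

locale corr_filtration = prob_space M for M :: "'a measure" +
  fixes F G :: "nat \<Rightarrow> 'a measure" and r :: real and n :: nat
  assumes sub_F: "subalgebra M (F k)"
    and F_mono: "subalgebra (F (Suc k)) (F k)"
    and sub_G: "subalgebra (F k) (G k)"
    and r: "0 \<le> r" "r < 1"
    and initial: "W \<in> L2 M (F 0) \<Longrightarrow> Y \<in> L2 M M \<Longrightarrow> (\<integral>\<omega>. Y \<omega> \<partial>M) = 0 \<Longrightarrow> (\<integral>\<omega>. W \<omega> * Y \<omega> \<partial>M) = 0"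
    and markov: "1 \<le> k \<Longrightarrow> k < n \<Longrightarrow> Y \<in> L2 M (G (Suc k)) \<Longrightarrow> W \<in> L2 M (F k) \<Longrightarrow>
      (\<integral>\<omega>. W \<omega> * Y \<omega> \<partial>M) = (\<integral>\<omega>. W \<omega> * real_cond_exp M (G k) Y \<omega> \<partial>M)"
    and contraction: "1 \<le> k \<Longrightarrow> k < n \<Longrightarrow> U \<in> L2 M (G k) \<Longrightarrow> Y \<in> L2 M (G (Suc k)) \<Longrightarrow>
      (\<integral>\<omega>. Y \<omega> \<partial>M) = 0 \<Longrightarrow> \<bar>\<integral>\<omega>. U \<omega> * Y \<omega> \<partial>M\<bar> \<le> r * norm2 M U * norm2 M Y"
begin

lemma F_chain: "i \<le> j \<Longrightarrow> subalgebra (F j) (F i)"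
  using F_mono by (rule subalgebra_chain)

lemma sub_GM: "subalgebra M (G k)"
  using sub_F[of k] sub_G[of k] by (auto simp: subalgebra_def)

lemma L2_F_mono: "f \<in> L2 M (F i) \<Longrightarrow> i \<le> j \<Longrightarrow> f \<in> L2 M (F j)"
  using L2_subalgebra F_chain by blast

lemma L2_G_F: "f \<in> L2 M (G k) \<Longrightarrow> f \<in> L2 M (F k)"
  using L2_subalgebra sub_G by blast

lemma L2_F_M: "f \<in> L2 M (F k) \<Longrightarrow> f \<in> L2 M M"
  using L2_subalgebra sub_F by blast

lemma L2_G_M: "f \<in> L2 M (G k) \<Longrightarrow> f \<in> L2 M M"
  using L2_subalgebra sub_GM by blast

text \<open>The default 0 is the right value at both ends: at \<open>k = 0\<close> a centred
  variable has conditional expectation 0, and from \<open>k = n\<close> on there are no further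
  summands.\<close>

definition proj :: "nat \<Rightarrow> ('a \<Rightarrow> real) \<Rightarrow> 'a \<Rightarrow> real" where
  "proj k Y = (if 1 \<le> k \<and> k < n then real_cond_exp M (G k) Y else (\<lambda>\<omega>. 0))"

lemma proj_L2: "Y \<in> L2 M M \<Longrightarrow> proj k Y \<in> L2 M (G k)"
  by (simp add: proj_def real_cond_exp_L2[OF sub_GM] L2_zero)

lemma proj_inner:
  assumes "k < n" "Y \<in> L2 M (G (Suc k))" "(\<integral>\<omega>. Y \<omega> \<partial>M) = 0" "W \<in> L2 M (F k)"
  shows "(\<integral>\<omega>. W \<omega> * Y \<omega> \<partial>M) = (\<integral>\<omega>. W \<omega> * proj k Y \<omega> \<partial>M)"
proof (cases "k = 0")
  case True
  then show ?thesis
    using initial[of W Y] assms L2_G_M by (simp add: proj_def)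
next
  case False
  then show ?thesis
    using markov[of k Y W] assms by (simp add: proj_def)
qed

lemma proj_mean:
  assumes "Y \<in> L2 M (G (Suc k))" "(\<integral>\<omega>. Y \<omega> \<partial>M) = 0"
  shows "(\<integral>\<omega>. proj k Y \<omega> \<partial>M) = 0"
proof (cases "k < n")
  case True
  then show ?thesis
    using proj_inner[OF True assms L2_const[of 1]] assms(2) by simp
qed (simp add: proj_def)

text \<open>The squared norm of the projection is its inner product with \<open>Y\<close>, which the
  contraction bounds by \<open>r\<close> times both norms; one norm of the projection
  cancels.\<close>

lemma proj_norm2:
  assumes "Y \<in> L2 M (G (Suc k))" "(\<integral>\<omega>. Y \<omega> \<partial>M) = 0"
  shows "norm2 M (proj k Y) \<le> r * norm2 M Y"
proof (cases "1 \<le> k \<and> k < n")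
  case True
  have P: "proj k Y \<in> L2 M (G k)"
    using assms L2_G_M proj_L2 by blast
  have "(norm2 M (proj k Y))\<^sup>2 = (\<integral>\<omega>. proj k Y \<omega> * proj k Y \<omega> \<partial>M)"
    unfolding norm2_power2 by (simp add: power2_eq_square)
  also have "\<dots> = (\<integral>\<omega>. proj k Y \<omega> * Y \<omega> \<partial>M)"
    using proj_inner[OF _ assms L2_G_F[OF P]] True by simp
  also have "\<dots> \<le> r * norm2 M (proj k Y) * norm2 M Y"
    using contraction[OF _ _ P assms] True by (simp add: abs_le_iff)
  finally have "norm2 M (proj k Y) * norm2 M (proj k Y) \<le> norm2 M (proj k Y) * (r * norm2 M Y)"
    by (simp add: power2_eq_square mult_ac)
  then show ?thesis
    using r norm2_nonneg[of M "proj k Y"] norm2_nonneg[of M Y]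
    by (cases "norm2 M (proj k Y) = 0") (auto simp: mult_le_cancel_left)
qed (use r in \<open>auto simp: proj_def norm2_def\<close>)

lemma real_cond_exp_abs_bound:
  assumes "Y \<in> borel_measurable M" "AE \<omega> in M. \<bar>Y \<omega>\<bar> \<le> c"
  shows "AE \<omega> in M. \<bar>real_cond_exp M (G k) Y \<omega>\<bar> \<le> c"
proof -
  interpret G: sigma_finite_subalgebra M "G k"
    by (rule sigma_finite_subalgebra_of[OF sub_GM])
  have int: "integrable M Y"
    using assms by (intro integrable_const_bound[where B = c]) auto
  have "AE \<omega> in M. Y \<omega> \<le> c" "AE \<omega> in M. - c \<le> Y \<omega>"
    using assms(2) by auto
  then have "AE \<omega> in M. real_cond_exp M (G k) Y \<omega> \<le> c" "AE \<omega> in M. - c \<le> real_cond_exp M (G k) Y \<omega>"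
    by (blast intro: G.real_cond_exp_le_c G.real_cond_exp_ge_c int)+
  then show ?thesis
    by eventually_elim simp
qed

lemma proj_abs_bound:
  assumes "Y \<in> borel_measurable M" "AE \<omega> in M. \<bar>Y \<omega>\<bar> \<le> c" "0 \<le> c"
  shows "AE \<omega> in M. \<bar>proj k Y \<omega>\<bar> \<le> c"
  using real_cond_exp_abs_bound[OF assms(1,2)] assms(3) by (simp add: proj_def)

text \<open>Each application of \<open>proj\<close> moves \<open>Y\<close> back by one time step and
  gains a factor \<open>r\<close>. \<open>W\<close> may depend on the whole past, since the Markov
  property is tested against \<open>F k\<close> and not only \<open>G k\<close>.\<close>

lemma mixing:
  assumes "W \<in> L2 M (F i)" "Y \<in> L2 M (G j)" "(\<integral>\<omega>. Y \<omega> \<partial>M) = 0" "i \<le> j" "j \<le> n"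
  shows "\<bar>\<integral>\<omega>. W \<omega> * Y \<omega> \<partial>M\<bar> \<le> r ^ (j - i) * (norm2 M W * norm2 M Y)"
  using assms(4,2,3,5)
proof (induction j arbitrary: Y rule: dec_induct)
  case base
  then show ?case
    using Cauchy_Schwarz_norm2[OF L2_F_M[OF assms(1)] L2_G_M[OF base(1)]] by simp
next
  case (step k)
  have W: "W \<in> L2 M (F k)"
    using assms(1) step.hyps L2_F_mono by blast
  have "\<bar>\<integral>\<omega>. W \<omega> * Y \<omega> \<partial>M\<bar> = \<bar>\<integral>\<omega>. W \<omega> * proj k Y \<omega> \<partial>M\<bar>"
    using proj_inner[OF _ step.prems(1,2) W] step.prems by simp
  also have "\<dots> \<le> r ^ (k - i) * (norm2 M W * norm2 M (proj k Y))"
    using step.prems L2_G_M proj_L2 proj_mean by (intro step.IH) auto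
  also have "\<dots> \<le> r ^ (k - i) * (norm2 M W * (r * norm2 M Y))"
    using proj_norm2[OF step.prems(1,2)] r by (intro mult_left_mono) auto
  also have "\<dots> = r ^ (Suc k - i) * (norm2 M W * norm2 M Y)"
    using step.hyps by (simp add: Suc_diff_le)
  finally show ?case .
qed

text \<open>Mixing and 2 a b <= a^2 + b^2 bound each inner product by r^|i-j| times the mean of the
  two squared norms; two geometric series give 2 / (1 - r) per row. This is the upper variance
  bound, used for the truncation error and the remainder alike.\<close>

lemma second_moment_sum_le:
  assumes L2: "\<And>j. j \<le> n \<Longrightarrow> Y j \<in> L2 M (G j)" and mean: "\<And>j. j \<le> n \<Longrightarrow> (\<integral>\<omega>. Y j \<omega> \<partial>M) = 0"
  shows "(norm2 M (\<lambda>\<omega>. \<Sum>j\<le>n. Y j \<omega>))\<^sup>2 \<le> 2 / (1 - r) * (\<Sum>j\<le>n. (norm2 M (Y j))\<^sup>2)"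
proof -
  define a where "a j = norm2 M (Y j)" for j
  define e where "e i j = (if i \<le> j then j - i else i - j)" for i j :: nat
  have YM: "Y j \<in> L2 M M" if "j \<le> n" for j
    using L2[OF that] L2_G_M by blast
  have corr: "(\<integral>\<omega>. Y i \<omega> * Y j \<omega> \<partial>M) \<le> r ^ e i j * ((a i)\<^sup>2 / 2 + (a j)\<^sup>2 / 2)" if "i \<le> n" "j \<le> n" for i j
  proof -
    have *: "(\<integral>\<omega>. Y i \<omega> * Y j \<omega> \<partial>M) \<le> r ^ (j - i) * (a i * a j)" if "i \<le> j" "j \<le> n" for i j
      using mixing[of "Y i" i "Y j" j] that L2 mean L2_G_F unfolding a_def by (simp add: abs_le_iff)
    have "(\<integral>\<omega>. Y i \<omega> * Y j \<omega> \<partial>M) \<le> r ^ e i j * (a i * a j)"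
      using *[of i j] *[of j i] that by (auto simp: e_def mult.commute)
    also have "a i * a j \<le> (a i)\<^sup>2 / 2 + (a j)\<^sup>2 / 2"
      using sum_squares_bound[of "a i" "a j"] by simp
    finally show ?thesis
      using r by (simp add: mult_left_mono)
  qed
  have "(norm2 M (\<lambda>\<omega>. \<Sum>j\<le>n. Y j \<omega>))\<^sup>2 = (\<integral>\<omega>. (\<Sum>i\<le>n. \<Sum>j\<le>n. Y i \<omega> * Y j \<omega>) \<partial>M)"
    unfolding norm2_power2 by (simp add: power2_eq_square sum_product)
  also have "\<dots> = (\<Sum>i\<le>n. \<Sum>j\<le>n. \<integral>\<omega>. Y i \<omega> * Y j \<omega> \<partial>M)"
    by (subst Bochner_Integration.integral_sum)
      (auto intro!: sum.cong Bochner_Integration.integral_sum Bochner_Integration.integrable_sum L2_product_integrable YM)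
  also have "\<dots> \<le> (\<Sum>i\<le>n. \<Sum>j\<le>n. r ^ e i j * ((a i)\<^sup>2 / 2 + (a j)\<^sup>2 / 2))"
    by (intro sum_mono corr) auto
  also have "\<dots> = (\<Sum>i\<le>n. \<Sum>j\<le>n. r ^ e i j * ((a i)\<^sup>2 / 2)) + (\<Sum>i\<le>n. \<Sum>j\<le>n. r ^ e i j * ((a j)\<^sup>2 / 2))"
    by (simp add: distrib_left sum.distrib)
  also have "(\<Sum>i\<le>n. \<Sum>j\<le>n. r ^ e i j * ((a j)\<^sup>2 / 2)) = (\<Sum>i\<le>n. \<Sum>j\<le>n. r ^ e i j * ((a i)\<^sup>2 / 2))"
    by (subst sum.swap) (intro sum.cong refl, auto simp: e_def)
  also have "(\<Sum>i\<le>n. \<Sum>j\<le>n. r ^ e i j * ((a i)\<^sup>2 / 2)) = (\<Sum>i\<le>n. (\<Sum>j\<le>n. r ^ e i j) * ((a i)\<^sup>2 / 2))"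
    by (simp only: sum_distrib_right)
  also have "\<dots> + \<dots> = (\<Sum>i\<le>n. (\<Sum>j\<le>n. r ^ e i j) * (a i)\<^sup>2)"
    by (simp add: sum.distrib[symmetric] distrib_left[symmetric] mult.commute)
  also have "\<dots> \<le> (\<Sum>i\<le>n. 2 / (1 - r) * (a i)\<^sup>2)"
    unfolding e_def using r by (intro sum_mono mult_right_mono sum_abs_diff_power_le) auto
  also have "\<dots> = 2 / (1 - r) * (\<Sum>j\<le>n. (norm2 M (Y j))\<^sup>2)"
    by (simp add: a_def sum_distrib_left)
  finally show ?thesis .
qed

end

section \<open>Martingale approximation\<close>

text \<open>Extending the row by 0 outside 1..n removes boundary cases from the shifted indices k +
  i.\<close>

locale centred_array = corr_filtration +
  fixes X :: "nat \<Rightarrow> 'a \<Rightarrow> real"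
  assumes X_L2: "X k \<in> L2 M (G k)"
    and X_mean: "(\<integral>\<omega>. X k \<omega> \<partial>M) = 0"
    and X_outside: "k = 0 \<or> n < k \<Longrightarrow> X k = (\<lambda>\<omega>. 0)"
begin

text \<open>\<open>ahead i k\<close> is \<open>E(X\<^sub>k\<^sub>+\<^sub>i | \<xi>\<^sub>k)\<close>.\<close>
primrec ahead :: "nat \<Rightarrow> nat \<Rightarrow> 'a \<Rightarrow> real" where
  "ahead 0 k = X k"
| "ahead (Suc i) k = proj k (ahead i (Suc k))"

definition potential :: "nat \<Rightarrow> nat \<Rightarrow> 'a \<Rightarrow> real" where
  "potential m k \<omega> = (\<Sum>i\<le>m. ahead i k \<omega>)"

text \<open>A version of the conditional expectation of the potential at time k + 1 given the state
  at time k. It is defined termwise, so that the algebraic identities hold pointwise and not just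
  almost surely.\<close>

definition potential_next :: "nat \<Rightarrow> nat \<Rightarrow> 'a \<Rightarrow> real" where
  "potential_next m k \<omega> = (\<Sum>i\<le>m. ahead (Suc i) k \<omega>)"

definition mdiff :: "nat \<Rightarrow> nat \<Rightarrow> 'a \<Rightarrow> real" where
  "mdiff m k \<omega> = potential m (Suc k) \<omega> - potential_next m k \<omega>"

definition remainder :: "nat \<Rightarrow> 'a \<Rightarrow> real" where
  "remainder m \<omega> = (\<Sum>k\<le>n. ahead (Suc m) k \<omega>)"

lemma ahead_L2: "ahead i k \<in> L2 M (G k)"
  by (induction i arbitrary: k) (auto intro: X_L2 proj_L2 L2_G_M)

lemma ahead_mean: "(\<integral>\<omega>. ahead i k \<omega> \<partial>M) = 0"
  by (induction i arbitrary: k) (auto intro: X_mean proj_mean ahead_L2)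

lemma ahead_norm2: "norm2 M (ahead i k) \<le> r ^ i * norm2 M (X (k + i))"
proof (induction i arbitrary: k)
  case (Suc i)
  have "norm2 M (ahead (Suc i) k) \<le> r * norm2 M (ahead i (Suc k))"
    using proj_norm2[OF ahead_L2 ahead_mean] by simp
  also have "\<dots> \<le> r * (r ^ i * norm2 M (X (Suc k + i)))"
    using Suc[of "Suc k"] r by (intro mult_left_mono) auto
  finally show ?case
    by (simp add: mult.assoc)
qed simp

lemma ahead_abs_bound:
  assumes "\<And>k. AE \<omega> in M. \<bar>X k \<omega>\<bar> \<le> c" "0 \<le> c"
  shows "AE \<omega> in M. \<bar>ahead i k \<omega>\<bar> \<le> c"
proof (induction i arbitrary: k)
  case (Suc i)
  then show ?case
    using proj_abs_bound[of "ahead i (Suc k)" c k] L2_G_M[OF ahead_L2] assms(2) by (simp add: L2_def)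
qed (simp add: assms)

section \<open>Bounds, orthogonality and telescoping for the potentials\<close>

lemma potential_L2: "potential m k \<in> L2 M (G k)"
  unfolding potential_def[abs_def] by (intro L2_sum sub_GM ahead_L2)

lemma potential_next_L2: "potential_next m k \<in> L2 M (G k)"
  unfolding potential_next_def[abs_def] by (intro L2_sum sub_GM ahead_L2)

lemma potential_next_L2_F: "potential_next m k \<in> L2 M (F k)"
  by (rule L2_G_F[OF potential_next_L2])

lemma potential_mean: "(\<integral>\<omega>. potential m k \<omega> \<partial>M) = 0"
  unfolding potential_def[abs_def] 
  by (subst Bochner_Integration.integral_sum) (auto intro: L2_integrable L2_G_M ahead_L2 simp: ahead_mean)

lemma mdiff_L2: "mdiff m k \<in> L2 M (F (Suc k))"
  unfolding mdiff_def[abs_def]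
  using L2_G_F[OF potential_L2] L2_F_mono[OF potential_next_L2_F, of k "Suc k"] by (intro L2_diff sub_F) auto

lemma potential_abs_bound:
  assumes "\<And>k. AE \<omega> in M. \<bar>X k \<omega>\<bar> \<le> c" "0 \<le> c"
  shows "AE \<omega> in M. \<bar>potential m k \<omega>\<bar> \<le> real (Suc m) * c"
proof -
  have "AE \<omega> in M. \<forall>i. \<bar>ahead i k \<omega>\<bar> \<le> c"
    using ahead_abs_bound[OF assms] by (simp add: AE_all_countable)
  then show ?thesis
  proof eventually_elim
    case (elim \<omega>)
    have "\<bar>potential m k \<omega>\<bar> \<le> (\<Sum>i\<le>m. \<bar>ahead i k \<omega>\<bar>)"
      unfolding potential_def by (rule sum_abs)
    also have "\<dots> \<le> real (Suc m) * c"
      using sum_bounded_above[of "{..m}" "\<lambda>i. \<bar>ahead i k \<omega>\<bar>" c] elim by simp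
    finally show ?case .
  qed
qed

lemma potential_next_abs_bound:
  assumes "\<And>k. AE \<omega> in M. \<bar>X k \<omega>\<bar> \<le> c" "0 \<le> c"
  shows "AE \<omega> in M. \<bar>potential_next m k \<omega>\<bar> \<le> real (Suc m) * c"
proof -
  have "AE \<omega> in M. \<forall>i. \<bar>ahead i k \<omega>\<bar> \<le> c"
    using ahead_abs_bound[OF assms] by (simp add: AE_all_countable)
  then show ?thesis
  proof eventually_elim
    case (elim \<omega>)
    have "\<bar>potential_next m k \<omega>\<bar> \<le> (\<Sum>i\<le>m. \<bar>ahead (Suc i) k \<omega>\<bar>)"
      unfolding potential_next_def by (rule sum_abs)
    also have "\<dots> \<le> real (Suc m) * c"
      using sum_bounded_above[of "{..m}" "\<lambda>i. \<bar>ahead (Suc i) k \<omega>\<bar>" c] elim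
      by (simp del: ahead.simps)
    finally show ?case .
  qed
qed

lemma mdiff_abs_bound:
  assumes "\<And>k. AE \<omega> in M. \<bar>X k \<omega>\<bar> \<le> c" "0 \<le> c"
  shows "AE \<omega> in M. \<bar>mdiff m k \<omega>\<bar> \<le> 2 * (real (Suc m) * c)"
  using potential_abs_bound[OF assms, of m "Suc k"] potential_next_abs_bound[OF assms, of m k]
  by eventually_elim (simp add: mdiff_def abs_le_iff)

text \<open>Tested against \<open>W\<close>, the variables \<open>ahead i (Suc k)\<close> and
  \<open>ahead (Suc i) k\<close> have the same integral by the Markov property, so the two sums
  cancel term by term.\<close>

lemma mdiff_orthogonal:
  assumes "k < n" "W \<in> L2 M (F k)"
  shows "(\<integral>\<omega>. W \<omega> * mdiff m k \<omega> \<partial>M) = 0"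
proof -
  have int: "integrable M (\<lambda>\<omega>. W \<omega> * ahead i j \<omega>)" for i j
    using L2_product_integrable[OF L2_F_M[OF assms(2)] L2_G_M[OF ahead_L2]] .
  have "(\<integral>\<omega>. W \<omega> * mdiff m k \<omega> \<partial>M) =
      (\<integral>\<omega>. (\<Sum>i\<le>m. W \<omega> * ahead i (Suc k) \<omega>) - (\<Sum>i\<le>m. W \<omega> * ahead (Suc i) k \<omega>) \<partial>M)"
    unfolding mdiff_def potential_def potential_next_def
    by (simp only: right_diff_distrib sum_distrib_left)
  also have "\<dots> = (\<Sum>i\<le>m. \<integral>\<omega>. W \<omega> * ahead i (Suc k) \<omega> \<partial>M) - (\<Sum>i\<le>m. \<integral>\<omega>. W \<omega> * ahead (Suc i) k \<omega> \<partial>M)"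
    using int by (simp del: ahead.simps)
  also have "\<dots> = 0"
    using proj_inner[OF assms(1) ahead_L2 ahead_mean assms(2)] by simp
  finally show ?thesis .
qed

text \<open>An approximate Poisson equation: shifting the summation index loses the term
  \<open>X k\<close> and gains the term of index m + 1, which is the error of the cut.\<close>

lemma potential_next_eq: "potential_next m k \<omega> = potential m k \<omega> - X k \<omega> + ahead (Suc m) k \<omega>"
proof -
  have "(\<Sum>i\<le>Suc m. ahead i k \<omega>) = ahead 0 k \<omega> + potential_next m k \<omega>"
    unfolding potential_next_def by (rule sum.atMost_Suc_shift)
  moreover have "(\<Sum>i\<le>Suc m. ahead i k \<omega>) = potential m k \<omega> + ahead (Suc m) k \<omega>"
    unfolding potential_def by (rule sum.atMost_Suc)
  ultimately show ?thesis
    by (simp del: ahead.simps(2))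
qed

lemma sum_mdiff:
  assumes "a \<le> b"
  shows "(\<Sum>k=a..<b. mdiff m k \<omega>) =
    potential m b \<omega> - potential m a \<omega> + (\<Sum>k=a..<b. X k \<omega>) - (\<Sum>k=a..<b. ahead (Suc m) k \<omega>)"
  using assms
  by (induction b rule: dec_induct) (simp_all add: mdiff_def potential_next_eq del: ahead.simps)

lemma ahead_Suc_outside: "k = 0 \<or> n \<le> k \<Longrightarrow> ahead (Suc i) k = (\<lambda>\<omega>. 0)"
  by (auto simp: proj_def)

lemma potential_outside:
  assumes "k = 0 \<or> n \<le> k"
  shows "potential m k \<omega> = X k \<omega>"
proof -
  have "(\<Sum>i\<le>m. ahead i k \<omega>) = (\<Sum>i\<le>m. if i = 0 then X k \<omega> else 0)"
  proof (rule sum.cong[OF refl])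
    fix i
    show "ahead i k \<omega> = (if i = 0 then X k \<omega> else 0)"
      using ahead_Suc_outside[OF assms] by (cases i) (simp_all del: ahead.simps(2))
  qed
  then show ?thesis
    by (simp add: potential_def)
qed

text \<open>The boundary terms fit exactly: the potential is \<open>X 0\<close>, hence 0, at time 0,
  and \<open>X n\<close> at time n, which is the summand missing from the sum over k < n.\<close>

lemma martingale_decomposition: "(\<Sum>k\<le>n. X k \<omega>) = (\<Sum>k<n. mdiff m k \<omega>) + remainder m \<omega>"
proof -
  have "(\<Sum>k<n. mdiff m k \<omega>) = X n \<omega> - X 0 \<omega> + (\<Sum>k<n. X k \<omega>) - (\<Sum>k<n. ahead (Suc m) k \<omega>)"
    using sum_mdiff[of 0 n m \<omega>] potential_outside[of 0 m \<omega>] potential_outside[of n m \<omega>]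
    by (simp add: atLeast0LessThan del: ahead.simps)
  moreover have "remainder m \<omega> = (\<Sum>k<n. ahead (Suc m) k \<omega>)"
    unfolding remainder_def lessThan_Suc_atMost[symmetric]
    using ahead_Suc_outside[of n m] by (simp del: ahead.simps)
  moreover have "(\<Sum>k\<le>n. X k \<omega>) = (\<Sum>k<n. X k \<omega>) + X n \<omega>"
    by (simp add: lessThan_Suc_atMost[symmetric])
  ultimately show ?thesis
    by (simp add: X_outside)
qed

lemma sum_mdiff_L2: "b \<le> k \<Longrightarrow> (\<lambda>\<omega>. \<Sum>j=a..<b. mdiff m j \<omega>) \<in> L2 M (F k)"
  by (intro L2_sum sub_F L2_F_mono[OF mdiff_L2]) auto

text \<open>Pythagoras with a weight. The cross term vanishes because the weight times the earlier
  partial sum is still measurable with respect to \<open>F b\<close>. The weight 1 gives the second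
  moment of the martingale; a squared difference as weight serves for
  \<open>cov_sq_near\<close>.\<close>

lemma sum_mdiff_square:
  assumes W: "W \<in> borel_measurable (F a)" "AE \<omega> in M. \<bar>W \<omega>\<bar> \<le> w" and "a \<le> b" "b \<le> n"
  shows "(\<integral>\<omega>. W \<omega> * (\<Sum>k=a..<b. mdiff m k \<omega>)\<^sup>2 \<partial>M) = (\<Sum>k=a..<b. \<integral>\<omega>. W \<omega> * (mdiff m k \<omega>)\<^sup>2 \<partial>M)"
  using assms(3,4)
proof (induction b rule: dec_induct)
  case (step b)
  define s where "s \<omega> = (\<Sum>k=a..<b. mdiff m k \<omega>)" for \<omega>
  have WF: "W \<in> borel_measurable (F b)"
    using W(1) F_chain[OF step.hyps(1)] by (rule measurable_from_subalg[rotated])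
  have s: "s \<in> L2 M (F b)"
    unfolding s_def[abs_def] by (rule sum_mdiff_L2) simp
  have Ws: "(\<lambda>\<omega>. W \<omega> * s \<omega>) \<in> L2 M (F b)"
    by (rule L2_mult_AE_bounded[OF sub_F WF W(2) s])
  have WM: "W \<in> borel_measurable M"
    by (rule measurable_from_subalg[OF sub_F WF])
  have sM: "s \<in> L2 M M" and DM: "mdiff m b \<in> L2 M M"
    using s mdiff_L2 L2_F_M by blast+
  have i1: "integrable M (\<lambda>\<omega>. W \<omega> * (s \<omega>)\<^sup>2)"
    using L2_product_integrable[OF L2_F_M[OF Ws] sM] by (simp add: power2_eq_square mult.assoc)
  have i2: "integrable M (\<lambda>\<omega>. W \<omega> * s \<omega> * mdiff m b \<omega>)"
    by (rule L2_product_integrable[OF L2_F_M[OF Ws] DM])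
  have i3: "integrable M (\<lambda>\<omega>. W \<omega> * (mdiff m b \<omega>)\<^sup>2)"
    using L2_product_integrable[OF L2_mult_AE_bounded[OF subalgebra_self WM W(2) DM] DM]
    by (simp add: power2_eq_square mult.assoc)
  have "(\<integral>\<omega>. W \<omega> * (\<Sum>k=a..<Suc b. mdiff m k \<omega>)\<^sup>2 \<partial>M) =
      (\<integral>\<omega>. W \<omega> * (s \<omega>)\<^sup>2 + 2 * (W \<omega> * s \<omega> * mdiff m b \<omega>) + W \<omega> * (mdiff m b \<omega>)\<^sup>2 \<partial>M)"
    using step.hyps by (simp add: s_def power2_sum algebra_simps)
  also have "\<dots> = (\<integral>\<omega>. W \<omega> * (s \<omega>)\<^sup>2 \<partial>M) + (\<integral>\<omega>. W \<omega> * (mdiff m b \<omega>)\<^sup>2 \<partial>M)"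
    using i1 i2 i3 mdiff_orthogonal[OF _ Ws, of m] step.prems by simp
  finally show ?case
    using step by (simp add: s_def)
qed simp

lemma norm2_sum_mdiff: "(norm2 M (\<lambda>\<omega>. \<Sum>k<n. mdiff m k \<omega>))\<^sup>2 = (\<Sum>k<n. (norm2 M (mdiff m k))\<^sup>2)"
  using sum_mdiff_square[of "\<lambda>_. 1" 0 1 n m] unfolding norm2_power2 by (simp add: atLeast0LessThan)

lemma remainder_L2: "remainder m \<in> L2 M M"
  unfolding remainder_def[abs_def] by (intro L2_sum subalgebra_self L2_G_M[OF ahead_L2])

lemma norm2_X_outside: "n < k \<Longrightarrow> norm2 M (X k) = 0"
  by (simp add: X_outside norm2_def)

text \<open>The remainder is itself a sum of centred functions of single states, so the upper
  variance bound applies to it; each summand has been contracted m + 1 times, and indices shifted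
  beyond n contribute 0.\<close>

lemma norm2_remainder:
  "(norm2 M (remainder m))\<^sup>2 \<le> 2 / (1 - r) * ((r ^ Suc m)\<^sup>2 * (\<Sum>k\<le>n. (norm2 M (X k))\<^sup>2))"
proof -
  have "(norm2 M (remainder m))\<^sup>2 \<le> 2 / (1 - r) * (\<Sum>k\<le>n. (norm2 M (ahead (Suc m) k))\<^sup>2)"
    unfolding remainder_def[abs_def] by (intro second_moment_sum_le ahead_L2 ahead_mean)
  also have "(\<Sum>k\<le>n. (norm2 M (ahead (Suc m) k))\<^sup>2) \<le> (\<Sum>k\<le>n. (r ^ Suc m)\<^sup>2 * (norm2 M (X (k + Suc m)))\<^sup>2)"
    unfolding power_mult_distrib[symmetric] by (intro sum_mono power_mono ahead_norm2 norm2_nonneg)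
  also have "\<dots> = (r ^ Suc m)\<^sup>2 * (\<Sum>k\<in>(\<lambda>k. k + Suc m) ` {..n}. (norm2 M (X k))\<^sup>2)"
    by (subst sum.reindex) (auto simp: sum_distrib_left inj_on_def)
  also have "(\<Sum>k\<in>(\<lambda>k. k + Suc m) ` {..n}. (norm2 M (X k))\<^sup>2) =
      (\<Sum>k\<in>(\<lambda>k. k + Suc m) ` {..n} \<inter> {..n}. (norm2 M (X k))\<^sup>2)"
  proof (rule sum.mono_neutral_right)
    show "\<forall>k\<in>(\<lambda>k. k + Suc m) ` {..n} - (\<lambda>k. k + Suc m) ` {..n} \<inter> {..n}. (norm2 M (X k))\<^sup>2 = 0"
    proof
      fix k assume "k \<in> (\<lambda>k. k + Suc m) ` {..n} - (\<lambda>k. k + Suc m) ` {..n} \<inter> {..n}"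
      then have "n < k"
        by auto
      then show "(norm2 M (X k))\<^sup>2 = 0"
        by (simp add: norm2_X_outside)
    qed
  qed auto
  also have "\<dots> \<le> (\<Sum>k\<le>n. (norm2 M (X k))\<^sup>2)"
    by (intro sum_mono2) auto
  finally show ?thesis
    using r by (simp add: mult_left_mono divide_right_mono)
qed

text \<open>As for \<open>proj\<close>: orthogonality of the difference to
  \<open>potential_next\<close> turns the squared norm into an inner product with the potential, to
  which the contraction applies.\<close>

lemma norm2_potential_next: 
  assumes "k < n"
  shows "norm2 M (potential_next m k) \<le> r * norm2 M (potential m (Suc k))"
proof (cases "k = 0")
  case True
  then have "potential_next m k = (\<lambda>\<omega>. 0)"
    unfolding potential_next_def[abs_def] using ahead_Suc_outside[of k] by (simp del: ahead.simps)
  then show ?thesis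
    using r by (simp add: norm2_def)
next
  case False
  have "(norm2 M (potential_next m k))\<^sup>2 = (\<integral>\<omega>. potential_next m k \<omega> * potential m (Suc k) \<omega> \<partial>M)"
    using mdiff_orthogonal[OF assms potential_next_L2_F, of m m]
      L2_product_integrable[OF L2_F_M[OF potential_next_L2_F] L2_G_M[OF potential_L2], of m k m "Suc k"]
      L2_product_integrable[OF L2_F_M[OF potential_next_L2_F] L2_G_M[OF potential_next_L2], of m k m k]
    unfolding norm2_power2 by (simp add: mdiff_def right_diff_distrib power2_eq_square)
  also have "\<dots> \<le> r * norm2 M (potential_next m k) * norm2 M (potential m (Suc k))"
    using contraction[OF _ assms potential_next_L2 potential_L2 potential_mean, of m m] False
    by (simp add: abs_le_iff)
  finally have "norm2 M (potential_next m k) * norm2 M (potential_next m k) \<le>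
      norm2 M (potential_next m k) * (r * norm2 M (potential m (Suc k)))"
    by (simp add: power2_eq_square mult_ac)
  then show ?thesis
    using r norm2_nonneg[of M "potential_next m k"] norm2_nonneg[of M "potential m (Suc k)"]
    by (cases "norm2 M (potential_next m k) = 0") (auto simp: mult_le_cancel_left)
qed

text \<open>By orthogonality the squared norm of the difference is that of the potential minus that
  of its conditional expectation, and 1 - r^2 >= 1 - r.\<close>

lemma norm2_mdiff:
  assumes "k < n"
  shows "(1 - r) * (norm2 M (potential m (Suc k)))\<^sup>2 \<le> (norm2 M (mdiff m k))\<^sup>2"
proof -
  let ?p = "potential m (Suc k)" and ?q = "potential_next m k"
  have q: "?q \<in> L2 M M" and d: "mdiff m k \<in> L2 M M"
    using potential_next_L2_F mdiff_L2 L2_F_M by blast+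
  have "(norm2 M ?p)\<^sup>2 = (\<integral>\<omega>. (mdiff m k \<omega>)\<^sup>2 + 2 * (?q \<omega> * mdiff m k \<omega>) + (?q \<omega>)\<^sup>2 \<partial>M)"
    unfolding norm2_power2
    by (intro Bochner_Integration.integral_cong) (auto simp: mdiff_def power2_eq_square algebra_simps)
  also have "\<dots> = (norm2 M (mdiff m k))\<^sup>2 + (norm2 M ?q)\<^sup>2"
    using q d L2_product_integrable[OF q d] mdiff_orthogonal[OF assms potential_next_L2_F, of m m]
    unfolding norm2_power2 by (simp add: L2_def)
  finally have "(norm2 M (mdiff m k))\<^sup>2 = (norm2 M ?p)\<^sup>2 - (norm2 M ?q)\<^sup>2"
    by simp
  moreover have "(norm2 M ?q)\<^sup>2 \<le> (r * norm2 M ?p)\<^sup>2"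
    by (intro power_mono norm2_potential_next assms norm2_nonneg)
  moreover have "(r * norm2 M ?p)\<^sup>2 \<le> r * (norm2 M ?p)\<^sup>2"
  proof -
    have "r * (r * (norm2 M ?p)\<^sup>2) \<le> r * (1 * (norm2 M ?p)\<^sup>2)"
      using r by (intro mult_left_mono mult_right_mono) auto
    then show ?thesis
      by (simp add: power2_eq_square mult_ac)
  qed
  ultimately show ?thesis
    by (simp add: algebra_simps)
qed

text \<open>The lower variance bound. The potentials are controlled by the differences, whose
  squared norms add up to that of the sum; conversely each summand is a potential minus the
  projection of the next one, hence bounded by two potentials.\<close>

lemma second_moment_sum_ge:
  "(1 - r) * (\<Sum>k\<le>n. (norm2 M (X k))\<^sup>2) \<le> 4 * (norm2 M (\<lambda>\<omega>. \<Sum>k\<le>n. X k \<omega>))\<^sup>2"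
proof -
  let ?S = "\<lambda>\<omega>. \<Sum>k\<le>n. X k \<omega>" and ?D = "\<lambda>\<omega>. \<Sum>k<n. mdiff n k \<omega>"
  define p where "p k = (norm2 M (potential n k))\<^sup>2" for k
  \<comment> \<open>With cut m = n, looking n + 1 steps ahead always leaves the row, so the
    remainder vanishes in \<open>L2\<close>.\<close>
  have ahead0: "norm2 M (ahead (Suc n) k) = 0" for k
    using ahead_norm2[of "Suc n" k] norm2_X_outside[of "k + Suc n"] by (auto intro!: antisym)
  have rem0: "norm2 M (remainder n) = 0"
  proof -
    have "(norm2 M (remainder n))\<^sup>2 \<le> 2 / (1 - r) * (\<Sum>k\<le>n. (norm2 M (ahead (Suc n) k))\<^sup>2)"
      unfolding remainder_def[abs_def] by (intro second_moment_sum_le ahead_L2 ahead_mean)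
    then show ?thesis
      unfolding ahead0 by simp
  qed
  have S: "?S \<in> L2 M M"
    by (intro L2_sum subalgebra_self L2_G_M[OF X_L2])
  have "norm2 M ?D = norm2 M (\<lambda>\<omega>. ?S \<omega> - remainder n \<omega>)"
    by (simp add: martingale_decomposition[of _ n])
  also have "\<dots> \<le> norm2 M ?S"
    using norm2_triangle_diff[OF S remainder_L2[of n]] rem0 by simp
  finally have D_le: "(norm2 M ?D)\<^sup>2 \<le> (norm2 M ?S)\<^sup>2"
    by (intro power_mono norm2_nonneg)
  have "(\<Sum>k<n. (1 - r) * p (Suc k)) \<le> (norm2 M ?D)\<^sup>2"
    unfolding norm2_sum_mdiff p_def by (intro sum_mono norm2_mdiff) simp
  then have sum_p: "(1 - r) * (\<Sum>k<n. p (Suc k)) \<le> (norm2 M ?S)\<^sup>2"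
    unfolding sum_distrib_left using D_le by (rule order_trans)
  have X_le: "(norm2 M (X k))\<^sup>2 \<le> 2 * p k + 2 * p (Suc k)" if "k < n" for k
  proof -
    have L: "potential n k \<in> L2 M M" "potential_next n k \<in> L2 M M" "ahead (Suc n) k \<in> L2 M M"
      by (blast intro: L2_G_M potential_L2 potential_next_L2 ahead_L2)+
    have "norm2 M (X k) = norm2 M (\<lambda>\<omega>. (potential n k \<omega> - potential_next n k \<omega>) + ahead (Suc n) k \<omega>)"
      by (simp add: potential_next_eq del: ahead.simps)
    also have "\<dots> \<le> norm2 M (potential n k) + norm2 M (potential_next n k) + norm2 M (ahead (Suc n) k)"
      using norm2_triangle[OF L2_diff[OF subalgebra_self L(1,2)] L(3)] norm2_triangle_diff[OF L(1,2)] by linarith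
    also have "\<dots> \<le> norm2 M (potential n k) + norm2 M (potential n (Suc k))"
      unfolding ahead0 using norm2_potential_next[OF that, of n] r
        mult_right_mono[of r 1 "norm2 M (potential n (Suc k))"] by simp
    finally have "(norm2 M (X k))\<^sup>2 \<le> (norm2 M (potential n k) + norm2 M (potential n (Suc k)))\<^sup>2"
      by (intro power_mono norm2_nonneg)
    also have "\<dots> \<le> 2 * p k + 2 * p (Suc k)"
      unfolding p_def using sum_squares_bound[of "norm2 M (potential n k)" "norm2 M (potential n (Suc k))"]
      by (simp add: power2_sum)
    finally show ?thesis .
  qed
  have p0: "p 0 = 0"
    using X_outside[of 0] by (simp add: p_def norm2_def potential_outside)
  have pn: "(norm2 M (X n))\<^sup>2 = p n"
    by (simp add: p_def norm2_def potential_outside)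
  have "(\<Sum>k\<le>n. (norm2 M (X k))\<^sup>2) = (\<Sum>k<n. (norm2 M (X k))\<^sup>2) + p n"
    by (simp add: lessThan_Suc_atMost[symmetric] pn)
  \<comment> \<open>The last term is doubled so that it completes the first sum to k <= n; as
    \<open>p 0 = 0\<close>, that sum coincides with the shifted one.\<close>
  also have "\<dots> \<le> (\<Sum>k<n. 2 * p k + 2 * p (Suc k)) + 2 * p n"
    using X_le by (intro add_mono sum_mono) (auto simp: p_def)
  also have "\<dots> = 2 * (\<Sum>k<Suc n. p k) + 2 * (\<Sum>k<n. p (Suc k))"
    by (simp add: sum.distrib sum_distrib_left)
  also have "(\<Sum>k<Suc n. p k) = (\<Sum>k<n. p (Suc k))"
    by (subst sum.lessThan_Suc_shift) (simp add: p0)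
  finally have "(\<Sum>k\<le>n. (norm2 M (X k))\<^sup>2) \<le> 4 * (\<Sum>k<n. p (Suc k))"
    by simp
  then have "(1 - r) * (\<Sum>k\<le>n. (norm2 M (X k))\<^sup>2) \<le> (1 - r) * (4 * (\<Sum>k<n. p (Suc k)))"
    using r by (intro mult_left_mono) auto
  then show ?thesis
    using sum_p by simp
qed

end

section \<open>Quadratic variation for bounded arrays\<close>

text \<open>The condition on \<open>m\<close> says that the geometric tail from \<open>m\<close> on,
  r^m / (1 - r), is at most 1.\<close>

locale bounded_array = centred_array +
  fixes c :: real and m :: nat
  assumes X_bound: "AE \<omega> in M. \<bar>X k \<omega>\<bar> \<le> c"
    and c_nonneg: "0 \<le> c"
    and r_power_m: "r ^ m \<le> 1 - r"
begin

abbreviation "p \<equiv> potential m"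
abbreviation "q \<equiv> potential_next m"
abbreviation "D \<equiv> mdiff m"

definition pot_bound :: real where
  "pot_bound = real (Suc m) * c"

definition mdiff_sq :: "nat \<Rightarrow> 'a \<Rightarrow> real" where
  "mdiff_sq k \<omega> = (D k \<omega>)\<^sup>2"

definition mean_sq :: "nat \<Rightarrow> real" where
  "mean_sq k = (norm2 M (D k))\<^sup>2"

text \<open>The conditional variance of the difference given the state at time \<open>k\<close>. The
  squared difference involves two consecutive states, so the Markov property is not directly
  applicable to it; in this form only the squared potential at time k + 1 is conditioned, and the
  result is visibly \<open>G k\<close>-measurable.\<close>

definition cond_sq :: "nat \<Rightarrow> 'a \<Rightarrow> real" where
  "cond_sq k \<omega> = real_cond_exp M (G k) (\<lambda>\<omega>. (p (Suc k) \<omega>)\<^sup>2) \<omega> - (q k \<omega>)\<^sup>2"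

lemma pot_bound_nonneg: "0 \<le> pot_bound"
  using c_nonneg by (simp add: pot_bound_def)

lemma m_c_le_pot_bound: "real m * c \<le> pot_bound"
  using c_nonneg by (simp add: pot_bound_def mult_right_mono)

lemma p_bound: "AE \<omega> in M. \<bar>p k \<omega>\<bar> \<le> pot_bound"
  unfolding pot_bound_def by (rule potential_abs_bound[OF X_bound c_nonneg])

lemma q_bound: "AE \<omega> in M. \<bar>q k \<omega>\<bar> \<le> pot_bound"
  unfolding pot_bound_def by (rule potential_next_abs_bound[OF X_bound c_nonneg])

lemma D_bound: "AE \<omega> in M. \<bar>D k \<omega>\<bar> \<le> 2 * pot_bound"
  unfolding pot_bound_def by (rule mdiff_abs_bound[OF X_bound c_nonneg])

lemma square_le_of_abs_le: "\<bar>x\<bar> \<le> y \<Longrightarrow> x\<^sup>2 \<le> y\<^sup>2" for x y :: real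
  by (rule abs_le_square_iff[THEN iffD1]) simp

lemma mdiff_sq_bound: "AE \<omega> in M. \<bar>mdiff_sq k \<omega>\<bar> \<le> 4 * pot_bound\<^sup>2"
  using D_bound[of k]
proof eventually_elim
  case (elim \<omega>)
  from square_le_of_abs_le[OF this] show ?case
    by (simp add: mdiff_sq_def power_mult_distrib)
qed

lemma mdiff_sq_measurable_F: "mdiff_sq k \<in> borel_measurable (F (Suc k))"
  using L2_measurable[OF mdiff_L2] unfolding mdiff_sq_def[abs_def] by measurable

lemma mdiff_sq_L2: "mdiff_sq k \<in> L2 M (F (Suc k))"
  by (rule L2_AE_bounded[OF sub_F mdiff_sq_measurable_F mdiff_sq_bound])

lemma expectation_mdiff_sq: "(\<integral>\<omega>. mdiff_sq k \<omega> \<partial>M) = mean_sq k"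
  by (simp add: mdiff_sq_def mean_sq_def norm2_power2)

lemma mean_sq_nonneg: "0 \<le> mean_sq k"
  by (simp add: mean_sq_def)

lemma integrable_mdiff_sq: "integrable M (mdiff_sq k)"
  by (rule L2_integrable[OF L2_F_M[OF mdiff_sq_L2]])

lemma expectation_mult_mdiff_sq_le:
  assumes "W \<in> borel_measurable M" "AE \<omega> in M. \<bar>W \<omega>\<bar> \<le> w"
  shows "(\<integral>\<omega>. W \<omega> * mdiff_sq k \<omega> \<partial>M) \<le> w * mean_sq k"
proof -
  have "(\<integral>\<omega>. W \<omega> * mdiff_sq k \<omega> \<partial>M) \<le> (\<integral>\<omega>. w * mdiff_sq k \<omega> \<partial>M)"
  proof (rule integral_mono_AE)
    show "integrable M (\<lambda>\<omega>. W \<omega> * mdiff_sq k \<omega>)"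
      by (rule L2_product_integrable[OF L2_AE_bounded[OF subalgebra_self assms] L2_F_M[OF mdiff_sq_L2]])
    show "integrable M (\<lambda>\<omega>. w * mdiff_sq k \<omega>)"
      using integrable_mdiff_sq by simp
    show "AE \<omega> in M. W \<omega> * mdiff_sq k \<omega> \<le> w * mdiff_sq k \<omega>"
      using assms(2) by eventually_elim (auto simp: mdiff_sq_def intro!: mult_right_mono)
  qed
  then show ?thesis
    by (simp add: expectation_mdiff_sq)
qed

lemma norm2_mdiff_sq: "norm2 M (mdiff_sq k) \<le> 2 * pot_bound * norm2 M (D k)"
proof (rule power2_le_imp_le)
  have "(norm2 M (mdiff_sq k))\<^sup>2 = (\<integral>\<omega>. mdiff_sq k \<omega> * mdiff_sq k \<omega> \<partial>M)"
    unfolding norm2_power2 by (simp add: power2_eq_square)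
  also have "\<dots> \<le> 4 * pot_bound\<^sup>2 * mean_sq k"
    by (intro expectation_mult_mdiff_sq_le mdiff_sq_bound L2_measurable[OF L2_F_M[OF mdiff_sq_L2]])
  also have "\<dots> = (2 * pot_bound * norm2 M (D k))\<^sup>2"
    by (simp add: mean_sq_def power_mult_distrib)
  finally show "(norm2 M (mdiff_sq k))\<^sup>2 \<le> (2 * pot_bound * norm2 M (D k))\<^sup>2" .
  show "0 \<le> 2 * pot_bound * norm2 M (D k)"
    using pot_bound_nonneg by simp
qed

lemma p_square_L2: "(\<lambda>\<omega>. (p k \<omega>)\<^sup>2) \<in> L2 M (G k)"
  using L2_mult_AE_bounded[OF sub_GM L2_measurable[OF potential_L2] p_bound potential_L2]
  by (simp add: power2_eq_square)

lemma q_square_L2: "(\<lambda>\<omega>. (q k \<omega>)\<^sup>2) \<in> L2 M (G k)"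
  using L2_mult_AE_bounded[OF sub_GM L2_measurable[OF potential_next_L2] q_bound potential_next_L2]
  by (simp add: power2_eq_square)

lemma cond_sq_L2: "cond_sq k \<in> L2 M (G k)"
  unfolding cond_sq_def[abs_def]
  by (intro L2_diff sub_GM real_cond_exp_L2[OF sub_GM] q_square_L2 L2_G_M[OF p_square_L2])

lemma cond_sq_bound: "AE \<omega> in M. \<bar>cond_sq k \<omega>\<bar> \<le> pot_bound\<^sup>2"
proof -
  interpret G: sigma_finite_subalgebra M "G k"
    by (rule sigma_finite_subalgebra_of[OF sub_GM])
  have meas: "(\<lambda>\<omega>. (p (Suc k) \<omega>)\<^sup>2) \<in> borel_measurable M"
    by (rule L2_measurable[OF L2_G_M[OF p_square_L2]])
  have "AE \<omega> in M. \<bar>(p (Suc k) \<omega>)\<^sup>2\<bar> \<le> pot_bound\<^sup>2"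
    using p_bound[of "Suc k"] by eventually_elim (simp add: square_le_of_abs_le)
  then have "AE \<omega> in M. \<bar>real_cond_exp M (G k) (\<lambda>\<omega>. (p (Suc k) \<omega>)\<^sup>2) \<omega>\<bar> \<le> pot_bound\<^sup>2"
    by (rule real_cond_exp_abs_bound[OF meas])
  moreover have "AE \<omega> in M. 0 \<le> real_cond_exp M (G k) (\<lambda>\<omega>. (p (Suc k) \<omega>)\<^sup>2) \<omega>"
    by (rule G.real_cond_exp_pos[OF _ meas]) simp
  moreover note q_bound[of k]
  ultimately show ?thesis
  proof eventually_elim
    case (elim \<omega>)
    then show ?case
      unfolding cond_sq_def using square_le_of_abs_le[OF elim(3)] zero_le_power2[of "q k \<omega>"] by linarith
  qed
qed

text \<open>From (p - q)^2 = p^2 - q^2 - 2 q (p - q): the last term is orthogonal to the bounded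
  past weight, and p^2 is a function of the next state.\<close>

lemma cond_sq_inner:
  assumes "1 \<le> k" "k < n" "W \<in> borel_measurable (F k)" "AE \<omega> in M. \<bar>W \<omega>\<bar> \<le> w"
  shows "(\<integral>\<omega>. W \<omega> * mdiff_sq k \<omega> \<partial>M) = (\<integral>\<omega>. W \<omega> * cond_sq k \<omega> \<partial>M)"
proof -
  have W: "W \<in> L2 M (F k)"
    by (rule L2_AE_bounded[OF sub_F assms(3,4)])
  have Wq: "(\<lambda>\<omega>. W \<omega> * q k \<omega>) \<in> L2 M (F k)"
    by (rule L2_mult_AE_bounded[OF sub_F assms(3,4) potential_next_L2_F])
  let ?e = "real_cond_exp M (G k) (\<lambda>\<omega>. (p (Suc k) \<omega>)\<^sup>2)"
  have i1: "integrable M (\<lambda>\<omega>. W \<omega> * (p (Suc k) \<omega>)\<^sup>2)"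
    by (rule L2_product_integrable[OF L2_F_M[OF W] L2_G_M[OF p_square_L2]])
  have i2: "integrable M (\<lambda>\<omega>. W \<omega> * (q k \<omega>)\<^sup>2)"
    by (rule L2_product_integrable[OF L2_F_M[OF W] L2_G_M[OF q_square_L2]])
  have i3: "integrable M (\<lambda>\<omega>. W \<omega> * q k \<omega> * D k \<omega>)"
    by (rule L2_product_integrable[OF L2_F_M[OF Wq] L2_F_M[OF mdiff_L2]])
  have i4: "integrable M (\<lambda>\<omega>. W \<omega> * ?e \<omega>)"
    by (rule L2_product_integrable[OF L2_F_M[OF W] L2_G_M[OF real_cond_exp_L2[OF sub_GM L2_G_M[OF p_square_L2]]]])
  have "(\<integral>\<omega>. W \<omega> * mdiff_sq k \<omega> \<partial>M) =
      (\<integral>\<omega>. W \<omega> * (p (Suc k) \<omega>)\<^sup>2 - W \<omega> * (q k \<omega>)\<^sup>2 - 2 * (W \<omega> * q k \<omega> * D k \<omega>) \<partial>M)"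
    by (intro Bochner_Integration.integral_cong) (auto simp: mdiff_sq_def mdiff_def power2_eq_square algebra_simps)
  also have "\<dots> = (\<integral>\<omega>. W \<omega> * (p (Suc k) \<omega>)\<^sup>2 \<partial>M) - (\<integral>\<omega>. W \<omega> * (q k \<omega>)\<^sup>2 \<partial>M)"
    using i1 i2 i3 mdiff_orthogonal[OF assms(2) Wq, of m] by simp
  also have "(\<integral>\<omega>. W \<omega> * (p (Suc k) \<omega>)\<^sup>2 \<partial>M) = (\<integral>\<omega>. W \<omega> * ?e \<omega> \<partial>M)"
    by (rule markov[OF assms(1,2) p_square_L2 W])
  also have "\<dots> - (\<integral>\<omega>. W \<omega> * (q k \<omega>)\<^sup>2 \<partial>M) = (\<integral>\<omega>. W \<omega> * cond_sq k \<omega> \<partial>M)"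
    using i2 i4 by (simp add: cond_sq_def right_diff_distrib)
  finally show ?thesis .
qed

lemma expectation_cond_sq: "1 \<le> k \<Longrightarrow> k < n \<Longrightarrow> (\<integral>\<omega>. cond_sq k \<omega> \<partial>M) = mean_sq k"
  using cond_sq_inner[of k "\<lambda>_. 1" 1] by (simp add: expectation_mdiff_sq)

text \<open>Choosing the conditional variance itself as weight in \<open>cond_sq_inner\<close>
  reduces its second moment to its sup bound times the mean of the squared difference.\<close>

lemma norm2_cond_sq:
  assumes "1 \<le> k" "k < n"
  shows "norm2 M (cond_sq k) \<le> pot_bound * norm2 M (D k)"
proof (rule power2_le_imp_le)
  have "(norm2 M (cond_sq k))\<^sup>2 = (\<integral>\<omega>. cond_sq k \<omega> * cond_sq k \<omega> \<partial>M)"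
    unfolding norm2_power2 by (simp add: power2_eq_square)
  also have "\<dots> = (\<integral>\<omega>. cond_sq k \<omega> * mdiff_sq k \<omega> \<partial>M)"
    by (rule cond_sq_inner[symmetric, OF assms L2_measurable[OF L2_G_F[OF cond_sq_L2]] cond_sq_bound])
  also have "\<dots> \<le> pot_bound\<^sup>2 * mean_sq k"
    by (intro expectation_mult_mdiff_sq_le cond_sq_bound L2_measurable[OF L2_G_M[OF cond_sq_L2]])
  also have "\<dots> = (pot_bound * norm2 M (D k))\<^sup>2"
    by (simp add: mean_sq_def power_mult_distrib)
  finally show "(norm2 M (cond_sq k))\<^sup>2 \<le> (pot_bound * norm2 M (D k))\<^sup>2" .
  show "0 \<le> pot_bound * norm2 M (D k)"
    using pot_bound_nonneg by simp
qed

section \<open>Covariances of the squared martingale differences\<close>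

definition cov_sq :: "nat \<Rightarrow> nat \<Rightarrow> real" where
  "cov_sq i j = (\<integral>\<omega>. mdiff_sq i \<omega> * mdiff_sq j \<omega> \<partial>M) - mean_sq i * mean_sq j"

text \<open>The later square is replaced by its conditional variance, a function of the state at
  time j; the earlier one is known at time i + 1, whence the exponent j - (i + 1). Summing this over
  all j would cost 1 / (1 - r), so it is applied only to distances beyond m.\<close>

lemma cov_sq_far:
  assumes "i < j" "j < n"
  shows "cov_sq i j \<le> r ^ (j - Suc i) * (pot_bound\<^sup>2 * (mean_sq i + mean_sq j))"
proof -
  define w where "w \<omega> = cond_sq j \<omega> - mean_sq j" for \<omega>
  have j: "1 \<le> j"
    using assms by simp
  note vM = L2_G_M[OF cond_sq_L2[of j]]
  have w_L2: "w \<in> L2 M (G j)"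
    unfolding w_def[abs_def] by (intro L2_diff sub_GM cond_sq_L2 L2_const)
  have w_mean: "(\<integral>\<omega>. w \<omega> \<partial>M) = 0"
    using expectation_cond_sq[OF j assms(2)] L2_integrable[OF vM] by (simp add: w_def prob_space)
  have w_norm: "norm2 M w \<le> norm2 M (cond_sq j)"
  proof (rule power2_le_imp_le)
    have "(norm2 M w)\<^sup>2 = (\<integral>\<omega>. (cond_sq j \<omega>)\<^sup>2 - 2 * mean_sq j * cond_sq j \<omega> + (mean_sq j)\<^sup>2 \<partial>M)"
      unfolding norm2_power2 w_def by (intro Bochner_Integration.integral_cong) (auto simp: power2_diff)
    also have "\<dots> = (norm2 M (cond_sq j))\<^sup>2 - (mean_sq j)\<^sup>2"
      using expectation_cond_sq[OF j assms(2)] L2_integrable[OF vM] L2_square_integrable[OF vM]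
      unfolding norm2_power2 by (simp add: prob_space power2_eq_square)
    finally show "(norm2 M w)\<^sup>2 \<le> (norm2 M (cond_sq j))\<^sup>2"
      by simp
  qed simp
  have Vj: "mdiff_sq i \<in> L2 M (F j)"
    using assms by (intro L2_F_mono[OF mdiff_sq_L2]) simp
  have "(\<integral>\<omega>. mdiff_sq i \<omega> * mdiff_sq j \<omega> \<partial>M) = (\<integral>\<omega>. mdiff_sq i \<omega> * cond_sq j \<omega> \<partial>M)"
    by (rule cond_sq_inner[OF j assms(2) L2_measurable[OF Vj] mdiff_sq_bound])
  then have "cov_sq i j = (\<integral>\<omega>. mdiff_sq i \<omega> * w \<omega> \<partial>M)"
    using L2_product_integrable[OF L2_F_M[OF Vj] vM] integrable_mdiff_sq[of i]
    by (simp add: cov_sq_def w_def right_diff_distrib expectation_mdiff_sq)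
  also have "\<dots> \<le> r ^ (j - Suc i) * (norm2 M (mdiff_sq i) * norm2 M w)"
    using mixing[OF mdiff_sq_L2 w_L2 w_mean, of i] assms by (simp add: abs_le_iff)
  also have "\<dots> \<le> r ^ (j - Suc i) * ((2 * pot_bound * norm2 M (D i)) * (pot_bound * norm2 M (D j)))"
    using r w_norm norm2_cond_sq[OF j assms(2)] pot_bound_nonneg
    by (intro mult_left_mono mult_mono norm2_mdiff_sq) auto
  also have "\<dots> \<le> r ^ (j - Suc i) * (pot_bound\<^sup>2 * (mean_sq i + mean_sq j))"
  proof (intro mult_left_mono)
    have "pot_bound\<^sup>2 * (2 * norm2 M (D i) * norm2 M (D j)) \<le> pot_bound\<^sup>2 * (mean_sq i + mean_sq j)"
      unfolding mean_sq_def by (intro mult_left_mono sum_squares_bound) simp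
    then show "(2 * pot_bound * norm2 M (D i)) * (pot_bound * norm2 M (D j)) \<le> pot_bound\<^sup>2 * (mean_sq i + mean_sq j)"
      by (simp add: power2_eq_square mult_ac)
  qed (use r in simp)
  finally show ?thesis .
qed

text \<open>The sum of \<open>m\<close> consecutive differences telescopes and is of the order of a single potential.\<close>
lemma sum_mdiff_bound:
  assumes "i \<le> b" "b \<le> i + m"
  shows "AE \<omega> in M. \<bar>\<Sum>k=i..<b. D k \<omega>\<bar> \<le> 4 * pot_bound"
proof -
  have "AE \<omega> in M. \<forall>k. \<bar>X k \<omega>\<bar> \<le> c"
    using X_bound by (simp add: AE_all_countable)
  moreover have "AE \<omega> in M. \<forall>k. \<bar>ahead (Suc m) k \<omega>\<bar> \<le> c"
    using ahead_abs_bound[OF X_bound c_nonneg] by (simp add: AE_all_countable del: ahead.simps)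
  moreover note p_bound[of i] p_bound[of b]
  ultimately show ?thesis
  proof eventually_elim
    case (elim \<omega>)
    have s: "\<bar>\<Sum>k=i..<b. f k\<bar> \<le> pot_bound" if "\<And>k. \<bar>f k\<bar> \<le> c" for f :: "nat \<Rightarrow> real"
    proof -
      have "\<bar>\<Sum>k=i..<b. f k\<bar> \<le> (\<Sum>k=i..<b. \<bar>f k\<bar>)"
        by (rule sum_abs)
      also have "\<dots> \<le> real (b - i) * c"
        using sum_bounded_above[of "{i..<b}" "\<lambda>k. \<bar>f k\<bar>" c] that by simp
      also have "\<dots> \<le> real m * c"
        using assms c_nonneg by (intro mult_right_mono) auto
      also have "\<dots> \<le> pot_bound"
        by (rule m_c_le_pot_bound)
      finally show ?thesis .
    qed
    have "\<bar>\<Sum>k=i..<b. X k \<omega>\<bar> \<le> pot_bound" "\<bar>\<Sum>k=i..<b. ahead (Suc m) k \<omega>\<bar> \<le> pot_bound"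
      using elim(1,2) by (auto intro!: s simp del: ahead.simps)
    then show ?case
      using elim(3,4) unfolding sum_mdiff[OF assms(1)] by linarith
  qed
qed

lemma cov_sq_near:
  assumes "Suc i \<le> b" "b \<le> Suc i + m" "b \<le> n"
  shows "(\<Sum>j=Suc i..<b. cov_sq i j) \<le> 16 * pot_bound\<^sup>2 * mean_sq i"
proof -
  define s where "s \<omega> = (\<Sum>k=Suc i..<b. D k \<omega>)" for \<omega>
  have s_L2: "s \<in> L2 M M"
    unfolding s_def[abs_def] by (rule L2_F_M[OF sum_mdiff_L2[OF order_refl]])
  have s_bound: "AE \<omega> in M. \<bar>(s \<omega>)\<^sup>2\<bar> \<le> 16 * pot_bound\<^sup>2"
    using sum_mdiff_bound[OF assms(1,2)]
  proof eventually_elim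
    case (elim \<omega>)
    from square_le_of_abs_le[OF this] show ?case
      by (simp add: s_def power_mult_distrib)
  qed
  have "(\<Sum>j=Suc i..<b. cov_sq i j) \<le> (\<Sum>j=Suc i..<b. \<integral>\<omega>. mdiff_sq i \<omega> * mdiff_sq j \<omega> \<partial>M)"
    unfolding cov_sq_def by (intro sum_mono) (simp add: mean_sq_nonneg)
  also have "\<dots> = (\<integral>\<omega>. mdiff_sq i \<omega> * (s \<omega>)\<^sup>2 \<partial>M)"
    using sum_mdiff_square[OF mdiff_sq_measurable_F mdiff_sq_bound assms(1,3), of m] unfolding s_def by (simp add: mdiff_sq_def)
  also have "\<dots> = (\<integral>\<omega>. (s \<omega>)\<^sup>2 * mdiff_sq i \<omega> \<partial>M)"
    by (simp add: mult.commute)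
  also have "\<dots> \<le> 16 * pot_bound\<^sup>2 * mean_sq i"
    using L2_measurable[OF s_L2] by (intro expectation_mult_mdiff_sq_le s_bound) simp
  finally show ?thesis .
qed

text \<open>The powers of \<open>r\<close> sum to at most 1 over j for fixed i and over i for fixed
  j, so each of the two means is counted at most once.\<close>

lemma sum_cov_sq_far_le:
  "(\<Sum>i<n. \<Sum>j=Suc i + m..<n. r ^ (j - Suc i) * (pot_bound\<^sup>2 * (mean_sq i + mean_sq j))) \<le> 2 * pot_bound\<^sup>2 * (\<Sum>i<n. mean_sq i)"
proof -
  have geo: "(\<Sum>k\<in>K. r ^ k) \<le> 1" if "finite K" "\<And>k. k \<in> K \<Longrightarrow> m \<le> k" for K
  proof -
    have "(\<Sum>k\<in>K. r ^ k) \<le> r ^ m / (1 - r)"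
      using r that by (intro sum_power_le_geometric) auto
    also have "\<dots> \<le> 1"
      using r r_power_m by simp
    finally show ?thesis .
  qed
  have 1: "(\<Sum>i<n. \<Sum>j=Suc i + m..<n. r ^ (j - Suc i) * (pot_bound\<^sup>2 * mean_sq i)) \<le> (\<Sum>i<n. pot_bound\<^sup>2 * mean_sq i)"
  proof (rule sum_mono)
    fix i
    have "(\<Sum>j=Suc i + m..<n. r ^ (j - Suc i)) = (\<Sum>k\<in>(\<lambda>j. j - Suc i) ` {Suc i + m..<n}. r ^ k)"
      by (subst sum.reindex) (auto simp: inj_on_def)
    also have "\<dots> \<le> 1"
      by (rule geo) auto
    finally have "(\<Sum>j=Suc i + m..<n. r ^ (j - Suc i)) * (pot_bound\<^sup>2 * mean_sq i) \<le> 1 * (pot_bound\<^sup>2 * mean_sq i)"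
      by (intro mult_right_mono) (simp_all add: mean_sq_nonneg)
    then show "(\<Sum>j=Suc i + m..<n. r ^ (j - Suc i) * (pot_bound\<^sup>2 * mean_sq i)) \<le> pot_bound\<^sup>2 * mean_sq i"
      by (simp add: sum_distrib_right)
  qed
  have "(\<Sum>i<n. \<Sum>j=Suc i + m..<n. r ^ (j - Suc i) * (pot_bound\<^sup>2 * mean_sq j)) =
      (\<Sum>i<n. \<Sum>j<n. if Suc i + m \<le> j then r ^ (j - Suc i) * (pot_bound\<^sup>2 * mean_sq j) else 0)"
  proof (rule sum.cong[OF refl])
    fix i
    have "(\<Sum>j<n. if Suc i + m \<le> j then r ^ (j - Suc i) * (pot_bound\<^sup>2 * mean_sq j) else 0) =
        (\<Sum>j\<in>{j \<in> {..<n}. Suc i + m \<le> j}. r ^ (j - Suc i) * (pot_bound\<^sup>2 * mean_sq j))"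
      by (rule sum.inter_filter[symmetric]) simp
    also have "{j \<in> {..<n}. Suc i + m \<le> j} = {Suc i + m..<n}"
      by auto
    finally show "(\<Sum>j=Suc i + m..<n. r ^ (j - Suc i) * (pot_bound\<^sup>2 * mean_sq j)) =
      (\<Sum>j<n. if Suc i + m \<le> j then r ^ (j - Suc i) * (pot_bound\<^sup>2 * mean_sq j) else 0)" ..
  qed
  also have "\<dots> = (\<Sum>j<n. \<Sum>i<n. if Suc i + m \<le> j then r ^ (j - Suc i) * (pot_bound\<^sup>2 * mean_sq j) else 0)"
    by (rule sum.swap)
  also have "\<dots> \<le> (\<Sum>j<n. pot_bound\<^sup>2 * mean_sq j)"
  proof (rule sum_mono)
    fix j
    have "(\<Sum>i<n. if Suc i + m \<le> j then r ^ (j - Suc i) * (pot_bound\<^sup>2 * mean_sq j) else 0) =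
        (\<Sum>i\<in>{i \<in> {..<n}. Suc i + m \<le> j}. r ^ (j - Suc i) * (pot_bound\<^sup>2 * mean_sq j))"
      by (rule sum.inter_filter[symmetric]) simp
    also have "\<dots> = (\<Sum>i\<in>{i \<in> {..<n}. Suc i + m \<le> j}. r ^ (j - Suc i)) * (pot_bound\<^sup>2 * mean_sq j)"
      by (simp add: sum_distrib_right)
    also have "(\<Sum>i\<in>{i \<in> {..<n}. Suc i + m \<le> j}. r ^ (j - Suc i)) =
        (\<Sum>k\<in>(\<lambda>i. j - Suc i) ` {i \<in> {..<n}. Suc i + m \<le> j}. r ^ k)"
      by (subst sum.reindex) (auto simp: inj_on_def)
    also have "\<dots> * (pot_bound\<^sup>2 * mean_sq j) \<le> 1 * (pot_bound\<^sup>2 * mean_sq j)"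
      by (intro mult_right_mono geo) (auto simp: mean_sq_nonneg)
    finally show "(\<Sum>i<n. if Suc i + m \<le> j then r ^ (j - Suc i) * (pot_bound\<^sup>2 * mean_sq j) else 0) \<le> pot_bound\<^sup>2 * mean_sq j"
      by simp
  qed
  finally have "(\<Sum>i<n. \<Sum>j=Suc i + m..<n. r ^ (j - Suc i) * (pot_bound\<^sup>2 * mean_sq j)) \<le> (\<Sum>j<n. pot_bound\<^sup>2 * mean_sq j)" .
  with 1 show ?thesis
    by (simp add: distrib_left sum.distrib sum_distrib_left[symmetric])
qed

text \<open>The constant is 4 from the diagonal plus twice (16 from short distances and 2 from long
  ones).\<close>

lemma second_moment_sum_mdiff_sq:
  "(norm2 M (\<lambda>\<omega>. (\<Sum>k<n. mdiff_sq k \<omega>) - (\<Sum>k<n. mean_sq k)))\<^sup>2 \<le> 40 * pot_bound\<^sup>2 * (\<Sum>k<n. mean_sq k)"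
proof -
  have VM: "mdiff_sq k \<in> L2 M M" for k
    by (rule L2_F_M[OF mdiff_sq_L2])
  have "(norm2 M (\<lambda>\<omega>. (\<Sum>k<n. mdiff_sq k \<omega>) - (\<Sum>k<n. mean_sq k)))\<^sup>2 =
      (\<integral>\<omega>. (\<Sum>i<n. \<Sum>j<n. (mdiff_sq i \<omega> - mean_sq i) * (mdiff_sq j \<omega> - mean_sq j)) \<partial>M)"
    unfolding norm2_power2 by (simp add: sum_subtractf[symmetric] power2_eq_square sum_product)
  also have "\<dots> = (\<Sum>i<n. \<Sum>j<n. \<integral>\<omega>. (mdiff_sq i \<omega> - mean_sq i) * (mdiff_sq j \<omega> - mean_sq j) \<partial>M)"
  proof -
    have "integrable M (\<lambda>\<omega>. (mdiff_sq i \<omega> - mean_sq i) * (mdiff_sq j \<omega> - mean_sq j))" for i j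
      by (intro L2_product_integrable L2_diff subalgebra_self VM L2_const)
    then show ?thesis
      by (subst Bochner_Integration.integral_sum)
        (auto intro!: sum.cong Bochner_Integration.integral_sum Bochner_Integration.integrable_sum)
  qed
  also have "\<dots> = (\<Sum>i<n. \<Sum>j<n. cov_sq i j)"
  proof (intro sum.cong refl)
    fix i j
    have "(\<integral>\<omega>. (mdiff_sq i \<omega> - mean_sq i) * (mdiff_sq j \<omega> - mean_sq j) \<partial>M) =
        (\<integral>\<omega>. mdiff_sq i \<omega> * mdiff_sq j \<omega> - mean_sq j * mdiff_sq i \<omega> - mean_sq i * mdiff_sq j \<omega> + mean_sq i * mean_sq j \<partial>M)"
      by (intro Bochner_Integration.integral_cong) (auto simp: algebra_simps)
    also have "\<dots> = cov_sq i j"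
      using L2_product_integrable[OF VM VM, of i j] integrable_mdiff_sq
      by (simp add: expectation_mdiff_sq cov_sq_def prob_space)
    finally show "(\<integral>\<omega>. (mdiff_sq i \<omega> - mean_sq i) * (mdiff_sq j \<omega> - mean_sq j) \<partial>M) = cov_sq i j" .
  qed
  also have "\<dots> = (\<Sum>i<n. cov_sq i i) + 2 * (\<Sum>i<n. \<Sum>j=Suc i..<n. cov_sq i j)"
    by (rule sum_symmetric_split) (simp add: cov_sq_def mult.commute)
  finally have split: "(norm2 M (\<lambda>\<omega>. (\<Sum>k<n. mdiff_sq k \<omega>) - (\<Sum>k<n. mean_sq k)))\<^sup>2 =
    (\<Sum>i<n. cov_sq i i) + 2 * (\<Sum>i<n. \<Sum>j=Suc i..<n. cov_sq i j)" .
  have diag: "(\<Sum>i<n. cov_sq i i) \<le> (\<Sum>i<n. 4 * pot_bound\<^sup>2 * mean_sq i)"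
  proof (rule sum_mono)
    fix i
    have "cov_sq i i \<le> (\<integral>\<omega>. mdiff_sq i \<omega> * mdiff_sq i \<omega> \<partial>M)"
      by (simp add: cov_sq_def)
    also have "\<dots> \<le> 4 * pot_bound\<^sup>2 * mean_sq i"
      by (intro expectation_mult_mdiff_sq_le mdiff_sq_bound L2_measurable[OF VM])
    finally show "cov_sq i i \<le> 4 * pot_bound\<^sup>2 * mean_sq i" .
  qed
  have "(\<Sum>i<n. \<Sum>j=Suc i..<n. cov_sq i j) \<le>
      (\<Sum>i<n. 16 * pot_bound\<^sup>2 * mean_sq i + (\<Sum>j=Suc i + m..<n. r ^ (j - Suc i) * (pot_bound\<^sup>2 * (mean_sq i + mean_sq j))))"
  proof (rule sum_mono)
    fix i assume "i \<in> {..<n}"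
    define b where "b = min n (Suc i + m)"
    have b: "Suc i \<le> b" "b \<le> n" "b \<le> Suc i + m"
      using \<open>i \<in> {..<n}\<close> by (auto simp: b_def)
    have "(\<Sum>j=Suc i..<n. cov_sq i j) = (\<Sum>j=Suc i..<b. cov_sq i j) + (\<Sum>j=b..<n. cov_sq i j)"
      using b by (simp add: sum.atLeastLessThan_concat)
    moreover have "(\<Sum>j=b..<n. cov_sq i j) \<le> (\<Sum>j=Suc i + m..<n. r ^ (j - Suc i) * (pot_bound\<^sup>2 * (mean_sq i + mean_sq j)))"
    proof -
      have "{b..<n} = {Suc i + m..<n}"
        by (auto simp: b_def)
      then show ?thesis
        by (auto intro!: sum_mono cov_sq_far)
    qed
    ultimately show "(\<Sum>j=Suc i..<n. cov_sq i j) \<le>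
        16 * pot_bound\<^sup>2 * mean_sq i + (\<Sum>j=Suc i + m..<n. r ^ (j - Suc i) * (pot_bound\<^sup>2 * (mean_sq i + mean_sq j)))"
      using cov_sq_near[OF b(1,3,2)] by linarith
  qed
  also have "\<dots> \<le> 16 * pot_bound\<^sup>2 * (\<Sum>k<n. mean_sq k) + 2 * pot_bound\<^sup>2 * (\<Sum>k<n. mean_sq k)"
    unfolding sum.distrib sum_distrib_left[of "16 * pot_bound\<^sup>2"] by (intro add_left_mono sum_cov_sq_far_le)
  finally have off: "(\<Sum>i<n. \<Sum>j=Suc i..<n. cov_sq i j) \<le> 16 * pot_bound\<^sup>2 * (\<Sum>k<n. mean_sq k) + 2 * pot_bound\<^sup>2 * (\<Sum>k<n. mean_sq k)" .
  have "(\<Sum>i<n. cov_sq i i) \<le> 4 * pot_bound\<^sup>2 * (\<Sum>k<n. mean_sq k)"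
    using diag by (simp only: sum_distrib_left)
  with split off show ?thesis
    by linarith
qed

text \<open>After normalisation by \<open>A\<close> the differences are bounded by 2 B / A, and the
  sum of squares has \<open>L1\<close> distance at most 7 B / A from 1, where B is
  \<open>pot_bound\<close>.\<close>

lemma char_martingale_bound:
  fixes t :: real
  defines "A \<equiv> norm2 M (\<lambda>\<omega>. \<Sum>k<n. D k \<omega>)"
  assumes A: "0 < A" "2 * pot_bound \<le> A"
  shows "cmod ((\<integral>\<omega>. iexp (t * (\<Sum>k<n. D k \<omega> / A)) \<partial>M) - of_real (exp (- t\<^sup>2 / 2)))
    \<le> (12 * \<bar>t\<bar> ^ 3 + 7 * (2 + 3 / 2 * t\<^sup>2 * exp (3 / 2 * t\<^sup>2))) * (pot_bound / A)"
proof -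
  define d where "d k \<omega> = D k \<omega> / A" for k \<omega>
  define e where "e = (\<integral>\<omega>. \<bar>(\<Sum>k<n. (d k \<omega>)\<^sup>2) - 1\<bar> \<partial>M)"
  have A2: "A\<^sup>2 = (\<Sum>k<n. mean_sq k)"
    unfolding A_def mean_sq_def by (rule norm2_sum_mdiff)
  have "cmod ((\<integral>\<omega>. iexp (t * (\<Sum>k<n. d k \<omega>)) \<partial>M) - of_real (exp (- t\<^sup>2 / 2)))
    \<le> 6 * \<bar>t\<bar> ^ 3 * (2 * pot_bound / A) + (2 + 3 / 2 * t\<^sup>2 * exp (3 / 2 * t\<^sup>2)) * e"
    unfolding e_def
  proof (rule martingale_char_bound[where F = F])
    show "subalgebra M (F k)" "subalgebra (F (Suc k)) (F k)" for k
      by (rule sub_F F_mono)+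
    show "d k \<in> borel_measurable (F (Suc k))" for k
      using L2_measurable[OF mdiff_L2] unfolding d_def[abs_def] by measurable
    show "(\<integral>\<omega>. W \<omega> * d k \<omega> \<partial>M) = 0" if "k < n" "W \<in> L2 M (F k)" for k W
      using mdiff_orthogonal[OF that, of m] by (simp add: d_def)
    show "AE \<omega> in M. \<bar>d k \<omega>\<bar> \<le> 2 * pot_bound / A" for k
      using D_bound[of k] by eventually_elim (use A in \<open>simp add: d_def divide_right_mono\<close>)
  qed (use A pot_bound_nonneg in auto)
  moreover have "e \<le> 7 * (pot_bound / A)"
  proof -
    have s_L2: "(\<lambda>\<omega>. (\<Sum>k<n. mdiff_sq k \<omega>) - A\<^sup>2) \<in> L2 M M"
      by (intro L2_diff L2_sum subalgebra_self L2_F_M[OF mdiff_sq_L2] L2_const)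
    have "(norm2 M (\<lambda>\<omega>. (\<Sum>k<n. mdiff_sq k \<omega>) - A\<^sup>2))\<^sup>2 \<le> 40 * pot_bound\<^sup>2 * A\<^sup>2"
      unfolding A2 by (rule second_moment_sum_mdiff_sq)
    \<comment> \<open>The constant 40 is rounded up to the next perfect square.\<close>
    also have "\<dots> \<le> 49 * pot_bound\<^sup>2 * A\<^sup>2"
      by (intro mult_right_mono) auto
    also have "\<dots> = (7 * (pot_bound * A))\<^sup>2"
      by (simp add: power_mult_distrib)
    finally have nrm: "norm2 M (\<lambda>\<omega>. (\<Sum>k<n. mdiff_sq k \<omega>) - A\<^sup>2) \<le> 7 * (pot_bound * A)"
      by (rule power2_le_imp_le) (use A pot_bound_nonneg in simp)
    have "(\<Sum>k<n. (d k \<omega>)\<^sup>2) - 1 = ((\<Sum>k<n. mdiff_sq k \<omega>) - A\<^sup>2) / A\<^sup>2" for \<omega>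
      using A by (simp add: d_def mdiff_sq_def power_divide sum_divide_distrib diff_divide_distrib)
    then have "e = (\<integral>\<omega>. \<bar>(\<Sum>k<n. mdiff_sq k \<omega>) - A\<^sup>2\<bar> \<partial>M) / A\<^sup>2"
      by (simp add: e_def)
    also have "\<dots> \<le> 7 * (pot_bound * A) / A\<^sup>2"
      using expectation_abs_le_norm2[OF s_L2] nrm by (intro divide_right_mono) auto
    also have "\<dots> = 7 * (pot_bound / A)"
      using A by (simp add: power2_eq_square)
    finally show ?thesis .
  qed
  then have "(2 + 3 / 2 * t\<^sup>2 * exp (3 / 2 * t\<^sup>2)) * e \<le> (2 + 3 / 2 * t\<^sup>2 * exp (3 / 2 * t\<^sup>2)) * (7 * (pot_bound / A))"
    by (intro mult_left_mono) auto
  ultimately show ?thesis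
    unfolding d_def by (simp add: algebra_simps)
qed

end

section \<open>Markov chains\<close>

context prob_space
begin

text \<open>The Markov property for events of \<open>H\<close> says that \<open>F\<close> and \<open>H\<close> are conditionally
  independent given \<open>G\<close>; as this is symmetric in \<open>F\<close> and \<open>H\<close>, it passes from events to functions
  without approximation.\<close>
lemma real_cond_exp_markov_extend:
  assumes F: "subalgebra M F" and G: "subalgebra F G" and H: "subalgebra M H"
    and markov: "\<And>A. A \<in> sets H \<Longrightarrow>
      AE \<omega> in M. real_cond_exp M F (indicator A) \<omega> = real_cond_exp M G (indicator A) \<omega>"
    and Y: "Y \<in> L2 M H" and W: "W \<in> L2 M F"
  shows "(\<integral>\<omega>. W \<omega> * Y \<omega> \<partial>M) = (\<integral>\<omega>. W \<omega> * real_cond_exp M G Y \<omega> \<partial>M)"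
proof -
  have GM: "subalgebra M G"
    using F G by (auto simp: subalgebra_def)
  interpret F: sigma_finite_subalgebra M F
    by (rule sigma_finite_subalgebra_of[OF F])
  interpret G: sigma_finite_subalgebra M G
    by (rule sigma_finite_subalgebra_of[OF GM])
  interpret H: sigma_finite_subalgebra M H
    by (rule sigma_finite_subalgebra_of[OF H])
  have YM: "Y \<in> L2 M M"
    using L2_subalgebra[OF H Y] .
  have WM: "W \<in> L2 M M"
    using L2_subalgebra[OF F W] .
  have Y_int: "integrable M Y"
    by (rule L2_integrable[OF YM])
  have [measurable]: "Y \<in> borel_measurable M" "W \<in> borel_measurable M" "Y \<in> borel_measurable H"
    "W \<in> borel_measurable F"
    using YM WM Y W by (auto simp: L2_def)
  have ind_L2: "indicator A \<in> L2 M M" if "A \<in> sets M" for A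
    using that by (intro L2_AE_bounded[where c = 1] subalgebra_self) (auto simp: indicator_def)
  have cond_L2: "real_cond_exp M K h \<in> L2 M M" if "subalgebra M K" "h \<in> L2 M M" for K h
    using L2_subalgebra[OF that(1) real_cond_exp_L2[OF that]] .
  have main: "(\<integral>\<omega>. indicat_real C \<omega> * Y \<omega> \<partial>M) = (\<integral>\<omega>. indicat_real C \<omega> * real_cond_exp M G Y \<omega> \<partial>M)"
    if C: "C \<in> sets F" for C
  proof -
    have CM: "C \<in> sets M"
      using C F by (auto simp: subalgebra_def)
    define g where "g = real_cond_exp M G (indicator C)"
    have g_L2: "g \<in> L2 M M"
      unfolding g_def by (rule cond_L2[OF GM ind_L2[OF CM]])
    have g_int: "integrable M g"
      by (rule L2_integrable[OF g_L2])
    have g_G [measurable]: "g \<in> borel_measurable G"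
      by (simp add: g_def)
    have [measurable]: "g \<in> borel_measurable M"
      using g_L2 by (simp add: L2_def)
    \<comment> \<open>The given Markov property for \<open>A\<close> is read against
      \<open>C\<close>; self-adjointness of conditioning on \<open>G\<close> then moves it from the
      indicator of \<open>A\<close> to that of \<open>C\<close>.\<close>
    have sets: "(\<integral>\<omega>. indicat_real A \<omega> * indicat_real C \<omega> \<partial>M) = (\<integral>\<omega>. indicat_real A \<omega> * g \<omega> \<partial>M)"
      if A: "A \<in> sets H" for A
    proof -
      have AM: "A \<in> sets M"
        using A H by (auto simp: subalgebra_def)
      have "(\<integral>\<omega>. indicat_real A \<omega> * indicat_real C \<omega> \<partial>M) = (\<integral>\<omega>. indicat_real C \<omega> * indicat_real A \<omega> \<partial>M)"
        by (simp add: mult.commute)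
      also have "\<dots> = (\<integral>\<omega>. indicat_real C \<omega> * real_cond_exp M F (indicator A) \<omega> \<partial>M)"
        using C AM by (intro F.real_cond_exp_intg(2)[symmetric] L2_product_integrable ind_L2 CM) auto
      also have "\<dots> = (\<integral>\<omega>. indicat_real C \<omega> * real_cond_exp M G (indicator A) \<omega> \<partial>M)"
        using markov[OF A] CM by (intro integral_cong_AE) (auto elim!: eventually_mono)
      also have "\<dots> = (\<integral>\<omega>. real_cond_exp M G (indicator A) \<omega> * indicat_real C \<omega> \<partial>M)"
        by (simp add: mult.commute)
      also have "\<dots> = (\<integral>\<omega>. real_cond_exp M G (indicator A) \<omega> * g \<omega> \<partial>M)"
        unfolding g_def using CM AM
        by (intro G.real_cond_exp_intg(2)[symmetric] L2_product_integrable ind_L2 cond_L2 GM) auto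
      also have "\<dots> = (\<integral>\<omega>. g \<omega> * real_cond_exp M G (indicator A) \<omega> \<partial>M)"
        by (simp add: mult.commute)
      also have "\<dots> = (\<integral>\<omega>. g \<omega> * indicat_real A \<omega> \<partial>M)"
        using AM by (intro G.real_cond_exp_intg(2) L2_product_integrable g_L2 ind_L2) auto
      finally show ?thesis
        by (simp add: mult.commute)
    qed
    \<comment> \<open>The same identity with the roles exchanged: as \<open>A\<close> runs through
      \<open>H\<close>, it says that the indicator of \<open>C\<close> and \<open>g\<close> have
      equal conditional expectations given \<open>H\<close>. Any \<open>H\<close>-measurable
      \<open>Y\<close> may then be paired with either.\<close>
    have "AE \<omega> in M. real_cond_exp M H (indicator C) \<omega> = real_cond_exp M H g \<omega>"
    proof (rule H.real_cond_exp_charact)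
      fix A assume A: "A \<in> sets H"
      show "(\<integral>\<omega>\<in>A. indicat_real C \<omega> \<partial>M) = (\<integral>\<omega>\<in>A. real_cond_exp M H g \<omega> \<partial>M)"
        using sets[OF A] H.real_cond_exp_intA[OF g_int A] by (simp add: set_lebesgue_integral_def)
    qed (use L2_integrable[OF ind_L2[OF CM]] g_int H.real_cond_exp_int in auto)
    then have eq: "(\<integral>\<omega>. Y \<omega> * real_cond_exp M H (indicator C) \<omega> \<partial>M) = (\<integral>\<omega>. Y \<omega> * real_cond_exp M H g \<omega> \<partial>M)"
      by (intro integral_cong_AE) (auto elim!: eventually_mono)
    have "(\<integral>\<omega>. indicat_real C \<omega> * Y \<omega> \<partial>M) = (\<integral>\<omega>. Y \<omega> * indicat_real C \<omega> \<partial>M)"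
      by (simp add: mult.commute)
    also have "\<dots> = (\<integral>\<omega>. Y \<omega> * real_cond_exp M H (indicator C) \<omega> \<partial>M)"
      using CM by (intro H.real_cond_exp_intg(2)[symmetric] L2_product_integrable YM ind_L2) auto
    also note eq
    also have "(\<integral>\<omega>. Y \<omega> * real_cond_exp M H g \<omega> \<partial>M) = (\<integral>\<omega>. Y \<omega> * g \<omega> \<partial>M)"
      by (intro H.real_cond_exp_intg(2) L2_product_integrable YM g_L2) auto
    also have "\<dots> = (\<integral>\<omega>. g \<omega> * Y \<omega> \<partial>M)"
      by (simp add: mult.commute)
    also have "\<dots> = (\<integral>\<omega>. g \<omega> * real_cond_exp M G Y \<omega> \<partial>M)"
      by (intro G.real_cond_exp_intg(2)[symmetric] L2_product_integrable YM g_L2) auto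
    also have "\<dots> = (\<integral>\<omega>. real_cond_exp M G Y \<omega> * g \<omega> \<partial>M)"
      by (simp add: mult.commute)
    also have "\<dots> = (\<integral>\<omega>. real_cond_exp M G Y \<omega> * indicat_real C \<omega> \<partial>M)"
      unfolding g_def using CM
      by (intro G.real_cond_exp_intg(2) L2_product_integrable ind_L2 cond_L2 GM YM) auto
    finally show ?thesis
      by (simp add: mult.commute)
  qed
  have "AE \<omega> in M. real_cond_exp M F Y \<omega> = real_cond_exp M G Y \<omega>"
  proof (rule F.real_cond_exp_charact)
    show "(\<integral>\<omega>\<in>C. Y \<omega> \<partial>M) = (\<integral>\<omega>\<in>C. real_cond_exp M G Y \<omega> \<partial>M)" if "C \<in> sets F" for C
      using main[OF that] by (simp add: set_lebesgue_integral_def)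
    show "real_cond_exp M G Y \<in> borel_measurable F"
      by (rule measurable_from_subalg[OF G borel_measurable_cond_exp])
  qed (use Y_int G.real_cond_exp_int in auto)
  then have "(\<integral>\<omega>. W \<omega> * real_cond_exp M F Y \<omega> \<partial>M) = (\<integral>\<omega>. W \<omega> * real_cond_exp M G Y \<omega> \<partial>M)"
    by (intro integral_cong_AE) (auto elim!: eventually_mono)
  moreover have "(\<integral>\<omega>. W \<omega> * real_cond_exp M F Y \<omega> \<partial>M) = (\<integral>\<omega>. W \<omega> * Y \<omega> \<partial>M)"
    by (intro F.real_cond_exp_intg(2) L2_product_integrable WM YM) auto
  ultimately show ?thesis
    by simp
qed

end

section \<open>Sigma-algebras generated by the chain\<close>

lemma space_gen_alg [simp]: "space (gen_alg M S \<xi> I) = space M"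
  by (simp add: gen_alg_def space_measure_of_conv)

lemma sets_gen_alg:
  "sets (gen_alg M S \<xi> I) = sigma_sets (space M) (\<Union>i\<in>I. {\<xi> i -` A \<inter> space M | A. A \<in> sets S})"
  unfolding gen_alg_def by (rule sets_measure_of) auto

lemma subalgebra_gen_alg:
  assumes "\<And>i. i \<in> I \<Longrightarrow> \<xi> i \<in> measurable M S"
  shows "subalgebra M (gen_alg M S \<xi> I)"
proof -
  have "sigma_sets (space M) (\<Union>i\<in>I. {\<xi> i -` A \<inter> space M | A. A \<in> sets S}) \<subseteq> sets M"
    using assms by (intro sets.sigma_sets_subset) (auto intro: measurable_sets)
  then show ?thesis
    by (simp add: subalgebra_def sets_gen_alg)
qed

lemma subalgebra_gen_alg_mono:
  assumes "I \<subseteq> J"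
  shows "subalgebra (gen_alg M S \<xi> J) (gen_alg M S \<xi> I)"
  unfolding subalgebra_def sets_gen_alg using assms by (auto intro!: sigma_sets_mono')

lemma measurable_gen_alg:
  assumes "i \<in> I" "\<xi> i \<in> measurable M S"
  shows "\<xi> i \<in> measurable (gen_alg M S \<xi> I) S"
proof (rule measurableI)
  show "\<xi> i -` A \<inter> space (gen_alg M S \<xi> I) \<in> sets (gen_alg M S \<xi> I)" if "A \<in> sets S" for A
    using that assms(1) by (auto simp: sets_gen_alg intro!: sigma_sets.Basic)
  show "\<xi> i x \<in> space S" if "x \<in> space (gen_alg M S \<xi> I)" for x
    using measurable_space[OF assms(2)] that by simp
qed

text \<open>Preimages under a single map already form a sigma-algebra. Hence the Markov property,
  assumed for preimages, covers every event of the next state.\<close>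

lemma sets_gen_alg_singleton:
  assumes "\<xi> i \<in> measurable M S" "A \<in> sets (gen_alg M S \<xi> {i})"
  obtains A' where "A' \<in> sets S" "A = \<xi> i -` A' \<inter> space M"
proof -
  have "A \<in> sigma_sets (space M) {\<xi> i -` A' \<inter> space M | A'. A' \<in> sets S}"
    using assms(2) by (simp add: sets_gen_alg)
  then have "\<exists>A'\<in>sets S. A = \<xi> i -` A' \<inter> space M"
  proof induction
    case Empty
    then show ?case by (intro bexI[of _ "{}"]) auto
  next
    case (Compl B)
    then obtain A' where "A' \<in> sets S" "B = \<xi> i -` A' \<inter> space M"
      by auto
    then show ?case
      using measurable_space[OF assms(1)] by (intro bexI[of _ "space S - A'"]) auto
  next
    case (Union B)
    then obtain A' where "\<And>k. A' k \<in> sets S" "\<And>k. B k = \<xi> i -` A' k \<inter> space M"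
      by metis
    then show ?case
      by (intro bexI[of _ "\<Union>k. A' k"]) auto
  qed auto
  then show ?thesis
    using that by blast
qed

lemma measurable_gen_alg_empty_const:
  assumes "W \<in> borel_measurable (gen_alg M S \<xi> {})"
  obtains w :: real where "\<And>\<omega>. \<omega> \<in> space M \<Longrightarrow> W \<omega> = w"
proof (cases "space M = {}")
  case False
  then obtain x where x: "x \<in> space M"
    by auto
  have "W -` {W x} \<inter> space M \<in> sigma_sets (space M) {}"
    using measurable_sets[OF assms, of "{W x}"] by (simp add: sets_gen_alg)
  then have "W -` {W x} \<inter> space M \<in> {{}, space M}"
    by (simp add: sigma_sets_empty_eq)
  then have "W -` {W x} \<inter> space M = space M"
    using x by auto
  then show ?thesis
    using that[of "W x"] by blast
qed (use that in auto)

section \<open>From maximal correlations to \<open>L2\<close> contraction\<close>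

context prob_space
begin

lemma norm2_centred_le:
  assumes "f \<in> L2 M M"
  shows "norm2 M (\<lambda>\<omega>. f \<omega> - (\<integral>x. f x \<partial>M)) \<le> norm2 M f"
proof (rule power2_le_imp_le)
  show "(norm2 M (\<lambda>\<omega>. f \<omega> - (\<integral>x. f x \<partial>M)))\<^sup>2 \<le> (norm2 M f)\<^sup>2"
    unfolding norm2_power2 using variance_eq[OF L2_integrable[OF assms] L2_square_integrable[OF assms]] by simp
qed simp

lemma abs_cov_le_norm2:
  assumes "f \<in> L2 M M" "g \<in> L2 M M"
  shows "\<bar>cov M f g\<bar> \<le> norm2 M (\<lambda>\<omega>. f \<omega> - (\<integral>x. f x \<partial>M)) * norm2 M (\<lambda>\<omega>. g \<omega> - (\<integral>x. g x \<partial>M))"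
  unfolding cov_def by (intro Cauchy_Schwarz_norm2 L2_diff subalgebra_self assms L2_const)

lemma corr_eq:
  "corr M f g = cov M f g / (norm2 M (\<lambda>\<omega>. f \<omega> - (\<integral>x. f x \<partial>M)) * norm2 M (\<lambda>\<omega>. g \<omega> - (\<integral>x. g x \<partial>M)))"
  by (simp add: corr_def norm2_def)

lemma abs_corr_le_1:
  assumes "f \<in> L2 M M" "g \<in> L2 M M"
  shows "\<bar>corr M f g\<bar> \<le> 1"
  using abs_cov_le_norm2[OF assms] unfolding corr_eq abs_divide
  by (intro divide_le_eq_1[THEN iffD2]) (auto simp: abs_mult zero_less_mult_iff less_le)

lemma abs_corr_le_max_corr:
  assumes "subalgebra M A" "subalgebra M B" "f \<in> L2 M A" "g \<in> L2 M B"
  shows "\<bar>corr M f g\<bar> \<le> max_corr M A B"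
  unfolding max_corr_def
proof (rule cSup_upper)
  show "bdd_above {\<bar>corr M f g\<bar> | f g. f \<in> L2 M A \<and> g \<in> L2 M B}"
    using abs_corr_le_1 L2_subalgebra[OF assms(1)] L2_subalgebra[OF assms(2)]
    by (intro bdd_aboveI[of _ 1]) blast
qed (use assms in auto)

lemma max_corr_nonneg:
  assumes "subalgebra M A" "subalgebra M B"
  shows "0 \<le> max_corr M A B"
  using abs_corr_le_max_corr[OF assms L2_zero L2_zero] by linarith

text \<open>Centring one factor suffices to turn the integral into a covariance; replacing the norms
  of the centred variables by the full norms only increases the bound.\<close>

lemma expectation_mult_le_max_corr:
  assumes "subalgebra M A" "subalgebra M B" "f \<in> L2 M A" "g \<in> L2 M B" "(\<integral>\<omega>. g \<omega> \<partial>M) = 0"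
  shows "\<bar>\<integral>\<omega>. f \<omega> * g \<omega> \<partial>M\<bar> \<le> max_corr M A B * norm2 M f * norm2 M g"
proof -
  let ?f = "\<lambda>\<omega>. f \<omega> - (\<integral>x. f x \<partial>M)" and ?g = "\<lambda>\<omega>. g \<omega> - (\<integral>x. g x \<partial>M)"
  have f: "f \<in> L2 M M" and g: "g \<in> L2 M M"
    using assms L2_subalgebra by blast+
  have "(\<integral>\<omega>. f \<omega> * g \<omega> \<partial>M) = cov M f g"
    using L2_product_integrable[OF f g] L2_integrable[OF g] assms(5)
    by (simp add: cov_def left_diff_distrib)
  also have "\<bar>\<dots>\<bar> \<le> max_corr M A B * (norm2 M ?f * norm2 M ?g)"
  \<comment> \<open>Here the correlation is 0 by convention and carries no information;
    Cauchy-Schwarz shows that the covariance vanishes.\<close>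
  proof (cases "norm2 M ?f * norm2 M ?g = 0")
    case True
    then show ?thesis
      using abs_cov_le_norm2[OF f g] unfolding True by simp
  next
    case False
    then have pos: "0 < norm2 M ?f * norm2 M ?g"
      by (simp add: less_le)
    have "\<bar>cov M f g\<bar> / (norm2 M ?f * norm2 M ?g) \<le> max_corr M A B"
      using abs_corr_le_max_corr[OF assms(1-4)] unfolding corr_eq abs_divide abs_mult by simp
    then show ?thesis
      unfolding pos_divide_le_eq[OF pos] .
  qed
  also have "\<dots> \<le> max_corr M A B * (norm2 M f * norm2 M g)"
    using max_corr_nonneg[OF assms(1,2)] norm2_centred_le[OF f] norm2_centred_le[OF g]
    by (intro mult_left_mono mult_mono) auto
  finally show ?thesis
    by (simp add: mult.assoc)
qed

lemma max_corr_le_rho1: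
  assumes "1 \<le> s" "s < n"
  shows "max_corr M (gen_alg M S \<xi> {s}) (gen_alg M S \<xi> {Suc s}) \<le> rho1 M S n \<xi>"
  using assms unfolding rho1_def by (auto intro!: Max_ge imageI)

lemma rho1_nonneg:
  assumes "markov_chain M S n \<xi>"
  shows "0 \<le> rho1 M S n \<xi>"
proof (cases "n \<le> 1")
  case False
  have "0 \<le> max_corr M (gen_alg M S \<xi> {1}) (gen_alg M S \<xi> {Suc 1})"
    using assms False by (intro max_corr_nonneg subalgebra_gen_alg) (auto simp: markov_chain_def)
  also have "\<dots> \<le> rho1 M S n \<xi>"
    using False by (intro max_corr_le_rho1) auto
  finally show ?thesis .
qed (simp add: rho1_def)

text \<open>The index sets are intersected with 1..n because measurability of the chain is known
  only there; outside, \<open>G k\<close> becomes trivial and \<open>F k\<close> stays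
  constant.\<close>

lemma markov_chain_corr_filtration:
  assumes mc: "markov_chain M S n \<xi>" and rho: "rho1 M S n \<xi> < 1"
  shows "corr_filtration M (\<lambda>k. gen_alg M S \<xi> {1..min k n}) (\<lambda>k. gen_alg M S \<xi> ({k} \<inter> {1..n}))
    (rho1 M S n \<xi>) n"
proof
  let ?F = "\<lambda>k. gen_alg M S \<xi> {1..min k n}" and ?G = "\<lambda>k. gen_alg M S \<xi> ({k} \<inter> {1..n})"
  have \<xi>: "\<xi> i \<in> measurable M S" if "1 \<le> i" "i \<le> n" for i
    using mc that by (auto simp: markov_chain_def)
  show sub_F: "subalgebra M (?F k)" for k
    by (intro subalgebra_gen_alg \<xi>) auto
  show "subalgebra (?F (Suc k)) (?F k)" for k
    by (intro subalgebra_gen_alg_mono) auto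
  show sub_G: "subalgebra (?F k) (?G k)" for k
    by (intro subalgebra_gen_alg_mono) auto
  show "0 \<le> rho1 M S n \<xi>"
    by (rule rho1_nonneg[OF mc])
  show "rho1 M S n \<xi> < 1"
    by (rule rho)
  show "(\<integral>\<omega>. W \<omega> * Y \<omega> \<partial>M) = 0"
    if W: "W \<in> L2 M (?F 0)" and "Y \<in> L2 M M" and Y: "(\<integral>\<omega>. Y \<omega> \<partial>M) = 0" for W Y
  proof -
    have "W \<in> borel_measurable (gen_alg M S \<xi> {})"
      using L2_measurable[OF W] by simp
    then obtain w where w: "\<And>\<omega>. \<omega> \<in> space M \<Longrightarrow> W \<omega> = w"
      using measurable_gen_alg_empty_const by blast
    have "(\<integral>\<omega>. W \<omega> * Y \<omega> \<partial>M) = (\<integral>\<omega>. w * Y \<omega> \<partial>M)"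
      by (intro Bochner_Integration.integral_cong) (auto simp: w)
    then show ?thesis
      by (simp add: Y)
  qed
  show "(\<integral>\<omega>. W \<omega> * Y \<omega> \<partial>M) = (\<integral>\<omega>. W \<omega> * real_cond_exp M (?G k) Y \<omega> \<partial>M)"
    if k: "1 \<le> k" "k < n" and Y: "Y \<in> L2 M (?G (Suc k))" and W: "W \<in> L2 M (?F k)" for k Y W
  proof (rule real_cond_exp_markov_extend[OF sub_F sub_G _ _ Y W])
    have G: "?G k = gen_alg M S \<xi> {k}" "?G (Suc k) = gen_alg M S \<xi> {Suc k}" "?F k = gen_alg M S \<xi> {1..k}"
      using k by (auto intro!: arg_cong[where f = "gen_alg M S \<xi>"])
    show "subalgebra M (?G (Suc k))"
      by (intro subalgebra_gen_alg \<xi>) auto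
    show "AE \<omega> in M. real_cond_exp M (?F k) (indicator A) \<omega> = real_cond_exp M (?G k) (indicator A) \<omega>"
      if A: "A \<in> sets (?G (Suc k))" for A
    proof -
      have "\<xi> (Suc k) \<in> measurable M S"
        using k by (intro \<xi>) auto
      then obtain A' where "A' \<in> sets S" "A = \<xi> (Suc k) -` A' \<inter> space M"
        using A unfolding G by (rule sets_gen_alg_singleton)
      then show ?thesis
        using mc k unfolding G markov_chain_def by auto
    qed
  qed
  show "\<bar>\<integral>\<omega>. U \<omega> * Y \<omega> \<partial>M\<bar> \<le> rho1 M S n \<xi> * norm2 M U * norm2 M Y"
    if k: "1 \<le> k" "k < n" and U: "U \<in> L2 M (?G k)" and Y: "Y \<in> L2 M (?G (Suc k))"
      and mean: "(\<integral>\<omega>. Y \<omega> \<partial>M) = 0" for k U Y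
  proof -
    have G: "?G k = gen_alg M S \<xi> {k}" "?G (Suc k) = gen_alg M S \<xi> {Suc k}"
      using k by (auto intro!: arg_cong[where f = "gen_alg M S \<xi>"])
    have "\<bar>\<integral>\<omega>. U \<omega> * Y \<omega> \<partial>M\<bar> \<le>
        max_corr M (gen_alg M S \<xi> {k}) (gen_alg M S \<xi> {Suc k}) * norm2 M U * norm2 M Y"
      using U Y mean k unfolding G by (intro expectation_mult_le_max_corr subalgebra_gen_alg \<xi>) auto
    also have "\<dots> \<le> rho1 M S n \<xi> * norm2 M U * norm2 M Y"
      using max_corr_le_rho1[OF k] by (intro mult_right_mono) auto
    finally show ?thesis .
  qed
qed

end

section \<open>Truncation\<close>

lemma cmod_iexp_diff_le: "cmod (iexp x - iexp y) \<le> \<bar>x - y\<bar>"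
proof -
  have "iexp x - iexp y = iexp y * (iexp (x - y) - 1)"
    by (simp add: algebra_simps exp_add[symmetric])
  then have "cmod (iexp x - iexp y) = cmod (iexp (x - y) - 1)"
    by (simp only: norm_mult norm_exp_i_times mult_1)
  also have "\<dots> \<le> \<bar>x - y\<bar>"
    using iexp_approx1[of "x - y" 0] by simp
  finally show ?thesis .
qed

lemma (in prob_space) cmod_expectation_iexp_diff_le:
  assumes "f \<in> L2 M M" "g \<in> L2 M M"
  shows "cmod ((\<integral>\<omega>. iexp (t * f \<omega>) \<partial>M) - (\<integral>\<omega>. iexp (t * g \<omega>) \<partial>M)) \<le> \<bar>t\<bar> * norm2 M (\<lambda>\<omega>. f \<omega> - g \<omega>)"
proof -
  have [measurable]: "f \<in> borel_measurable M" "g \<in> borel_measurable M"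
    using assms by (auto simp: L2_def)
  have int: "integrable M (\<lambda>\<omega>. iexp (t * h \<omega>))" if [measurable]: "h \<in> borel_measurable M" for h
    by (rule integrable_const_bound[where B = 1]) simp_all
  have d: "(\<lambda>\<omega>. f \<omega> - g \<omega>) \<in> L2 M M"
    by (rule L2_diff[OF subalgebra_self assms])
  have "(\<integral>\<omega>. iexp (t * f \<omega>) \<partial>M) - (\<integral>\<omega>. iexp (t * g \<omega>) \<partial>M) = (\<integral>\<omega>. iexp (t * f \<omega>) - iexp (t * g \<omega>) \<partial>M)"
    by (intro Bochner_Integration.integral_diff[symmetric] int) simp_all
  also have "cmod \<dots> \<le> (\<integral>\<omega>. cmod (iexp (t * f \<omega>) - iexp (t * g \<omega>)) \<partial>M)"
    by (rule integral_norm_bound)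
  also have "\<dots> \<le> (\<integral>\<omega>. \<bar>t\<bar> * \<bar>f \<omega> - g \<omega>\<bar> \<partial>M)"
  proof (rule integral_mono)
    show "integrable M (\<lambda>\<omega>. cmod (iexp (t * f \<omega>) - iexp (t * g \<omega>)))"
      by (intro integrable_norm Bochner_Integration.integrable_diff int) simp_all
    show "integrable M (\<lambda>\<omega>. \<bar>t\<bar> * \<bar>f \<omega> - g \<omega>\<bar>)"
      using L2_integrable[OF d] by simp
    show "cmod (iexp (t * f \<omega>) - iexp (t * g \<omega>)) \<le> \<bar>t\<bar> * \<bar>f \<omega> - g \<omega>\<bar>" for \<omega>
      using cmod_iexp_diff_le[of "t * f \<omega>" "t * g \<omega>"] by (simp only: right_diff_distrib[symmetric] abs_mult)
  qed
  also have "\<dots> \<le> \<bar>t\<bar> * norm2 M (\<lambda>\<omega>. f \<omega> - g \<omega>)"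
    using expectation_abs_le_norm2[OF d] by (simp add: mult_left_mono)
  finally show ?thesis .
qed

text \<open>The first term comes from comparing the normalised sum with the normalised martingale,
  the second from the martingale bound at B / A <= 2 delta.\<close>

definition char_const :: "real \<Rightarrow> real" where
  "char_const t = 4 * \<bar>t\<bar> + 2 * (12 * \<bar>t\<bar> ^ 3 + 7 * (2 + 3 / 2 * t\<^sup>2 * exp (3 / 2 * t\<^sup>2)))"

lemma char_const_nonneg: "0 \<le> char_const t"
  by (simp add: char_const_def)

lemma (in centred_array) char_sum_bound:
  fixes c \<delta> t :: real and m :: nat
  defines "S \<equiv> \<lambda>\<omega>. \<Sum>k\<le>n. X k \<omega>"
  defines "s \<equiv> norm2 M S"
  assumes s: "0 < s" and c: "0 \<le> c" and \<delta>: "0 < \<delta>" "\<delta> \<le> 1 / 4"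
    and tail: "2 / (1 - r) * (\<Sum>k\<le>n. \<integral>\<omega>. (X k \<omega>)\<^sup>2 * indicator {\<omega>. c < \<bar>X k \<omega>\<bar>} \<omega> \<partial>M) \<le> (\<delta> * s)\<^sup>2"
    and r_pow: "r ^ m \<le> (1 - r) * \<delta> / 3"
    and mc: "real (Suc m) * (2 * c) \<le> \<delta> * s"
  shows "cmod ((\<integral>\<omega>. iexp (t * (S \<omega> / s)) \<partial>M) - of_real (exp (- t\<^sup>2 / 2))) \<le> char_const t * \<delta>"
proof -
  define Z where "Z k \<omega> = (if \<bar>X k \<omega>\<bar> \<le> c then X k \<omega> else 0)" for k \<omega>
  \<comment> \<open>Truncation destroys the zero mean; recentring restores it and doubles the sup
    bound, so the array is bounded by \<open>2 * c\<close>.\<close>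
  define T where "T k \<omega> = Z k \<omega> - (\<integral>x. Z k x \<partial>M)" for k \<omega>
  define U where "U k \<omega> = X k \<omega> - Z k \<omega>" for k \<omega>
  have X_G [measurable]: "X k \<in> borel_measurable (G k)" for k
    using X_L2 by (simp add: L2_def)
  have Z_meas: "Z k \<in> borel_measurable (G k)" for k
    unfolding Z_def[abs_def] by measurable
  have Z_le: "\<bar>Z k \<omega>\<bar> \<le> c" for k \<omega>
    using c by (simp add: Z_def)
  have Z_L2: "Z k \<in> L2 M (G k)" for k
    using Z_le by (intro L2_AE_bounded[OF sub_GM Z_meas, of _ c]) simp
  have U_L2: "U k \<in> L2 M (G k)" for k
    unfolding U_def[abs_def] by (intro L2_diff sub_GM X_L2 Z_L2)
  have T_L2: "T k \<in> L2 M (G k)" for k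
    unfolding T_def[abs_def] by (intro L2_diff sub_GM Z_L2 L2_const)
  have EZ: "\<bar>\<integral>x. Z k x \<partial>M\<bar> \<le> c" for k
  proof -
    have "\<bar>\<integral>x. Z k x \<partial>M\<bar> \<le> (\<integral>x. \<bar>Z k x\<bar> \<partial>M)"
      using integral_norm_bound[of M "Z k"] by simp
    also have "\<dots> \<le> (\<integral>x. c \<partial>M)"
      using L2_integrable[OF L2_G_M[OF Z_L2]] Z_le by (intro integral_mono) auto
    finally show ?thesis
      by (simp add: prob_space)
  qed
  have T_le: "\<bar>T k \<omega>\<bar> \<le> 2 * c" for k \<omega>
    using Z_le[of k \<omega>] EZ[of k] unfolding T_def by linarith
  have T_mean: "(\<integral>\<omega>. T k \<omega> \<partial>M) = 0" for k
    using L2_integrable[OF L2_G_M[OF Z_L2]] by (simp add: T_def prob_space)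
  have T_outside: "T k = (\<lambda>\<omega>. 0)" if "k = 0 \<or> n < k" for k
    using X_outside[OF that] by (auto simp: T_def Z_def fun_eq_iff)
  have "(1 - r) * (\<delta> / 3) \<le> (1 - r) * 1"
    using r \<delta> by (intro mult_left_mono) auto
  then have r_pow1: "r ^ m \<le> 1 - r"
    using r_pow by simp
  interpret T: bounded_array M F G r n T "2 * c" m
    using T_L2 T_mean T_outside T_le c r_pow1 by unfold_locales auto
  define ST where "ST \<omega> = (\<Sum>k\<le>n. T k \<omega>)" for \<omega>
  define D where "D \<omega> = (\<Sum>k<n. T.mdiff m k \<omega>)" for \<omega>
  define R where "R = T.remainder m"
  have S_L2: "S \<in> L2 M M"
    unfolding S_def by (intro L2_sum subalgebra_self L2_G_M[OF X_L2])
  have D_L2: "D \<in> L2 M M"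
    unfolding D_def[abs_def] by (intro L2_sum subalgebra_self L2_F_M[OF T.mdiff_L2])
  have R_L2: "R \<in> L2 M M"
    unfolding R_def by (rule T.remainder_L2)
  \<comment> \<open>Since \<open>X\<close> is centred, the error of truncating and recentring is the
    centred discarded part, whose norm is at most that of the discarded part itself.\<close>
  have XT: "X k \<omega> - T k \<omega> = U k \<omega> - (\<integral>x. U k x \<partial>M)" for k \<omega>
    using L2_integrable[OF L2_G_M[OF X_L2]] L2_integrable[OF L2_G_M[OF Z_L2]] X_mean[of k]
    by (simp add: T_def U_def)
  have U_norm: "(norm2 M (U k))\<^sup>2 = (\<integral>\<omega>. (X k \<omega>)\<^sup>2 * indicator {\<omega>. c < \<bar>X k \<omega>\<bar>} \<omega> \<partial>M)" for k
    unfolding norm2_power2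
    by (intro Bochner_Integration.integral_cong) (auto simp: U_def Z_def indicator_def)
  have d1: "norm2 M (\<lambda>\<omega>. S \<omega> - ST \<omega>) \<le> \<delta> * s"
  proof (rule power2_le_imp_le)
    have "(norm2 M (\<lambda>\<omega>. S \<omega> - ST \<omega>))\<^sup>2 = (norm2 M (\<lambda>\<omega>. \<Sum>k\<le>n. X k \<omega> - T k \<omega>))\<^sup>2"
      by (simp add: S_def ST_def sum_subtractf)
    also have "\<dots> \<le> 2 / (1 - r) * (\<Sum>k\<le>n. (norm2 M (\<lambda>\<omega>. X k \<omega> - T k \<omega>))\<^sup>2)"
    proof (rule second_moment_sum_le)
      show "(\<lambda>\<omega>. X k \<omega> - T k \<omega>) \<in> L2 M (G k)" for k
        by (intro L2_diff sub_GM X_L2 T_L2)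
      show "(\<integral>\<omega>. X k \<omega> - T k \<omega> \<partial>M) = 0" for k
        using L2_integrable[OF L2_G_M[OF X_L2]] L2_integrable[OF L2_G_M[OF T_L2]]
        by (simp add: X_mean T_mean)
    qed
    also have "\<dots> \<le> 2 / (1 - r) * (\<Sum>k\<le>n. (norm2 M (U k))\<^sup>2)"
      unfolding XT using r
      by (intro mult_left_mono sum_mono power_mono norm2_centred_le L2_G_M[OF U_L2]) auto
    also have "\<dots> \<le> (\<delta> * s)\<^sup>2"
      using tail by (simp add: U_norm)
    finally show "(norm2 M (\<lambda>\<omega>. S \<omega> - ST \<omega>))\<^sup>2 \<le> (\<delta> * s)\<^sup>2" .
  qed (use s \<delta> in simp)
  have T_norm: "norm2 M (T k) \<le> norm2 M (X k)" for k
  proof -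
    have "norm2 M (T k) \<le> norm2 M (Z k)"
      unfolding T_def[abs_def] by (rule norm2_centred_le[OF L2_G_M[OF Z_L2]])
    also have "\<dots> \<le> norm2 M (X k)"
      unfolding norm2_def
      using L2_square_integrable[OF L2_G_M[OF Z_L2]] L2_square_integrable[OF L2_G_M[OF X_L2]]
      by (intro real_sqrt_le_mono integral_mono) (auto simp: Z_def)
    finally show ?thesis .
  qed
  have d2: "norm2 M R \<le> \<delta> * s"
  proof (rule power2_le_imp_le)
    have "(1 - r) * (\<Sum>k\<le>n. (norm2 M (T k))\<^sup>2) \<le> (1 - r) * (\<Sum>k\<le>n. (norm2 M (X k))\<^sup>2)"
      using r T_norm by (intro mult_left_mono sum_mono power_mono) auto
    also have "\<dots> \<le> 4 * s\<^sup>2"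
      unfolding s_def S_def by (rule second_moment_sum_ge)
    finally have sumT: "(\<Sum>k\<le>n. (norm2 M (T k))\<^sup>2) \<le> 4 * s\<^sup>2 / (1 - r)"
      using r by (simp add: le_divide_eq mult.commute)
    have "r ^ Suc m \<le> r ^ m"
      using r by (intro power_decreasing) auto
    then have rp: "(r ^ Suc m)\<^sup>2 \<le> ((1 - r) * \<delta> / 3)\<^sup>2"
      using r r_pow by (intro power_mono) auto
    have "(norm2 M R)\<^sup>2 \<le> 2 / (1 - r) * ((r ^ Suc m)\<^sup>2 * (\<Sum>k\<le>n. (norm2 M (T k))\<^sup>2))"
      unfolding R_def by (rule T.norm2_remainder)
    \<comment> \<open>The divisor 3 in the hypothesis on r^m is chosen so that the resulting
      constant 2 * 4 / 9 is below 1.\<close>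
    also have "\<dots> \<le> 2 / (1 - r) * (((1 - r) * \<delta> / 3)\<^sup>2 * (4 * s\<^sup>2 / (1 - r)))"
      using r by (intro mult_left_mono mult_mono rp sumT sum_nonneg) auto
    also have "\<dots> = 8 / 9 * (\<delta> * s)\<^sup>2"
    proof -
      have "2 / w * ((w * \<delta> / 3)\<^sup>2 * (4 * s\<^sup>2 / w)) = 8 / 9 * (\<delta> * s)\<^sup>2" if "w \<noteq> 0" for w :: real
        using that by (simp add: power2_eq_square field_simps)
      then show ?thesis
        using r by simp
    qed
    also have "\<dots> \<le> (\<delta> * s)\<^sup>2"
      by simp
    finally show "(norm2 M R)\<^sup>2 \<le> (\<delta> * s)\<^sup>2" .
  qed (use s \<delta> in simp)
  have ST_eq: "ST \<omega> = D \<omega> + R \<omega>" for \<omega>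
    unfolding ST_def D_def R_def by (rule T.martingale_decomposition)
  have SD_L2: "(\<lambda>\<omega>. S \<omega> - D \<omega>) \<in> L2 M M"
    by (intro L2_diff subalgebra_self S_L2 D_L2)
  have SD: "norm2 M (\<lambda>\<omega>. S \<omega> - D \<omega>) \<le> 2 * \<delta> * s"
  proof -
    have "(\<lambda>\<omega>. S \<omega> - ST \<omega>) \<in> L2 M M"
      unfolding ST_eq by (intro L2_diff L2_add subalgebra_self S_L2 D_L2 R_L2)
    from norm2_triangle[OF this R_L2]
    have "norm2 M (\<lambda>\<omega>. S \<omega> - D \<omega>) \<le> norm2 M (\<lambda>\<omega>. S \<omega> - ST \<omega>) + norm2 M R"
      by (simp add: ST_eq)
    with d1 d2 show ?thesis
      by simp
  qed
  define A where "A = norm2 M D"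
  have As: "\<bar>A - s\<bar> \<le> 2 * \<delta> * s"
    using norm2_triangle[OF SD_L2 D_L2] norm2_triangle_diff[OF S_L2 SD_L2] SD
    by (simp add: A_def s_def abs_le_iff)
  \<comment> \<open>The restriction to \<delta> \<le> 1/4 guarantees that the martingale keeps at
    least half of the standard deviation.\<close>
  have "2 * \<delta> * s \<le> 2 * (1 / 4) * s"
    using s \<delta> by (intro mult_right_mono) auto
  then have A_ge: "s / 2 \<le> A"
    using As by (simp add: abs_le_iff)
  then have A_pos: "0 < A"
    using s by simp
  have B_le: "T.pot_bound \<le> \<delta> * s"
    using mc by (simp add: T.pot_bound_def)
  have \<delta>s: "\<delta> * s \<le> (1 / 4) * s"
    using s \<delta> by (intro mult_right_mono) auto
  have BA: "T.pot_bound / A \<le> 2 * \<delta>"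
  proof -
    have "\<delta> * s \<le> 2 * \<delta> * A"
      using mult_left_mono[OF A_ge, of "2 * \<delta>"] \<delta> by simp
    then show ?thesis
      using B_le A_pos by (simp add: pos_divide_le_eq)
  qed
  have 1: "cmod ((\<integral>\<omega>. iexp (t * (D \<omega> / A)) \<partial>M) - of_real (exp (- t\<^sup>2 / 2)))
    \<le> (12 * \<bar>t\<bar> ^ 3 + 7 * (2 + 3 / 2 * t\<^sup>2 * exp (3 / 2 * t\<^sup>2))) * (2 * \<delta>)"
  proof -
    have "A = norm2 M (\<lambda>\<omega>. \<Sum>k<n. T.mdiff m k \<omega>)"
      by (simp add: A_def D_def[abs_def])
    then have "cmod ((\<integral>\<omega>. iexp (t * (\<Sum>k<n. T.mdiff m k \<omega> / A)) \<partial>M) - of_real (exp (- t\<^sup>2 / 2)))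
        \<le> (12 * \<bar>t\<bar> ^ 3 + 7 * (2 + 3 / 2 * t\<^sup>2 * exp (3 / 2 * t\<^sup>2))) * (T.pot_bound / A)"
      using T.char_martingale_bound[of t] A_pos A_ge B_le \<delta>s by simp
    also have "\<dots> \<le> (12 * \<bar>t\<bar> ^ 3 + 7 * (2 + 3 / 2 * t\<^sup>2 * exp (3 / 2 * t\<^sup>2))) * (2 * \<delta>)"
      by (intro mult_left_mono BA) simp
    finally show ?thesis
      by (simp add: D_def sum_divide_distrib)
  qed
  have "norm2 M (\<lambda>\<omega>. S \<omega> / s - D \<omega> / A) \<le> 4 * \<delta>"
  proof -
    \<comment> \<open>The two normalisations are separated: exchanging \<open>S\<close> for
      \<open>D\<close> at scale \<open>s\<close>, and exchanging \<open>s\<close> for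
      \<open>A\<close>, cost 2 delta each.\<close>
    have "norm2 M (\<lambda>\<omega>. (1 / s) * (S \<omega> - D \<omega>) + (1 / s - 1 / A) * D \<omega>) \<le>
        norm2 M (\<lambda>\<omega>. (1 / s) * (S \<omega> - D \<omega>)) + norm2 M (\<lambda>\<omega>. (1 / s - 1 / A) * D \<omega>)"
      by (intro norm2_triangle L2_cmult SD_L2 D_L2)
    also have "norm2 M (\<lambda>\<omega>. (1 / s) * (S \<omega> - D \<omega>)) \<le> 2 * \<delta>"
      unfolding norm2_cmult using SD s by (simp add: pos_divide_le_eq)
    also have "norm2 M (\<lambda>\<omega>. (1 / s - 1 / A) * D \<omega>) = \<bar>A - s\<bar> / s"
    proof -
      have "1 / s - 1 / A = (A - s) / (s * A)"
        using s A_pos by (simp add: field_simps)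
      then show ?thesis
        unfolding norm2_cmult A_def[symmetric] using s A_pos by (simp add: abs_mult)
    qed
    also have "\<dots> \<le> 2 * \<delta>"
      using As s by (simp add: pos_divide_le_eq)
    finally show ?thesis
      using s by (simp add: algebra_simps diff_divide_distrib)
  qed
  then have "\<bar>t\<bar> * norm2 M (\<lambda>\<omega>. S \<omega> / s - D \<omega> / A) \<le> \<bar>t\<bar> * (4 * \<delta>)"
    by (intro mult_left_mono) auto
  moreover have "cmod ((\<integral>\<omega>. iexp (t * (S \<omega> / s)) \<partial>M) - (\<integral>\<omega>. iexp (t * (D \<omega> / A)) \<partial>M))
      \<le> \<bar>t\<bar> * norm2 M (\<lambda>\<omega>. S \<omega> / s - D \<omega> / A)"
    using L2_cmult[OF S_L2, of "1 / s"] L2_cmult[OF D_L2, of "1 / A"]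
    by (intro cmod_expectation_iexp_diff_le) simp_all
  ultimately have 2: "cmod ((\<integral>\<omega>. iexp (t * (S \<omega> / s)) \<partial>M) - (\<integral>\<omega>. iexp (t * (D \<omega> / A)) \<partial>M)) \<le> \<bar>t\<bar> * (4 * \<delta>)"
    by linarith
  have "cmod ((\<integral>\<omega>. iexp (t * (S \<omega> / s)) \<partial>M) - of_real (exp (- t\<^sup>2 / 2))) \<le> \<bar>t\<bar> * (4 * \<delta>) +
      (12 * \<bar>t\<bar> ^ 3 + 7 * (2 + 3 / 2 * t\<^sup>2 * exp (3 / 2 * t\<^sup>2))) * (2 * \<delta>)"
    by (rule norm_diff_triangle_le[OF 2 1])
  also have "\<dots> = char_const t * \<delta>"
    unfolding char_const_def by (simp add: algebra_simps)
  finally show ?thesis .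
qed

text \<open>The logarithm in \<open>hfun\<close> pays for an \<open>m\<close> so large that \<open>r\<^sup>m\<close> is small compared
  with \<open>1 - r\<close>.\<close>
lemma obtain_truncation_length:
  fixes r \<delta> :: real
  assumes r: "0 \<le> r" "r < 1" and \<delta>: "0 < \<delta>" "\<delta> \<le> 1"
  obtains m :: nat where "r ^ m \<le> (1 - r) * \<delta> / 3" "real (Suc m) * hfun (1 - r) \<le> ln (3 / \<delta>) + 3"
proof -
  define l where "l = 1 - r"
  define L where "L = ln (3 / \<delta>)"
  \<comment> \<open>The real solution of exp(-l x) = l \<delta> / 3, which \<open>m\<close> rounds
    up.\<close>
  define x where "x = (\<bar>ln l\<bar> + L) / l"
  define m where "m = nat \<lceil>x\<rceil>"
  have l: "0 < l" "l \<le> 1"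
    using r by (auto simp: l_def)
  have L: "0 \<le> L"
    using \<delta> by (simp add: L_def)
  have x: "0 \<le> x"
    unfolding x_def using l L by (intro divide_nonneg_pos add_nonneg_nonneg) auto
  have m_ge: "x \<le> real m" and m_le: "real m \<le> x + 1"
    using x unfolding m_def by linarith+
  have "r ^ m \<le> (exp (- l)) ^ m"
    using r exp_ge_add_one_self[of "- l"] by (intro power_mono) (auto simp: l_def)
  also have "\<dots> = exp (- (l * real m))"
    by (simp add: exp_of_nat_mult[symmetric] mult.commute)
  also have "\<dots> \<le> exp (- (l * x))"
    using m_ge l by (simp add: mult_left_mono)
  also have "l * x = \<bar>ln l\<bar> + L"
    using l by (simp add: x_def)
  also have "\<bar>ln l\<bar> = - ln l"
    using l by simp
  also have "exp (- (- ln l + L)) = l * (\<delta> / 3)"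
    using l \<delta> by (simp add: L_def exp_diff)
  finally have 1: "r ^ m \<le> (1 - r) * \<delta> / 3"
    by (simp add: l_def)
  have "real (Suc m) * l \<le> (x + 2) * l"
    using m_le l by (intro mult_right_mono) auto
  also have "\<dots> = \<bar>ln l\<bar> + L + 2 * l"
    using l by (simp add: x_def field_simps)
  also have "\<dots> \<le> (L + 3) * (1 + \<bar>ln l\<bar>)"
  proof -
    have "(L + 3) * (1 + \<bar>ln l\<bar>) = L + 3 + L * \<bar>ln l\<bar> + 3 * \<bar>ln l\<bar>"
      by (simp only: distrib_left distrib_right mult_1_right)
    moreover have "0 \<le> L * \<bar>ln l\<bar>"
      using L by simp
    ultimately show ?thesis
      using l abs_ge_zero[of "ln l"] by linarith
  qed
  finally have "real (Suc m) * l / (1 + \<bar>ln l\<bar>) \<le> L + 3"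
    by (intro pos_divide_le_eq[THEN iffD2]) auto
  then have 2: "real (Suc m) * hfun (1 - r) \<le> ln (3 / \<delta>) + 3"
    by (simp add: hfun_def l_def L_def divide_inverse mult.assoc)
  show thesis
    by (rule that[OF 1 2])
qed

theorem corollary4:
  fixes M :: "'a measure" and S :: "'b measure"
    and \<xi> :: "nat \<Rightarrow> nat \<Rightarrow> 'a \<Rightarrow> 'b"
    and f :: "nat \<Rightarrow> nat \<Rightarrow> 'b \<Rightarrow> real"
    and X :: "nat \<Rightarrow> nat \<Rightarrow> 'a \<Rightarrow> real"
    and l \<sigma> b :: "nat \<Rightarrow> real"
  assumes "prob_space M"
    and "\<And>n. n \<ge> 1 \<Longrightarrow> markov_chain M S n (\<xi> n)"
    and "\<And>n i. 1 \<le> i \<Longrightarrow> i \<le> n \<Longrightarrow> f n i \<in> borel_measurable S"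
    and "\<And>n i. 1 \<le> i \<Longrightarrow> i \<le> n \<Longrightarrow> X n i = (\<lambda>\<omega>. f n i (\<xi> n i \<omega>))"
    and "\<And>n i. 1 \<le> i \<Longrightarrow> i \<le> n \<Longrightarrow> (\<integral>\<omega>. X n i \<omega> \<partial>M) = 0"
    and "\<And>n i. 1 \<le> i \<Longrightarrow> i \<le> n \<Longrightarrow> integrable M (\<lambda>\<omega>. (X n i \<omega>)\<^sup>2)"
    and "\<And>n. n \<ge> 1 \<Longrightarrow> l n = lam M S n (\<xi> n)"
    and "\<And>n. n \<ge> 1 \<Longrightarrow> \<sigma> n = sd_sum M n (X n)"
    and "\<And>n. n \<ge> 1 \<Longrightarrow> b n = b_coeff M n (X n)"
    and "\<And>n. n \<ge> 1 \<Longrightarrow> l n * b n > 0"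
    and "\<And>\<epsilon>::real. \<epsilon> > 0 \<Longrightarrow>
          (\<lambda>n. 1 / (l n * (\<sigma> n)\<^sup>2) *
             (\<Sum>i=1..n. \<integral>\<omega>. (X n i \<omega>)\<^sup>2 *
                indicator {\<omega>. \<bar>X n i \<omega>\<bar> > \<epsilon> * hfun (l n) * \<sigma> n} \<omega> \<partial>M)) \<longlonglongrightarrow> 0"
  shows "weak_conv_m (\<lambda>n. distr M borel (\<lambda>\<omega>. (\<Sum>i=1..n. X n i \<omega>) / \<sigma> n))
           std_normal_distribution"
proof -
  interpret prob_space M
    by fact
  define tail where "tail \<epsilon> n = (\<Sum>i=1..n. \<integral>\<omega>. (X n i \<omega>)\<^sup>2 *
    indicator {\<omega>. \<bar>X n i \<omega>\<bar> > \<epsilon> * hfun (l n) * \<sigma> n} \<omega> \<partial>M)" for \<epsilon> n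
  \<comment> \<open>The hypotheses say nothing about \<open>X n k\<close> for k outside 1..n; the
    zero extension meets the format of \<open>centred_array\<close>.\<close>
  define Y where "Y n k = (if 1 \<le> k \<and> k \<le> n then X n k else (\<lambda>\<omega>. 0))" for n k
  define r where "r n = rho1 M S n (\<xi> n)" for n
  have \<xi>: "\<xi> n i \<in> measurable M S" if "1 \<le> i" "i \<le> n" for n i
    using assms(2)[of n] that by (auto simp: markov_chain_def)
  have X_M: "X n i \<in> borel_measurable M" if "1 \<le> i" "i \<le> n" for n i
    unfolding assms(4)[OF that] using \<xi>[OF that] assms(3)[OF that] by measurable
  have X_gen: "X n i \<in> borel_measurable (gen_alg M S (\<xi> n) {i})" if "1 \<le> i" "i \<le> n" for n i
    unfolding assms(4)[OF that] using measurable_gen_alg[where \<xi> = "\<xi> n" and I = "{i}", OF _ \<xi>[OF that]] assms(3)[OF that] by measurable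
  have l_pos: "0 < l n" and b_pos: "0 < b n" if "1 \<le> n" for n
  proof -
    have "0 \<le> b n"
      using that by (simp add: assms(9) b_coeff_def sum_nonneg)
    then show "0 < l n" "0 < b n"
      using assms(10)[OF that] by (auto simp: zero_less_mult_iff)
  qed
  have l_eq: "l n = 1 - r n" if "1 \<le> n" for n
    using assms(7)[OF that] by (simp add: lam_def r_def)
  have array: "centred_array M (\<lambda>k. gen_alg M S (\<xi> n) {1..min k n})
      (\<lambda>k. gen_alg M S (\<xi> n) ({k} \<inter> {1..n})) (r n) n (Y n)" if n: "1 \<le> n" for n
  proof -
    have "r n < 1"
      using l_pos[OF n] l_eq[OF n] by simp
    then interpret corr_filtration M "\<lambda>k. gen_alg M S (\<xi> n) {1..min k n}"
      "\<lambda>k. gen_alg M S (\<xi> n) ({k} \<inter> {1..n})" "r n" n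
      unfolding r_def by (intro markov_chain_corr_filtration assms(2) n)
    show ?thesis
    proof
      show "Y n k \<in> L2 M (gen_alg M S (\<xi> n) ({k} \<inter> {1..n}))" for k
      proof (cases "1 \<le> k \<and> k \<le> n")
        case True
        then have "{k} \<inter> {1..n} = {k}"
          by auto
        then show ?thesis
          using X_gen[of k n] assms(6)[of k n] True by (simp add: Y_def L2_def)
      next
        case False
        then have "Y n k = (\<lambda>\<omega>. 0)"
          by (auto simp: Y_def)
        then show ?thesis
          by (simp only: L2_zero)
      qed
    qed (auto simp: Y_def assms(5))
  qed
  have sum_Y: "(\<Sum>k\<le>n. g (Y n k)) = (\<Sum>i=1..n. g (X n i))" if "g (\<lambda>\<omega>. 0) = (0::real)" for g n
  proof -
    have "(\<Sum>k\<le>n. g (Y n k)) = (\<Sum>k=1..n. g (Y n k))"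
      using that by (intro sum.mono_neutral_right) (auto simp: Y_def)
    then show ?thesis
      by (simp add: Y_def)
  qed
  have sum_Y_eq: "(\<Sum>k\<le>n. Y n k \<omega>) = (\<Sum>i=1..n. X n i \<omega>)" for n \<omega>
    by (rule sum_Y[of "\<lambda>h. h \<omega>"]) simp
  have \<sigma>_eq: "\<sigma> n = norm2 M (\<lambda>\<omega>. \<Sum>k\<le>n. Y n k \<omega>)" if "1 \<le> n" for n
  proof -
    have "(\<integral>\<omega>. (\<Sum>i=1..n. X n i \<omega>) \<partial>M) = 0"
      using X_M assms(5,6)
      by (subst Bochner_Integration.integral_sum) (auto intro: square_integrable_imp_integrable)
    then show ?thesis
      using that by (simp add: assms(8) sd_sum_def norm2_def sum_Y_eq)
  qed
  \<comment> \<open>Positivity passes from \<open>b n\<close> to \<open>\<sigma> n\<close> through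
    the lower variance bound.\<close>
  have \<sigma>_pos: "0 < \<sigma> n" if n: "1 \<le> n" for n
  proof -
    interpret centred_array M "\<lambda>k. gen_alg M S (\<xi> n) {1..min k n}"
      "\<lambda>k. gen_alg M S (\<xi> n) ({k} \<inter> {1..n})" "r n" n "Y n"
      by (rule array[OF n])
    have "(\<Sum>k\<le>n. (norm2 M (Y n k))\<^sup>2) = (\<Sum>i=1..n. (norm2 M (X n i))\<^sup>2)"
      by (rule sum_Y) (simp add: norm2_def)
    also have "\<dots> = (b n)\<^sup>2"
      using n by (simp add: assms(5,9) b_coeff_def norm2_power2 sum_nonneg)
    finally have "l n * (b n)\<^sup>2 \<le> 4 * (\<sigma> n)\<^sup>2"
      using second_moment_sum_ge n by (simp add: \<sigma>_eq l_eq)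
    moreover have "0 < l n * (b n)\<^sup>2"
      using l_pos[OF n] b_pos[OF n] by simp
    ultimately have "0 < (\<sigma> n)\<^sup>2"
      by linarith
    then show ?thesis
      using \<sigma>_eq[OF n] by (simp add: less_le)
  qed
  \<comment> \<open>The value of \<open>\<epsilon>\<close> makes (m + 1) * 2 c at most \<delta>
    \<open>\<sigma> n\<close> for the length \<open>m\<close> of
    \<open>obtain_truncation_length\<close>, uniformly in n. The threshold \<delta>^2 / 2 becomes
    (\<delta> \<open>\<sigma> n\<close>)^2 after multiplication by the factor 2 / \<open>l n\<close>
    of the upper variance bound.\<close>
  have bound: "cmod ((\<integral>\<omega>. iexp (t * ((\<Sum>i=1..n. X n i \<omega>) / \<sigma> n)) \<partial>M) - of_real (exp (- t\<^sup>2 / 2)))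
      \<le> char_const t * \<delta>"
    if n: "1 \<le> n" and \<delta>: "0 < \<delta>" "\<delta> \<le> 1 / 4" and \<epsilon>: "\<epsilon> = \<delta> / (2 * (ln (3 / \<delta>) + 3))"
      and small: "1 / (l n * (\<sigma> n)\<^sup>2) * tail \<epsilon> n \<le> \<delta>\<^sup>2 / 2" for n \<delta> \<epsilon> t
  proof -
    interpret centred_array M "\<lambda>k. gen_alg M S (\<xi> n) {1..min k n}"
      "\<lambda>k. gen_alg M S (\<xi> n) ({k} \<inter> {1..n})" "r n" n "Y n"
      by (rule array[OF n])
    have L: "0 < ln (3 / \<delta>)"
      using \<delta> by simp
    have \<epsilon>0: "0 < \<epsilon>"
      unfolding \<epsilon> by (intro divide_pos_pos mult_pos_pos add_pos_pos L \<delta>) simp_all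
    have h0: "0 \<le> hfun (l n)"
      using l_pos[OF n] by (simp add: hfun_def)
    define c where "c = \<epsilon> * hfun (l n) * \<sigma> n"
    have c0: "0 \<le> c"
      using \<epsilon>0 h0 \<sigma>_pos[OF n] by (simp add: c_def)
    obtain m where m: "r n ^ m \<le> (1 - r n) * \<delta> / 3" "real (Suc m) * hfun (1 - r n) \<le> ln (3 / \<delta>) + 3"
      using obtain_truncation_length[of "r n" \<delta>] r \<delta> by auto
    have mc: "real (Suc m) * (2 * c) \<le> \<delta> * \<sigma> n"
    proof -
      have "real (Suc m) * (2 * c) = (2 * \<epsilon> * \<sigma> n) * (real (Suc m) * hfun (1 - r n))"
        by (simp add: c_def l_eq[OF n] mult_ac)
      also have "\<dots> \<le> (2 * \<epsilon> * \<sigma> n) * (ln (3 / \<delta>) + 3)"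
        using \<epsilon>0 \<sigma>_pos[OF n] by (intro mult_left_mono m) auto
      also have "\<dots> = \<delta> * \<sigma> n"
      proof -
        have "2 * \<epsilon> * (ln (3 / \<delta>) + 3) = \<delta>"
        proof -
          have cancel: "2 * (\<delta> / (2 * y)) * y = \<delta>" if "0 < y" for y :: real
            using that by simp
          show ?thesis
            unfolding \<epsilon> by (rule cancel) (use L in linarith)
        qed
        then have "(2 * \<epsilon> * (ln (3 / \<delta>) + 3)) * \<sigma> n = \<delta> * \<sigma> n"
          by simp
        then show ?thesis
          by (simp only: mult_ac)
      qed
      finally show ?thesis .
    qed
    have tail_eq: "(\<Sum>k\<le>n. \<integral>\<omega>. (Y n k \<omega>)\<^sup>2 * indicator {\<omega>. c < \<bar>Y n k \<omega>\<bar>} \<omega> \<partial>M) = tail \<epsilon> n"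
      unfolding tail_def c_def[symmetric]
      by (rule sum_Y[of "\<lambda>h. \<integral>\<omega>. (h \<omega>)\<^sup>2 * indicator {\<omega>. c < \<bar>h \<omega>\<bar>} \<omega> \<partial>M"]) simp
    have "tail \<epsilon> n \<le> \<delta>\<^sup>2 / 2 * (l n * (\<sigma> n)\<^sup>2)"
      using small l_pos[OF n] \<sigma>_pos[OF n] by (simp add: pos_divide_le_eq)
    then have "2 / l n * tail \<epsilon> n \<le> 2 / l n * (\<delta>\<^sup>2 / 2 * (l n * (\<sigma> n)\<^sup>2))"
      using l_pos[OF n] by (intro mult_left_mono) auto
    also have "\<dots> = (\<delta> * \<sigma> n)\<^sup>2"
      using l_pos[OF n] by (simp add: power_mult_distrib)
    finally have tl: "2 / (1 - r n) * tail \<epsilon> n \<le> (\<delta> * \<sigma> n)\<^sup>2"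
      by (simp add: l_eq[OF n])
    show ?thesis
      using char_sum_bound[of c \<delta> m t, unfolded tail_eq \<sigma>_eq[OF n, symmetric],
          OF \<sigma>_pos[OF n] c0 \<delta> tl m(1) mc]
      unfolding sum_Y_eq .
  qed
  have meas: "(\<lambda>\<omega>. (\<Sum>i=1..n. X n i \<omega>) / \<sigma> n) \<in> borel_measurable M" for n
    using X_M by (intro borel_measurable_divide borel_measurable_sum borel_measurable_const) auto
  show ?thesis
  proof (rule levy_continuity)
    show "real_distribution (distr M borel (\<lambda>\<omega>. (\<Sum>i=1..n. X n i \<omega>) / \<sigma> n))" for n
      by (rule real_distribution_distr[OF meas])
    show "real_distribution std_normal_distribution"
      by (rule real_dist_normal_dist)
    fix t :: real
    have char_eq: "char (distr M borel (\<lambda>\<omega>. (\<Sum>i=1..n. X n i \<omega>) / \<sigma> n)) t =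
        (\<integral>\<omega>. iexp (t * ((\<Sum>i=1..n. X n i \<omega>) / \<sigma> n)) \<partial>M)" for n
      unfolding char_def by (rule integral_distr[OF meas]) measurable
    have "(\<lambda>n. \<integral>\<omega>. iexp (t * ((\<Sum>i=1..n. X n i \<omega>) / \<sigma> n)) \<partial>M) \<longlonglongrightarrow> of_real (exp (- t\<^sup>2 / 2))"
    proof (rule tendstoI)
      fix e :: real
      assume e: "0 < e"
      \<comment> \<open>The added 1 makes the resulting bound strictly less than \<open>e\<close>.
        For given \<open>t\<close> and \<open>e\<close> the Lindeberg condition is needed at a
        single \<open>\<epsilon>\<close> only.\<close>
      define \<delta> where "\<delta> = min (1 / 4) (e / (char_const t + 1))"
      define \<epsilon> where "\<epsilon> = \<delta> / (2 * (ln (3 / \<delta>) + 3))"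
      have C: "0 \<le> char_const t"
        by (rule char_const_nonneg)
      have "0 < \<delta>"
        using e C by (simp add: \<delta>_def)
      moreover have "\<delta> \<le> 1 / 4"
        unfolding \<delta>_def by (rule min.cobounded1)
      ultimately have \<delta>: "0 < \<delta>" "\<delta> \<le> 1 / 4" .
      have "char_const t * \<delta> \<le> char_const t * (e / (char_const t + 1))"
        using C by (intro mult_left_mono) (auto simp: \<delta>_def)
      also have "\<dots> < e"
        using C e by (simp add: field_simps)
      finally have lt: "char_const t * \<delta> < e" .
      have "0 < ln (3 / \<delta>)"
        using \<delta> by simp
      then have "0 < \<epsilon>"
        unfolding \<epsilon>_def by (intro divide_pos_pos mult_pos_pos add_pos_pos \<delta>) simp_all
      from order_tendstoD(2)[OF assms(11)[OF this], of "\<delta>\<^sup>2 / 2"] \<delta>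
      have "\<forall>\<^sub>F n in sequentially. 1 / (l n * (\<sigma> n)\<^sup>2) * tail \<epsilon> n < \<delta>\<^sup>2 / 2"
        by (simp add: tail_def)
      then show "\<forall>\<^sub>F n in sequentially.
          dist (\<integral>\<omega>. iexp (t * ((\<Sum>i=1..n. X n i \<omega>) / \<sigma> n)) \<partial>M) (of_real (exp (- t\<^sup>2 / 2))) < e"
        using eventually_ge_at_top[of 1]
      proof eventually_elim
        case (elim n)
        show ?case
          using bound[OF elim(2) \<delta> \<epsilon>_def, of t] elim(1) lt unfolding dist_norm by linarith
      qed
    qed
    then show "(\<lambda>n. char (distr M borel (\<lambda>\<omega>. (\<Sum>i=1..n. X n i \<omega>) / \<sigma> n)) t) \<longlonglongrightarrow> char std_normal_distribution t"
      by (simp only: char_eq char_std_normal_distribution)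
  qed
qed

end
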